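(* Let $n\ge 3$, $0<m<\frac{n-2}{n}$, $\beta<0$, $\alpha=\frac{2\beta-1}{1-m}$, and let $\gamma=\alpha/\beta$ satisfy $n\le\gamma<\frac{n-2}{m}$. Let $u_0$ satisfy $$A_1|x|^{-\gamma}\le u_0(x)\le A_2|x|^{-\gamma}\quad\text{in }\mathbb{R}^n\setminus\{0\}\qquad\text{and}\qquad u_0-A_0|x|^{-\gamma}\in L^1(\varphi_\mu;\mathbb{R}^n)$$ for some constants $A_2\ge A_0\ge A_1>0$ and $0<\mu<n-2$, where $\varphi_\mu$ is a weight function of the form described in the context. Let $u$ be the solution of $$u_t=\Delta(u^m/m)\ \text{ in }(\mathbb{R}^n\setminus\{0\})\times(0,\infty),\qquad u(\cdot,0)=u_0\ \text{ in }\mathbb{R}^n\setminus\{0\},$$ which satisfies $$V_{\lambda_1}\le u\le V_{\lambda_2}\quad\text{in }(\mathbb{R}^n\setminus\{0\})\times(0,\infty),$$ where $\lambda_i=A_i^{(1-m)\beta}$ for $i=1,2$. Let $$\widetilde{u}(y,\tau):=t^{\alpha}u(t^{\beta}y,t),\qquad \tau:=\log t.$$ Then as $\tau\to\infty$, $\widetilde{u}(\cdot,\tau)$ converges uniformly on each compact subset of $\mathbb{R}^n\setminus\{0\}$ and in $L^1(\varphi_\mu;\mathbb{R}^n)$ to $f_{\lambda_0}$, where $\lambda_0=A_0^{(1-m)\beta}$.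
   Context: Solutions: for $0\le u_0\in L^1_{loc}(\mathbb{R}^n\setminus\{0\})$, $u$ is a solution of the Cauchy problem if $u>0$ satisfies $u_t=\Delta(u^m/m)$ in the classical sense in $(\mathbb{R}^n\setminus\{0\})\times(0,\infty)$ and $\|u(\cdot,t)-u_0\|_{L^1(K)}\to0$ as $t\to0$ for every compact $K\subset\mathbb{R}^n\setminus\{0\}$. (It is known that the solution $u$ lying between $V_{\lambda_1}$ and $V_{\lambda_2}$ exists and is unique.) Self-similar solutions: for $\lambda>0$, $f_\lambda$ denotes the unique (existence and uniqueness are known) radially symmetric solution of $\Delta(f^m/m)+\alpha f+\beta x\cdot\nabla f=0$, $f>0$, in $\mathbb{R}^n\setminus\{0\}$ with $\lim_{|x|\to0}|x|^{\alpha/\beta}f(x)=\lambda^{\frac{1}{(1-m)\beta}}$, and $V_\lambda(x,t)=t^{-\alpha}f_\lambda(t^{-\beta}x)$ for $x\in\mathbb{R}^n\setminus\{0\}$, $t>0$. Weight: for $0<\mu<n-2$, let $\eta_1$ be a smooth non-negative radially symmetric function on $\mathbb{R}^n$ with $\eta_1(r)=0$ for $0\le r=|x|\le1$ and $\eta_1(r)=\mu(n-2-\mu)r^{-\mu-2}$ for $r\ge2$. Then $$\varphi_\mu(x)=1-a_4\int_0^{|x|}\frac{1}{s^{n-1}}\left(\int_0^s\rho^{n-1}\eta_1(\rho)\,d\rho\right)ds,\qquad a_4=\left(\int_0^\infty\frac{1}{s^{n-1}}\left(\int_0^s\rho^{n-1}\eta_1(\rho)\,d\rho\right)ds\right)^{-1}\in(0,\infty).$$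 $L^1(\varphi_\mu;\mathbb{R}^n)$ (also written $L^1(\varphi_\mu;\mathbb{R}^n\setminus\{0\})$) is the set of $v\in L^1_{loc}(\mathbb{R}^n\setminus\{0\})$ with $\int_{\mathbb{R}^n\setminus\{0\}}|v|\varphi_\mu\,dx<\infty$. *)

theory Defs
  imports "HOL-Analysis.Analysis"
begin

section \<open>Differential operators and classical regularity\<close>

definition pd :: "'a::euclidean_space \<Rightarrow> ('a \<Rightarrow> real) \<Rightarrow> 'a \<Rightarrow> real" where
  "pd i f x = frechet_derivative f (at x) i"

definition grad :: "('a::euclidean_space \<Rightarrow> real) \<Rightarrow> 'a \<Rightarrow> 'a" where
  "grad f x = (\<Sum>i\<in>Basis. pd i f x *\<^sub>R i)"

definition laplacian :: "('a::euclidean_space \<Rightarrow> real) \<Rightarrow> 'a \<Rightarrow> real" where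
  "laplacian f x = (\<Sum>i\<in>Basis. pd i (pd i f) x)"

text \<open>The class of \<open>k\<close> times continuously differentiable functions; meant for open \<open>S\<close>.\<close>

primrec Ck_on :: "nat \<Rightarrow> 'a::euclidean_space set \<Rightarrow> ('a \<Rightarrow> real) \<Rightarrow> bool" where
  "Ck_on 0 S f \<longleftrightarrow> continuous_on S f"
| "Ck_on (Suc k) S f \<longleftrightarrow>
     (\<forall>x\<in>S. f differentiable (at x)) \<and> (\<forall>i\<in>Basis. Ck_on k S (pd i f))"

definition smooth_on :: "'a::euclidean_space set \<Rightarrow> ('a \<Rightarrow> real) \<Rightarrow> bool" where
  "smooth_on S f \<longleftrightarrow> (\<forall>k. Ck_on k S f)"

text \<open>The parabolic class \<open>C\<^sup>2\<^sup>,\<^sup>1\<close> (twice in space, once in time, all these derivatives jointly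
  continuous); meant for open \<open>Q\<close>.\<close>

definition C21_on :: "('a::euclidean_space \<times> real) set \<Rightarrow> ('a \<Rightarrow> real \<Rightarrow> real) \<Rightarrow> bool" where
  "C21_on Q u \<longleftrightarrow>
     (\<forall>(x, t)\<in>Q. u x differentiable (at t) \<and> (\<lambda>y. u y t) differentiable (at x) \<and>
        (\<forall>i\<in>Basis. pd i (\<lambda>y. u y t) differentiable (at x))) \<and>
     continuous_on Q (\<lambda>(x, t). u x t) \<and>
     continuous_on Q (\<lambda>(x, t). deriv (u x) t) \<and>
     (\<forall>i\<in>Basis. continuous_on Q (\<lambda>(x, t). pd i (\<lambda>y. u y t) x)) \<and>
     (\<forall>i\<in>Basis. \<forall>j\<in>Basis. continuous_on Q (\<lambda>(x, t). pd j (pd i (\<lambda>y. u y t)) x))"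


section \<open>Function spaces on the punctured space\<close>

definition L1_loc :: "('a::euclidean_space \<Rightarrow> real) \<Rightarrow> bool" where
  "L1_loc v \<longleftrightarrow> (\<forall>K. compact K \<and> K \<subseteq> - {0} \<longrightarrow> v absolutely_integrable_on K)"

text \<open>An extended nonnegative integral, so that it is infinite (not 0) when the integrand
  is not integrable.\<close>

definition L1_norm_weighted ::
    "('a::euclidean_space \<Rightarrow> real) \<Rightarrow> 'a set \<Rightarrow> ('a \<Rightarrow> real) \<Rightarrow> ennreal" where
  "L1_norm_weighted w S v = (\<integral>\<^sup>+x\<in>S. ennreal (\<bar>v x\<bar> * w x) \<partial>lebesgue)"

definition L1_weighted :: "('a::euclidean_space \<Rightarrow> real) \<Rightarrow> ('a \<Rightarrow> real) set" where
  "L1_weighted w = {v. L1_loc v \<and> L1_norm_weighted w (- {0}) v < \<infinity>}"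


section \<open>The Cauchy problem and its self-similar solutions\<close>

text \<open>Functions on the punctured space are total here; their values at the origin, and
  those of \<open>u\<close> for nonpositive times, are irrelevant.\<close>

definition cauchy_solution ::
    "real \<Rightarrow> ('a::euclidean_space \<Rightarrow> real) \<Rightarrow> ('a \<Rightarrow> real \<Rightarrow> real) \<Rightarrow> bool" where
  "cauchy_solution m u0 u \<longleftrightarrow>
     L1_loc u0 \<and> (\<forall>x. x \<noteq> 0 \<longrightarrow> 0 \<le> u0 x) \<and>
     (\<forall>x t. x \<noteq> 0 \<and> t > 0 \<longrightarrow> u x t > 0) \<and>
     C21_on ((- {0}) \<times> {0<..}) u \<and>
     (\<forall>x t. x \<noteq> 0 \<and> t > 0 \<longrightarrow>
        deriv (u x) t = laplacian (\<lambda>y. u y t powr m / m) x) \<and>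
     (\<forall>K. compact K \<and> K \<subseteq> - {0} \<longrightarrow>
        ((\<lambda>t. L1_norm_weighted (\<lambda>_. 1) K (\<lambda>x. u x t - u0 x)) \<longlongrightarrow> 0) (at_right 0))"

definition self_similar_profile ::
    "real \<Rightarrow> real \<Rightarrow> real \<Rightarrow> real \<Rightarrow> ('a::euclidean_space \<Rightarrow> real) \<Rightarrow> bool" where
  "self_similar_profile m \<alpha> \<beta> lam f \<longleftrightarrow>
     (\<forall>x y. x \<noteq> 0 \<and> norm x = norm y \<longrightarrow> f x = f y) \<and>
     (\<forall>x. x \<noteq> 0 \<longrightarrow> f x > 0) \<and>
     Ck_on 2 (- {0}) f \<and>
     (\<forall>x. x \<noteq> 0 \<longrightarrow>
        laplacian (\<lambda>y. f y powr m / m) x + \<alpha> * f x + \<beta> * (x \<bullet> grad f x) = 0) \<and>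
     ((\<lambda>x. norm x powr (\<alpha> / \<beta>) * f x) \<longlongrightarrow> lam powr (1 / ((1 - m) * \<beta>))) (at 0)"

definition self_similar ::
    "real \<Rightarrow> real \<Rightarrow> ('a::euclidean_space \<Rightarrow> real) \<Rightarrow> 'a \<Rightarrow> real \<Rightarrow> real" where
  "self_similar \<alpha> \<beta> f x t = t powr (- \<alpha>) * f (t powr (- \<beta>) *\<^sub>R x)"

definition rescaled ::
    "real \<Rightarrow> real \<Rightarrow> ('a::euclidean_space \<Rightarrow> real \<Rightarrow> real) \<Rightarrow> 'a \<Rightarrow> real \<Rightarrow> real" where
  "rescaled \<alpha> \<beta> u y \<tau> = (let t = exp \<tau> in t powr \<alpha> * u (t powr \<beta> *\<^sub>R y) t)"


section \<open>The weight\<close>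

text \<open>The radially symmetric function \<open>\<eta>\<^sub>1\<close> is represented by its radial profile
  \<open>\<eta>\<close>, so that \<open>\<eta>\<^sub>1 x = \<eta> (norm x)\<close>; only the values of \<open>\<eta>\<close> on nonnegative reals matter.
  The type argument only carries the ambient space.\<close>

definition weight_source :: "'a::euclidean_space itself \<Rightarrow> real \<Rightarrow> (real \<Rightarrow> real) \<Rightarrow> bool" where
  "weight_source _ \<mu> \<eta> \<longleftrightarrow>
     smooth_on UNIV (\<lambda>x::'a. \<eta> (norm x)) \<and>
     (\<forall>r\<ge>0. \<eta> r \<ge> 0) \<and>
     (\<forall>r. 0 \<le> r \<and> r \<le> 1 \<longrightarrow> \<eta> r = 0) \<and>
     (\<forall>r\<ge>2. \<eta> r = \<mu> * (real DIM('a) - 2 - \<mu>) * r powr (- \<mu> - 2))"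

definition weight_integrand :: "nat \<Rightarrow> (real \<Rightarrow> real) \<Rightarrow> real \<Rightarrow> real" where
  "weight_integrand n \<eta> s = 1 / s ^ (n - 1) * integral {0..s} (\<lambda>\<rho>. \<rho> ^ (n - 1) * \<eta> \<rho>)"

definition weight_const :: "nat \<Rightarrow> (real \<Rightarrow> real) \<Rightarrow> real" where
  "weight_const n \<eta> = inverse (integral {0..} (weight_integrand n \<eta>))"

definition weight :: "(real \<Rightarrow> real) \<Rightarrow> 'a::euclidean_space \<Rightarrow> real" where
  "weight \<eta> x =
     1 - weight_const DIM('a) \<eta> * integral {0..norm x} (weight_integrand DIM('a) \<eta>)"

end

theory Submission
  imports Defs
begin

text \<open>Rescaled solutions \<open>U(x, s) = T\<^sup>\<alpha> u(T\<^sup>\<beta> x, T s)\<close> solve the same equation, lie between the same self-similar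
  solutions, and at \<open>s = 1\<close> equal the function \<open>rescaled\<close> at \<open>\<tau> = ln T\<close>. The weight is comparable to the superharmonic function
  \<open>W = (1 + \<bar>x\<bar>\<^sup>2) powr (-\<mu>/2)\<close>, so Kato's inequality makes \<open>\<integral> \<bar>U - V\<bar> W\<close> nonincreasing in time; the contributions of the cutoffs
  at the origin and at infinity vanish because \<open>m \<gamma> < n - 2\<close> and because the profiles decay almost like
  \<open>\<bar>x\<bar> powr (-(n - 2)/m)\<close>. Since \<open>\<gamma> \<ge> n\<close>, rescaling the initial difference sends its weighted norm to \<open>0\<close> by dominated
  convergence, which is the convergence in the weighted norm.

  For uniform convergence no parabolic regularity theory is needed. By comparison, \<open>s powr (-1/(1 - m)) U(x, s)\<close> is nonincreasing
  in \<open>s\<close>, so \<open>U(x, 1)\<^sup>m\<close> is pinched between averages of \<open>U(x, s)\<^sup>m\<close> over short time intervals after and before \<open>1\<close>. The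
  Laplacian of such an average is a difference of two values of \<open>U\<close>, hence bounded, and a mean value estimate turns
  the integral convergence of the averages into locally uniform convergence.\<close>

section \<open>Differential calculus and Green's identity\<close>

text \<open>As \<gamma> \<ge> n, the solutions are not integrable near the origin, so only
  differences can be tested, and only against weights cut off there. A cutoff at a small radius
  \<delta> costs \<delta>^(n - 2 - m \<gamma>), because u is at most a multiple of |x|^(-\<gamma>).
  A cutoff at a large radius R costs R^(n - 2 - \<kappa> - \<mu>) when u^m decays like
  |x|^(-\<kappa>). The bound |x|^(-\<gamma>) gives only \<kappa> = m \<gamma>, and m \<gamma> +
  \<mu> may be less than n - 2; this is why the ordinary differential equation of the profiles is
  studied. At positive times they decay faster, at the price of a factor that is singular as t tends
  to 0. The positive part of u^m - v^m is at most u^m, so these growth bounds are asked of one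
  solution only. The contraction is also the comparison principle of the proof: ordered initial data
  make its right side vanish, and continuity turns a vanishing integral into a pointwise order. The
  length \<delta> of the averaging intervals is fixed before the radius r of the mean value balls:
  the bounded Laplacian causes an error of order r^2 that must be small against \<delta>.\<close>

lemma pd_eqI: "(f has_derivative f') (at x) \<Longrightarrow> pd i f x = f' i"
  unfolding pd_def using frechet_derivative_at by metis

lemma pd_has_derivative:
  "f differentiable (at x) \<Longrightarrow> (f has_derivative (\<lambda>h. pd h f x)) (at x)"
  unfolding pd_def using frechet_derivative_works by fastforce

text \<open>\<open>frechet_derivative\<close> chooses from the set of derivatives at x, which
  depends only on the function near x; hence the values agree even where the functions are not
  differentiable.\<close>

lemma pd_cong:
  assumes "open S" "x \<in> S" "\<And>y. y \<in> S \<Longrightarrow> f y = g y"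
  shows "pd i f x = pd i g x"
proof -
  have "(f has_derivative D) (at x) \<longleftrightarrow> (g has_derivative D) (at x)" for D
    using assms by (metis has_derivative_transform_within_open)
  then show ?thesis by (simp add: pd_def frechet_derivative_def)
qed

lemma differentiable_cong_open:
  assumes "open S" "x \<in> S" "\<And>y. y \<in> S \<Longrightarrow> f y = g y" "g differentiable (at x)"
  shows "f differentiable (at x)"
  using assms(4) has_derivative_transform_within_open[OF _ assms(1,2)] assms(3)
  unfolding differentiable_def by metis

lemma laplacian_cong:
  assumes "open S" "x \<in> S" "\<And>y. y \<in> S \<Longrightarrow> f y = g y"
  shows "laplacian f x = laplacian g x"
  unfolding laplacian_def using assms by (intro sum.cong refl pd_cong[of S]) (auto intro: pd_cong)

lemma pd_has_real_derivative_line: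
  assumes "f differentiable (at (x + t *\<^sub>R i))"
  shows "((\<lambda>s. f (x + s *\<^sub>R i)) has_real_derivative pd i f (x + t *\<^sub>R i)) (at t)"
proof -
  have lin: "linear (\<lambda>h. pd h f (x + t *\<^sub>R i))"
    using pd_has_derivative[OF assms] has_derivative_linear by blast
  have "((\<lambda>s. f (x + s *\<^sub>R i)) has_derivative (\<lambda>s. pd (s *\<^sub>R i) f (x + t *\<^sub>R i))) (at t)"
    by (rule has_derivative_compose[of "\<lambda>s. x + s *\<^sub>R i", OF _ pd_has_derivative[OF assms]])
       (auto intro!: derivative_eq_intros)
  then show ?thesis
    using linear_scale[OF lin] by (simp add: has_field_derivative_def mult_commute_abs)
qed

lemma differentiable_compose_real:
  assumes "(G has_real_derivative D) (at (g x))" "g differentiable (at x)"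
  shows "((\<lambda>y. G (g y)) has_derivative (\<lambda>h. D * pd h g x)) (at x)"
  using has_derivative_compose[OF pd_has_derivative[OF assms(2)], of G "\<lambda>h. D * h"] assms(1)
  by (simp add: has_field_derivative_def)

lemma pd_compose_real:
  assumes "(G has_real_derivative D) (at (g x))" "g differentiable (at x)"
  shows "pd i (\<lambda>y. G (g y)) x = D * pd i g x"
  by (rule pd_eqI[OF differentiable_compose_real[OF assms]])

lemma pd_mult:
  fixes f g :: "'a::euclidean_space \<Rightarrow> real"
  assumes "f differentiable (at x)" "g differentiable (at x)"
  shows "pd i (\<lambda>y. f y * g y) x = f x * pd i g x + pd i f x * g x"
  by (rule pd_eqI[OF has_derivative_mult[OF pd_has_derivative[OF assms(1)] pd_has_derivative[OF assms(2)]]])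

lemma pd_diff:
  assumes "f differentiable (at x)" "g differentiable (at x)"
  shows "pd i (\<lambda>y. f y - g y) x = pd i f x - pd i g x"
  by (rule pd_eqI[OF has_derivative_diff[OF pd_has_derivative[OF assms(1)] pd_has_derivative[OF assms(2)]]])

lemma pd_scaled:
  fixes g :: "'a::euclidean_space \<Rightarrow> real"
  assumes "g differentiable (at (k *\<^sub>R x))"
  shows "(\<lambda>y. c * g (k *\<^sub>R y)) differentiable (at x)"
    "pd i (\<lambda>y. c * g (k *\<^sub>R y)) x = c * k * pd i g (k *\<^sub>R x)"
proof -
  have lin: "linear (\<lambda>h. pd h g (k *\<^sub>R x))"
    using pd_has_derivative[OF assms] has_derivative_linear by blast
  have "((\<lambda>y. g (k *\<^sub>R y)) has_derivative (\<lambda>h. pd (k *\<^sub>R h) g (k *\<^sub>R x))) (at x)"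
    by (rule has_derivative_compose[of "\<lambda>y. k *\<^sub>R y", OF _ pd_has_derivative[OF assms]])
       (auto intro!: derivative_eq_intros)
  then have *: "((\<lambda>y. c * g (k *\<^sub>R y)) has_derivative (\<lambda>h. c * pd (k *\<^sub>R h) g (k *\<^sub>R x))) (at x)"
    by (rule has_derivative_mult_right)
  then show "(\<lambda>y. c * g (k *\<^sub>R y)) differentiable (at x)" by (auto simp: differentiable_def)
  show "pd i (\<lambda>y. c * g (k *\<^sub>R y)) x = c * k * pd i g (k *\<^sub>R x)"
    using pd_eqI[OF *, of i] linear_scale[OF lin] by simp
qed

lemma pd_norm_sq:
  "((\<lambda>y::'a::euclidean_space. (norm (y - c))\<^sup>2) has_derivative (\<lambda>h. 2 * ((x - c) \<bullet> h))) (at x)"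
  unfolding power2_norm_eq_inner
  by (auto intro!: derivative_eq_intros simp: inner_commute)

lemma Ck_on_2:
  "Ck_on 2 S f \<longleftrightarrow> (\<forall>x\<in>S. f differentiable (at x)) \<and>
     (\<forall>i\<in>Basis. (\<forall>x\<in>S. pd i f differentiable (at x)) \<and>
        (\<forall>j\<in>Basis. continuous_on S (pd j (pd i f))))"
  by (auto simp: numeral_2_eq_2)

lemma Ck_on_2_continuous:
  assumes "Ck_on 2 S f"
  shows "continuous_on S f" "i \<in> Basis \<Longrightarrow> continuous_on S (pd i f)"
  using assms unfolding Ck_on_2
  by (auto intro!: continuous_at_imp_continuous_on differentiable_imp_continuous_within)

lemma Ck_on_2_laplacian: "Ck_on 2 S f \<Longrightarrow> continuous_on S (laplacian f)"
  unfolding Ck_on_2 laplacian_def by (intro continuous_intros) auto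

text \<open>This second-order chain rule has three uses: powers of solutions, radial functions of |x
  - c|^2, and Kato's inequality, where convexity of G makes the gradient term nonnegative. The
  derivatives of G are required on the image only, which admits powers that are singular at
  0.\<close>

lemma Ck_on_2_compose:
  fixes g :: "'a::euclidean_space \<Rightarrow> real"
  assumes U: "open U" and g: "Ck_on 2 U g"
    and G1: "\<And>s. s \<in> g ` U \<Longrightarrow> (G has_real_derivative G' s) (at s)"
    and G2: "\<And>s. s \<in> g ` U \<Longrightarrow> (G' has_real_derivative G'' s) (at s)"
    and G3: "continuous_on (g ` U) G''"
  shows "Ck_on 2 U (\<lambda>x. G (g x))"
    and "\<And>x i. x \<in> U \<Longrightarrow> pd i (\<lambda>x. G (g x)) x = G' (g x) * pd i g x"
    and "\<And>x. x \<in> U \<Longrightarrow> laplacian (\<lambda>x. G (g x)) x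
       = G' (g x) * laplacian g x + G'' (g x) * (\<Sum>i\<in>Basis. (pd i g x)\<^sup>2)"
proof -
  have gd: "x \<in> U \<Longrightarrow> g differentiable (at x)" for x using g by (auto simp: Ck_on_2)
  have gdd: "x \<in> U \<Longrightarrow> i \<in> Basis \<Longrightarrow> pd i g differentiable (at x)" for x i using g by (auto simp: Ck_on_2)
  have cg: "continuous_on U g" "\<And>i. i \<in> Basis \<Longrightarrow> continuous_on U (pd i g)" using Ck_on_2_continuous[OF g] by auto
  have cgg: "i \<in> Basis \<Longrightarrow> j \<in> Basis \<Longrightarrow> continuous_on U (pd j (pd i g))" for i j using g by (auto simp: Ck_on_2)
  have c1: "continuous_on (g ` U) G'" 
    using G2 by (meson DERIV_continuous continuous_at_imp_continuous_on)
  have p: "pd i (\<lambda>x. G (g x)) x = G' (g x) * pd i g x" if "x \<in> U" for x i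
    using pd_compose_real[OF G1 gd[OF that]] that by auto
  show "pd i (\<lambda>x. G (g x)) x = G' (g x) * pd i g x" if "x \<in> U" for x i using p[OF that] .
  have D1: "(\<lambda>x. G (g x)) differentiable (at x)" if "x \<in> U" for x
    using differentiable_compose_real[OF G1 gd[OF that]] that unfolding differentiable_def by blast
  have DG': "(\<lambda>x. G' (g x)) differentiable (at x)" if "x \<in> U" for x
    using differentiable_compose_real[OF G2 gd[OF that]] that unfolding differentiable_def by blast
  have pG': "pd j (\<lambda>x. G' (g x)) x = G'' (g x) * pd j g x" if "x \<in> U" for x j
    using pd_compose_real[OF G2 gd[OF that]] that by auto
  have D2: "(pd i (\<lambda>x. G (g x))) differentiable (at x)" if "x \<in> U" "i \<in> Basis" for x i
  proof -
    have "(\<lambda>x. G' (g x) * pd i g x) differentiable (at x)"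
      using DG'[OF that(1)] gdd[OF that] by (rule differentiable_mult)
    then show ?thesis
      by (rule differentiable_cong_open[OF U that(1), rotated]) (rule p)
  qed
  have p2: "pd j (pd i (\<lambda>x. G (g x))) x = G' (g x) * pd j (pd i g) x + G'' (g x) * (pd j g x * pd i g x)"
    if "x \<in> U" "i \<in> Basis" for x i j
  proof -
    have "pd j (pd i (\<lambda>x. G (g x))) x = pd j (\<lambda>x. G' (g x) * pd i g x) x"
      by (rule pd_cong[OF U that(1)]) (use p in auto)
    also have "\<dots> = G' (g x) * pd j (pd i g) x + G'' (g x) * (pd j g x * pd i g x)"
      using pd_mult[OF DG'[OF that(1)] gdd[OF that]] pG'[OF that(1)] by simp
    finally show ?thesis .
  qed
  have c2: "continuous_on U (pd j (pd i (\<lambda>x. G (g x))))" if "i \<in> Basis" "j \<in> Basis" for i j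
  proof -
    have "continuous_on U (\<lambda>x. G' (g x) * pd j (pd i g) x + G'' (g x) * (pd j g x * pd i g x))"
      using cgg that cg by (intro continuous_intros continuous_on_compose2[OF c1] continuous_on_compose2[OF G3]) auto
    then show ?thesis using p2 that by (simp cong: continuous_on_cong)
  qed
  show "Ck_on 2 U (\<lambda>x. G (g x))" unfolding Ck_on_2 using D1 D2 c2 by auto
  show "laplacian (\<lambda>x. G (g x)) x
       = G' (g x) * laplacian g x + G'' (g x) * (\<Sum>i\<in>Basis. (pd i g x)\<^sup>2)" if "x \<in> U" for x
    unfolding laplacian_def using p2[OF that] 
    by (simp add: sum.distrib sum_distrib_left power2_eq_square)
qed

lemma Ck_on_2_norm_sq:
  fixes c :: "'a::euclidean_space"
  shows "Ck_on 2 U (\<lambda>y. (norm (y - c))\<^sup>2)"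
    and "pd h (\<lambda>y. (norm (y - c))\<^sup>2) x = 2 * ((x - c) \<bullet> h)"
    and "laplacian (\<lambda>y. (norm (y - c))\<^sup>2) x = 2 * real DIM('a)"
proof -
  have p: "pd h (\<lambda>y. (norm (y - c))\<^sup>2) = (\<lambda>x. 2 * ((x - c) \<bullet> h))" for h
    using pd_eqI[OF pd_norm_sq] by blast
  then show "pd h (\<lambda>y. (norm (y - c))\<^sup>2) x = 2 * ((x - c) \<bullet> h)" by simp
  have d: "((\<lambda>x. 2 * ((x - c) \<bullet> h)) has_derivative (\<lambda>k. 2 * (k \<bullet> h))) (at x)" for h x
    by (auto intro!: derivative_eq_intros)
  have pp: "pd k (\<lambda>x. 2 * ((x - c) \<bullet> h)) = (\<lambda>x. 2 * (k \<bullet> h))" for h k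
    using pd_eqI[OF d] by blast
  show "Ck_on 2 U (\<lambda>y. (norm (y - c))\<^sup>2)"
    unfolding Ck_on_2 p pp using pd_norm_sq d by (auto simp: differentiable_def) blast
  show "laplacian (\<lambda>y. (norm (y - c))\<^sup>2) x = 2 * real DIM('a)"
    unfolding laplacian_def p pp by simp
qed

text \<open>The variable |x - c|^2 is smooth at the centre, unlike |x - c|, so weights, cutoffs and
  bumps need no separate argument there.\<close>

lemma Ck_on_2_radial:
  fixes c :: "'a::euclidean_space"
  assumes U: "open U"
    and G1: "\<And>x. x \<in> U \<Longrightarrow> (G has_real_derivative G' ((norm (x - c))\<^sup>2)) (at ((norm (x - c))\<^sup>2))"
    and G2: "\<And>x. x \<in> U \<Longrightarrow> (G' has_real_derivative G'' ((norm (x - c))\<^sup>2)) (at ((norm (x - c))\<^sup>2))"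
    and G3: "continuous_on ((\<lambda>x. (norm (x - c))\<^sup>2) ` U) G''"
  shows "Ck_on 2 U (\<lambda>x. G ((norm (x - c))\<^sup>2))"
    and "\<And>x i. x \<in> U \<Longrightarrow> pd i (\<lambda>x. G ((norm (x - c))\<^sup>2)) x = 2 * G' ((norm (x - c))\<^sup>2) * ((x - c) \<bullet> i)"
    and "\<And>x. x \<in> U \<Longrightarrow> laplacian (\<lambda>x. G ((norm (x - c))\<^sup>2)) x
       = 2 * real DIM('a) * G' ((norm (x - c))\<^sup>2) + 4 * (norm (x - c))\<^sup>2 * G'' ((norm (x - c))\<^sup>2)"
proof -
  have G1': "(G has_real_derivative G' s) (at s)" if "s \<in> (\<lambda>y. (norm (y - c))\<^sup>2) ` U" for s
    using that G1 by auto
  have G2': "(G' has_real_derivative G'' s) (at s)" if "s \<in> (\<lambda>y. (norm (y - c))\<^sup>2) ` U" for s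
    using that G2 by auto
  note C = Ck_on_2_compose[OF U Ck_on_2_norm_sq(1)[of U c], of G G' G'', OF G1' G2' G3]
  have s: "(\<Sum>i\<in>Basis. (pd i (\<lambda>x. (norm (x - c))\<^sup>2) x)\<^sup>2) = 4 * (norm (x - c))\<^sup>2" for x
    unfolding Ck_on_2_norm_sq(2) power_mult_distrib sum_distrib_left[symmetric]
    using euclidean_inner[of "x - c" "x - c"] power2_norm_eq_inner[of "x - c"]
    by (simp add: power2_eq_square)
  show "Ck_on 2 U (\<lambda>x. G ((norm (x - c))\<^sup>2))" by (rule C(1))
  show "pd i (\<lambda>x. G ((norm (x - c))\<^sup>2)) x = 2 * G' ((norm (x - c))\<^sup>2) * ((x - c) \<bullet> i)" if "x \<in> U" for x i
    using C(2)[OF _ _ that, of i] by (simp add: Ck_on_2_norm_sq(2))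
  show "laplacian (\<lambda>x. G ((norm (x - c))\<^sup>2)) x
       = 2 * real DIM('a) * G' ((norm (x - c))\<^sup>2) + 4 * (norm (x - c))\<^sup>2 * G'' ((norm (x - c))\<^sup>2)" 
    if "x \<in> U" for x
    using C(3)[OF _ _ that] s by (simp add: Ck_on_2_norm_sq(3) mult_ac)
qed

lemma Ck_on_2_diff:
  fixes f g :: "'a::euclidean_space \<Rightarrow> real"
  assumes U: "open U" and "Ck_on 2 U f" "Ck_on 2 U g"
  shows "Ck_on 2 U (\<lambda>x. f x - g x)"
    "x \<in> U \<Longrightarrow> laplacian (\<lambda>x. f x - g x) x = laplacian f x - laplacian g x"
proof -
  have p: "x \<in> U \<Longrightarrow> pd i (\<lambda>x. f x - g x) x = pd i f x - pd i g x" for x i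
    using assms by (intro pd_diff) (auto simp: Ck_on_2)
  have pp: "x \<in> U \<Longrightarrow> i \<in> Basis \<Longrightarrow> pd j (pd i (\<lambda>x. f x - g x)) x = pd j (pd i f) x - pd j (pd i g) x" for x i j
    using assms pd_cong[OF U, of x "pd i (\<lambda>x. f x - g x)" "\<lambda>x. pd i f x - pd i g x" j] p
      pd_diff[of "pd i f" x "pd i g" j] by (auto simp: Ck_on_2)
  have "pd i (\<lambda>x. f x - g x) differentiable at x" if "x \<in> U" "i \<in> Basis" for x i
  proof -
    have "(\<lambda>x. pd i f x - pd i g x) differentiable at x"
      using assms that by (intro differentiable_diff) (auto simp: Ck_on_2)
    then show ?thesis
      by (rule differentiable_cong_open[OF U that(1), rotated]) (rule p)
  qed
  moreover have "i \<in> Basis \<Longrightarrow> j \<in> Basis \<Longrightarrow> continuous_on U (pd j (pd i (\<lambda>x. f x - g x)))" for i j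
    using assms pp by (auto simp: Ck_on_2 cong: continuous_on_cong intro!: continuous_intros)
  ultimately show "Ck_on 2 U (\<lambda>x. f x - g x)" using assms unfolding Ck_on_2 by (auto intro!: differentiable_diff)
  show "x \<in> U \<Longrightarrow> laplacian (\<lambda>x. f x - g x) x = laplacian f x - laplacian g x"
    unfolding laplacian_def using pp by (simp add: sum_subtractf)
qed

lemma Ck_on_2_scaled:
  fixes g :: "'a::euclidean_space \<Rightarrow> real"
  assumes U: "open U" and g: "Ck_on 2 U g" and V: "V = (\<lambda>x. k *\<^sub>R x) -` U"
  shows "Ck_on 2 V (\<lambda>x. c * g (k *\<^sub>R x))"
    "k *\<^sub>R x \<in> U \<Longrightarrow> laplacian (\<lambda>x. c * g (k *\<^sub>R x)) x = c * k\<^sup>2 * laplacian g (k *\<^sub>R x)"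
proof -
  have oV: "open V" unfolding V by (rule open_vimage[OF U]) (auto intro!: continuous_intros)
  have p: "x \<in> V \<Longrightarrow> pd i (\<lambda>x. c * g (k *\<^sub>R x)) x = (c * k) * pd i g (k *\<^sub>R x)" for x i
    using g by (intro pd_scaled(2)) (auto simp: Ck_on_2 V)
  have pp: "pd j (pd i (\<lambda>x. c * g (k *\<^sub>R x))) x = c * k\<^sup>2 * pd j (pd i g) (k *\<^sub>R x)" 
    if "x \<in> V" "i \<in> Basis" for x i j
  proof -
    have "pd j (pd i (\<lambda>x. c * g (k *\<^sub>R x))) x = pd j (\<lambda>x. (c * k) * pd i g (k *\<^sub>R x)) x"
      using p by (intro pd_cong[OF oV]) (use that in auto)
    also have "\<dots> = c * k\<^sup>2 * pd j (pd i g) (k *\<^sub>R x)"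
      using g that by (subst pd_scaled(2)) (auto simp: Ck_on_2 V power2_eq_square)
    finally show ?thesis .
  qed
  have "pd i (\<lambda>x. c * g (k *\<^sub>R x)) differentiable at x" if "x \<in> V" "i \<in> Basis" for x i
  proof -
    have "(\<lambda>x. (c * k) * pd i g (k *\<^sub>R x)) differentiable at x"
      using g that by (intro pd_scaled) (auto simp: Ck_on_2 V)
    then show ?thesis
      by (rule differentiable_cong_open[OF oV that(1), rotated]) (rule p)
  qed
  moreover have "i \<in> Basis \<Longrightarrow> j \<in> Basis \<Longrightarrow> continuous_on V (pd j (pd i (\<lambda>x. c * g (k *\<^sub>R x))))" for i j
  proof -
    assume ij: "i \<in> Basis" "j \<in> Basis"
    then have "continuous_on U (pd j (pd i g))" using g by (auto simp: Ck_on_2)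
    then have "continuous_on V (\<lambda>x. pd j (pd i g) (k *\<^sub>R x))"
      by (rule continuous_on_compose2[of U]) (auto simp: V intro!: continuous_intros)
    then have "continuous_on V (\<lambda>x. c * k\<^sup>2 * pd j (pd i g) (k *\<^sub>R x))"
      by (rule continuous_on_mult_left)
    then show "continuous_on V (pd j (pd i (\<lambda>x. c * g (k *\<^sub>R x))))" using pp ij by (simp cong: continuous_on_cong)
  qed
  moreover have "x \<in> V \<Longrightarrow> (\<lambda>x. c * g (k *\<^sub>R x)) differentiable at x" for x
    using g by (intro pd_scaled) (auto simp: Ck_on_2 V)
  ultimately show "Ck_on 2 V (\<lambda>x. c * g (k *\<^sub>R x))" unfolding Ck_on_2 by auto
  show "k *\<^sub>R x \<in> U \<Longrightarrow> laplacian (\<lambda>x. c * g (k *\<^sub>R x)) x = c * k\<^sup>2 * laplacian g (k *\<^sub>R x)"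
    unfolding laplacian_def using pp by (simp add: V sum_distrib_left)
qed

section \<open>Integration of compactly supported functions\<close>

lemma continuous_on_zero_extension:
  fixes F :: "'a::euclidean_space \<Rightarrow> real"
  assumes "open U" "compact K" "K \<subseteq> U" "continuous_on U F" "\<And>x. x \<notin> K \<Longrightarrow> F x = 0"
  shows "continuous_on S F"
proof -
  have "continuous_on (- K) F"
    using assms(5) by (subst continuous_on_cong[where g="\<lambda>_. 0"]) auto
  then have "continuous_on (U \<union> - K) F"
    using assms compact_imp_closed by (intro continuous_on_open_Un) auto
  moreover have "U \<union> - K = UNIV" using assms(3) by auto
  ultimately show ?thesis by (metis continuous_on_subset subset_UNIV)
qed

lemma integrable_compact_support:
  fixes F :: "'a::euclidean_space \<Rightarrow> real"
  assumes "compact K" "continuous_on K F" "\<And>x. x \<notin> K \<Longrightarrow> F x = 0"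
  shows "integrable lborel F"
proof -
  have "(\<lambda>x. indicator K x *\<^sub>R F x) = F" using assms(3) by (auto simp: indicator_def fun_eq_iff)
  then show ?thesis using borel_integrable_compact[OF assms(1,2)] by simp
qed

lemma bounded_compact_support:
  fixes F :: "'a::euclidean_space \<Rightarrow> real"
  assumes "compact K" "continuous_on K F" "\<And>x. x \<notin> K \<Longrightarrow> F x = 0"
  obtains B where "B > 0" "\<And>x. \<bar>F x\<bar> \<le> B"
proof -
  have "bounded (F ` K)" using compact_continuous_image[OF assms(2,1)] compact_imp_bounded by blast
  then obtain B where B: "B > 0" "\<And>x. x \<in> K \<Longrightarrow> \<bar>F x\<bar> \<le> B" by (auto simp: bounded_pos)
  then have "\<bar>F x\<bar> \<le> B" for x using assms(3)[of x] by (cases "x \<in> K") auto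
  with B show ?thesis using that by blast
qed

lemma integral_translate:
  fixes F :: "'a::euclidean_space \<Rightarrow> real"
  assumes "F \<in> borel_measurable borel"
  shows "(\<integral>x. F (x + c) \<partial>lborel) = (\<integral>x. F x \<partial>lborel)"
    "integrable lborel F \<Longrightarrow> integrable lborel (\<lambda>x. F (x + c))"
proof -
  have d: "distr lborel borel (\<lambda>x. x + c) = lborel"
    using lborel_distr_plus[of c] by (subst add.commute) (simp add: comp_def)
  show "(\<integral>x. F (x + c) \<partial>lborel) = (\<integral>x. F x \<partial>lborel)"
    using integral_distr[of "\<lambda>x. x + c" lborel borel F] assms by (simp add: d)
  show "integrable lborel F \<Longrightarrow> integrable lborel (\<lambda>x. F (x + c))"
    using integrable_distr[of "\<lambda>x. x + c" lborel borel F] d by simp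
qed

lemma pd_zero_outside:
  assumes "compact K" "\<And>x. x \<notin> K \<Longrightarrow> F x = 0" "x \<notin> K"
  shows "pd i F x = 0"
proof -
  have "pd i F x = pd i (\<lambda>_. 0) x" 
    using assms compact_imp_closed by (intro pd_cong[of "- K"]) auto
  then show ?thesis using pd_eqI[OF has_derivative_const] by metis
qed

text \<open>Differentiate the translation invariance of the integral.\<close>

lemma integral_pd_eq_0:
  fixes F :: "'a::euclidean_space \<Rightarrow> real"
  assumes d: "\<And>x. F differentiable (at x)" and c: "continuous_on UNIV (pd i F)"
    and K: "compact K" "\<And>x. x \<notin> K \<Longrightarrow> F x = 0"
  shows "(\<integral>x. pd i F x \<partial>lborel) = 0"
proof -
  have cF: "continuous_on UNIV F"
    using d by (simp add: continuous_at_imp_continuous_on differentiable_imp_continuous_within)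
  have p0: "pd i F x = 0" if "x \<notin> K" for x
    by (rule pd_zero_outside[OF K that])
  obtain B where B: "B > 0" "\<And>x. \<bar>pd i F x\<bar> \<le> B" 
    using bounded_compact_support[OF K(1) continuous_on_subset[OF c subset_UNIV] p0] by metis
  have iF: "integrable lborel F"
    by (rule integrable_compact_support[OF K(1) continuous_on_subset[OF cF subset_UNIV] K(2)])
  \<comment> \<open>The points from which a step s i with 0 \<le> s \<le> 1 can reach
    \<open>K\<close>. All difference quotients \<open>q k\<close> vanish outside this compact set,
    so one integrable majorant serves every k.\<close>
  define K' where "K' = (\<lambda>z. fst z - snd z *\<^sub>R i) ` (K \<times> {0..1::real})"
  have cK': "compact K'" unfolding K'_def
    by (intro compact_continuous_image compact_Times K continuous_intros) auto
  define q where "q k x = real (Suc k) * (F (x + inverse (real (Suc k)) *\<^sub>R i) - F x)" for k x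
  have "(\<lambda>k. \<integral>x. q k x \<partial>lborel) \<longlonglongrightarrow> (\<integral>x. pd i F x \<partial>lborel)"
  proof (rule integral_dominated_convergence[where w="\<lambda>x. B * indicator K' x"])
    show "(pd i F) \<in> borel_measurable lborel" using c by (simp add: borel_measurable_continuous_onI)
    have "continuous_on UNIV (q k)" for k unfolding q_def
      by (intro continuous_intros continuous_on_compose2[OF cF]) auto
    then show "q k \<in> borel_measurable lborel" for k by (simp add: borel_measurable_continuous_onI)
    have "emeasure lborel K' < \<infinity>" using cK' emeasure_compact_finite by blast
    then show "integrable lborel (\<lambda>x. B * indicator K' x)" using cK'
      by (intro integrable_mult_right integrable_real_indicator) (auto intro: borel_compact)
    have "(\<lambda>k. q k x) \<longlonglongrightarrow> pd i F x" for x
    proof -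
      have "((\<lambda>s. F (x + s *\<^sub>R i)) has_real_derivative pd i F x) (at 0)"
        using pd_has_real_derivative_line[of F x 0 i] d by simp
      then have *: "((\<lambda>h. (F (x + h *\<^sub>R i) - F x) / h) \<longlongrightarrow> pd i F x) (at 0)"
        by (simp add: DERIV_def)
      have "filterlim (\<lambda>k. inverse (real (Suc k))) (at 0) sequentially"
        using LIMSEQ_inverse_real_of_nat by (auto simp: filterlim_at)
      from filterlim_compose[OF * this] show ?thesis by (simp add: q_def field_simps)
    qed
    then show "AE x in lborel. (\<lambda>k. q k x) \<longlonglongrightarrow> pd i F x" by simp
    have "norm (q k x) \<le> B * indicator K' x" for k x
    proof -
      let ?h = "inverse (real (Suc k))"
      have h: "0 < ?h" "?h \<le> 1" by (auto simp: field_simps)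
      have "\<exists>z. 0 < z \<and> z < ?h \<and> F (x + ?h *\<^sub>R i) - F (x + 0 *\<^sub>R i) = (?h - 0) * pd i F (x + z *\<^sub>R i)"
        by (rule MVT2) (use h in \<open>auto intro!: pd_has_real_derivative_line d\<close>)
      then obtain z where z: "0 < z" "z < ?h" "F (x + ?h *\<^sub>R i) - F x = ?h * pd i F (x + z *\<^sub>R i)" by auto
      then have q: "q k x = pd i F (x + z *\<^sub>R i)" unfolding q_def by simp
      show ?thesis
      proof (cases "x + z *\<^sub>R i \<in> K")
        case True
        then have "x \<in> K'" unfolding K'_def using z h
          by (intro image_eqI[of _ _ "(x + z *\<^sub>R i, z)"]) auto
        then show ?thesis using q B by simp
      next
        case False
        then show ?thesis using q p0 B by (simp add: indicator_def)
      qed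
    qed
    then show "AE x in lborel. norm (q k x) \<le> B * indicator K' x" for k by simp
  qed
  moreover have "(\<integral>x. q k x \<partial>lborel) = 0" for k
  proof -
    have "F \<in> borel_measurable borel" using cF by (simp add: borel_measurable_continuous_onI)
    from integral_translate[OF this] iF show ?thesis
      by (simp add: q_def Bochner_Integration.integral_diff)
  qed
  ultimately show ?thesis by (simp add: LIMSEQ_const_iff)
qed

lemma laplacian_zero_outside:
  assumes "compact K" "\<And>x. x \<notin> K \<Longrightarrow> F x = 0" "x \<notin> K"
  shows "laplacian F x = 0"
  unfolding laplacian_def using pd_zero_outside[OF assms(1) pd_zero_outside[OF assms(1,2)]] assms(3) by simp

text \<open>The flux \<open>F i\<close>, which is \<xi> times the derivative of h minus h times the
  derivative of \<xi>, vanishes off \<open>K\<close>, so it is differentiable everywhere although h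
  is regular on \<open>U\<close> only. Its derivative in direction i integrates to 0. In this form
  the identity applies to functions that are singular at the origin.\<close>

lemma green_identity:
  fixes h \<xi> :: "'a::euclidean_space \<Rightarrow> real"
  assumes U: "open U" and h: "Ck_on 2 U h" and \<xi>: "Ck_on 2 UNIV \<xi>"
    and K: "compact K" "K \<subseteq> U" "\<And>x. x \<notin> K \<Longrightarrow> \<xi> x = 0"
  shows "(\<integral>x. \<xi> x * laplacian h x \<partial>lborel) = (\<integral>x. h x * laplacian \<xi> x \<partial>lborel)"
    and "integrable lborel (\<lambda>x. \<xi> x * laplacian h x)"
    and "integrable lborel (\<lambda>x. h x * laplacian \<xi> x)"
proof -
  have nK: "open (- K)" using K compact_imp_closed by auto
  note Kp = pd_zero_outside[OF K(1,3)] and Kpp = pd_zero_outside[OF K(1) pd_zero_outside[OF K(1,3)]]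
  have hd: "x \<in> U \<Longrightarrow> h differentiable at x" "x \<in> U \<Longrightarrow> i \<in> Basis \<Longrightarrow> pd i h differentiable at x" for x i
    using h by (auto simp: Ck_on_2)
  have xd: "\<xi> differentiable at x" "i \<in> Basis \<Longrightarrow> pd i \<xi> differentiable at x" for x i
    using \<xi> by (auto simp: Ck_on_2)
  define F where "F i x = \<xi> x * pd i h x - h x * pd i \<xi> x" for i x
  have F0: "x \<notin> K \<Longrightarrow> F i x = 0" for x i unfolding F_def using K(3) Kp by simp
  have dF: "F i differentiable at x" if "i \<in> Basis" for i x
  proof (cases "x \<in> K")
    case True
    then show ?thesis unfolding F_def using hd xd that K(2)
      by (intro differentiable_diff differentiable_mult) auto
  next
    case False
    have "((\<lambda>_. 0::real) has_derivative (\<lambda>_. 0)) (at x)" by simp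
    then have "(F i has_derivative (\<lambda>_. 0)) (at x)"
      by (rule has_derivative_transform_within_open[OF _ nK]) (use False F0 in auto)
    then show ?thesis by (auto simp: differentiable_def)
  qed
  have pF: "pd i (F i) x = \<xi> x * pd i (pd i h) x - h x * pd i (pd i \<xi>) x" if i: "i \<in> Basis" for i x
  proof (cases "x \<in> K")
    case True
    then have xU: "x \<in> U" using K by auto
    show ?thesis unfolding F_def 
      by (subst pd_diff, (intro differentiable_mult hd xd xU i)+, subst pd_mult, (intro hd xd xU i)+, subst pd_mult, (intro hd xd xU i)+)
         (simp add: algebra_simps)
  next
    case False
    then show ?thesis using pd_zero_outside[OF K(1) F0] K(3) Kpp by simp
  qed
  have c1: "continuous_on S (\<lambda>x. \<xi> x * pd i (pd i h) x)" if "i \<in> Basis" for i S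
  proof (rule continuous_on_zero_extension[OF U K(1,2)])
    have "continuous_on U (pd i (pd i h))" using h that by (auto simp: Ck_on_2)
    then show "continuous_on U (\<lambda>x. \<xi> x * pd i (pd i h) x)"
      using continuous_on_subset[OF Ck_on_2_continuous(1)[OF \<xi>] subset_UNIV] by (intro continuous_intros)
  qed (use K(3) in simp)
  have c2: "continuous_on S (\<lambda>x. h x * pd i (pd i \<xi>) x)" if "i \<in> Basis" for i S
  proof (rule continuous_on_zero_extension[OF U K(1,2)])
    have "continuous_on U (pd i (pd i \<xi>))" using \<xi> that continuous_on_subset[OF _ subset_UNIV] unfolding Ck_on_2 by metis
    then show "continuous_on U (\<lambda>x. h x * pd i (pd i \<xi>) x)"
      using Ck_on_2_continuous(1)[OF h] by (intro continuous_intros)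
    show "x \<notin> K \<Longrightarrow> h x * pd i (pd i \<xi>) x = 0" for x using Kpp by simp
  qed
  have i1: "integrable lborel (\<lambda>x. \<xi> x * pd i (pd i h) x)" if "i \<in> Basis" for i
    by (rule integrable_compact_support[OF K(1) c1[OF that]]) (use K(3) in auto)
  have i2: "integrable lborel (\<lambda>x. h x * pd i (pd i \<xi>) x)" if "i \<in> Basis" for i
    by (rule integrable_compact_support[OF K(1) c2[OF that]]) (use Kpp in auto)
  have e: "(\<integral>x. \<xi> x * pd i (pd i h) x \<partial>lborel) = (\<integral>x. h x * pd i (pd i \<xi>) x \<partial>lborel)" if i: "i \<in> Basis" for i
  proof -
    have "continuous_on UNIV (pd i (F i))" using c1[OF i, of UNIV] c2[OF i, of UNIV]
      by (subst continuous_on_cong[OF refl pF[OF i]]) (rule continuous_on_diff)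
    from integral_pd_eq_0[OF dF[OF i] this K(1) F0] show ?thesis
      using i1[OF i] i2[OF i] by (simp add: pF[OF i] Bochner_Integration.integral_diff)
  qed
  show "integrable lborel (\<lambda>x. \<xi> x * laplacian h x)" "integrable lborel (\<lambda>x. h x * laplacian \<xi> x)"
    unfolding laplacian_def sum_distrib_left using i1 i2 by auto
  show "(\<integral>x. \<xi> x * laplacian h x \<partial>lborel) = (\<integral>x. h x * laplacian \<xi> x \<partial>lborel)"
    unfolding laplacian_def sum_distrib_left using i1 i2 e by simp
qed

section \<open>Decay of self-similar profiles\<close>

text \<open>Every monotonicity argument for the profiles uses an integrating factor e^(k s), which
  is the power weight r^k in the radius r = e^s.\<close>

lemma has_real_derivative_exp_weight:
  fixes f :: "real \<Rightarrow> real"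
  assumes "(f has_real_derivative d) (at s)"
  shows "((\<lambda>s. exp (k * s) * f s) has_real_derivative exp (k * s) * (k * f s + d)) (at s)"
proof -
  have "((\<lambda>s. exp (k * s)) has_real_derivative k * exp (k * s)) (at s)"
    by (auto intro!: derivative_eq_intros)
  from DERIV_mult[OF this assms] show ?thesis by (simp add: distrib_left mult_ac)
qed

text \<open>The profile equation in the logarithmic variable \<open>s = ln \<bar>x\<bar>\<close>, with \<open>N\<close> the dimension, \<open>g = \<gamma>\<close>
  and \<open>b = -\<beta>\<close>.\<close>

locale log_profile =
  fixes m g b N :: real and F F1 p2 :: "real \<Rightarrow> real"
  assumes m: "0 < m" "m < 1" and N: "N \<ge> 3" "N \<le> g" "m * g < N - 2" and b: "b > 0"
    and F_pos: "\<And>s. F s > 0"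
    and F_deriv: "\<And>s. (F has_real_derivative F1 s) (at s)"
    and p1_deriv: "\<And>s. ((\<lambda>s. F s powr (m - 1) * F1 s) has_real_derivative p2 s) (at s)"
    and ode: "\<And>s. p2 s + (N - 2) * (F s powr (m - 1) * F1 s) = b * exp (2 * s) * (g * F s + F1 s)"
begin

definition "p s = F s powr m / m"
definition "p1 s = F s powr (m - 1) * F1 s"
definition "G s = p1 s + m * g * p s"

lemma p_pos: "p s > 0"
  using F_pos[of s] m by (simp add: p_def)

lemma p_deriv: "(p has_real_derivative p1 s) (at s)"
  unfolding p_def[abs_def] p1_def using F_pos[of s] m
  by (auto intro!: derivative_eq_intros F_deriv)

lemma p1_deriv': "(p1 has_real_derivative p2 s) (at s)"
  using p1_deriv[of s] by (simp add: p1_def[abs_def])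

lemma F_powr: "F s powr (1 - m) * F s powr (m - 1) = 1" "F s powr m = F s powr (m - 1) * F s"
  "F s = F s powr (1 - m) * (m * p s)"
  using F_pos[of s] m by (auto simp: powr_add[symmetric] powr_mult_base p_def mult.commute[of _ "F s"])

lemma G_eq: "G s = F s powr (m - 1) * (g * F s + F1 s)"
  using m by (simp add: G_def p_def p1_def F_powr(2) algebra_simps)

lemma ode_p: "p2 s + (N - 2) * p1 s = b * exp (2 * s) * (g * F s + F1 s)"
  using ode[of s] by (simp add: p1_def)

lemma source_eq: "g * F s + F1 s = F s powr (1 - m) * G s"
  using F_powr(1)[of s] by (simp add: G_eq mult.assoc[symmetric])

text \<open>With this integrating factor the equation for \<open>G\<close> has only a source and a
  nonnegative multiple of \<open>G\<close> on the right. The source is positive because m \<gamma> <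
  n - 2.\<close>

lemma weighted_G_deriv:
  "((\<lambda>s. exp ((N - 2 - m * g) * s) * G s) has_real_derivative
     exp ((N - 2 - m * g) * s) * ((N - 2 - m * g) * m * g * p s + b * exp (2 * s) * (F s powr (1 - m) * G s))) (at s)"
proof -
  have "p2 s = b * exp (2 * s) * (F s powr (1 - m) * G s) - (N - 2) * p1 s"
    using ode_p[of s] source_eq[of s] by simp
  then have e: "(N - 2 - m * g) * G s + (p2 s + m * g * p1 s)
      = (N - 2 - m * g) * m * g * p s + b * exp (2 * s) * (F s powr (1 - m) * G s)"
    by (simp add: G_def algebra_simps)
  have "(G has_real_derivative p2 s + m * g * p1 s) (at s)"
    unfolding G_def[abs_def] by (intro DERIV_add DERIV_cmult p_deriv p1_deriv')
  from has_real_derivative_exp_weight[OF this, of "N - 2 - m * g"] show ?thesis unfolding e .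
qed

text \<open>\<open>G\<close> has the sign of the derivative of \<open>\<bar>x\<bar>\<^sup>\<gamma> f\<close>. Once positive it stays positive, and then \<open>F\<close> blows up at a
  finite \<open>s\<close>; hence \<open>\<bar>x\<bar>\<^sup>\<gamma> f\<close> is nonincreasing.\<close>

lemma G_stays_positive:
  assumes "G s1 > 0" "s1 \<le> s"
  shows "G s > 0"
proof (rule ccontr)
  let ?k = "N - 2 - m * g"
  assume neg: "\<not> G s > 0"
  have cG: "continuous_on S G" for S unfolding G_def[abs_def]
    by (intro continuous_on_add continuous_on_mult_left)
       (auto intro!: continuous_at_imp_continuous_on DERIV_isCont p_deriv p1_deriv')
  define Z where "Z = {x \<in> {s1..s}. G x \<le> 0}"
  have "closed ({s1..s} \<inter> G -` {..0})" by (rule continuous_closed_preimage[OF cG]) auto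
  then have "compact ({s1..s} \<inter> ({s1..s} \<inter> G -` {..0}))" by (rule compact_Int_closed[OF compact_Icc])
  moreover have "Z = {s1..s} \<inter> ({s1..s} \<inter> G -` {..0})" by (auto simp: Z_def)
  ultimately have Zc: "compact Z" by simp
  have "s \<in> Z" using neg assms by (auto simp: Z_def)
  \<comment> \<open>The first point at which \<open>G\<close> is not positive; up to it the weighted
    \<open>G\<close> increases, which is the contradiction.\<close>
  then obtain z where z: "z \<in> Z" "\<And>x. x \<in> Z \<Longrightarrow> z \<le> x" using compact_attains_inf[OF Zc] by blast
  have "G z \<le> 0" "s1 \<le> z" using z(1) by (auto simp: Z_def)
  with assms(1) have s1z: "s1 < z" by (cases "s1 = z") auto
  have "exp (?k * s1) * G s1 \<le> exp (?k * z) * G z"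
  proof (rule DERIV_nonneg_imp_increasing_open[where f="\<lambda>s. exp (?k * s) * G s"])
    show "s1 \<le> z" using s1z by simp
    fix x assume x: "s1 < x" "x < z"
    then have "x \<notin> Z" using z(2)[of x] by linarith
    then have "G x > 0" using x z(1) by (auto simp: Z_def)
    then have "0 \<le> exp (?k * x) * (?k * m * g * p x + b * exp (2 * x) * (F x powr (1 - m) * G x))"
      using N m b p_pos[of x] by (intro mult_nonneg_nonneg add_nonneg_nonneg) auto
    then show "\<exists>y. ((\<lambda>s. exp (?k * s) * G s) has_real_derivative y) (at x) \<and> 0 \<le> y"
      using weighted_G_deriv by blast
  qed (intro continuous_intros cG)
  moreover note \<open>G z \<le> 0\<close>
  moreover have "exp (?k * s1) * G s1 > 0" using assms by simp
  ultimately show False by (smt (verit) exp_gt_zero mult_nonneg_nonpos)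
qed

text \<open>The hypothesis says F^(m - 2) F' \<ge> c, so F^(m - 1) has slope at most -(1 - m) c. A
  positive quantity cannot decrease linearly on a half-line.\<close>

lemma blow_up:
  assumes c: "c > 0" "\<And>s. s \<ge> s0 \<Longrightarrow> c * F s \<le> p1 s"
  shows False
proof -
  define q where "q s = F s powr (m - 1) + (1 - m) * c * s" for s
  have "q s \<le> q s0" if "s0 \<le> s" for s
  proof (rule DERIV_nonpos_imp_nonincreasing[OF that])
    fix x assume x: "s0 \<le> x"
    have "F1 x = F x powr (1 - m) * p1 x" using F_powr(1)[of x] by (simp add: p1_def mult.assoc[symmetric])
    then have "F x powr (m - 2) * F1 x = F x powr (- 1) * p1 x"
      using F_pos[of x] by (simp add: powr_add[symmetric] mult.assoc[symmetric])
    also have "\<dots> \<ge> F x powr (- 1) * (c * F x)" using c(2)[OF x] by (intro mult_left_mono) auto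
    also have "F x powr (- 1) * (c * F x) = c" using F_pos[of x] by (simp add: powr_minus field_simps)
    finally have "F x powr (m - 2) * F1 x \<ge> c" .
    then have "(m - 1) * (F x powr (m - 2) * F1 x) + (1 - m) * c \<le> 0"
      using m mult_left_mono[of c "F x powr (m - 2) * F1 x" "1 - m"] by (simp add: algebra_simps)
    moreover have "(q has_real_derivative ((m - 1) * (F x powr (m - 2) * F1 x) + (1 - m) * c)) (at x)"
      unfolding q_def[abs_def] using F_pos[of x]
      by (auto intro!: derivative_eq_intros F_deriv simp: algebra_simps)
    ultimately show "\<exists>y. (q has_real_derivative y) (at x) \<and> y \<le> 0" by blast
  qed
  moreover define s where "s = max s0 ((q s0 + 1) / ((1 - m) * c))"
  have "q s0 + 1 \<le> (1 - m) * c * s" using c m by (simp add: s_def field_simps max_def)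
  then have "q s > q s0" using F_pos[of s] by (smt (verit) powr_ge_zero q_def)
  moreover have "s0 \<le> s" by (simp add: s_def)
  ultimately show False by (meson not_le)
qed

text \<open>Where \<open>G\<close> is nonnegative, \<open>p\<close> may still decrease, but e^((N -
  2) s) \<open>p1\<close> is nondecreasing, which keeps \<open>p1\<close> above - m g p(s1) e^((N -
  2) (s1 - s)). The integrated loss is at most the fraction m g / (N - 2) of p(s1), and this
  fraction is less than 1.\<close>

lemma p_bounded_below:
  assumes "\<And>s. s \<ge> s1 \<Longrightarrow> G s \<ge> 0" "s \<ge> s1"
  shows "p s1 * (1 - m * g / (N - 2)) \<le> p s"
proof -
  let ?n = "N - 2"
  have e: "exp (?n * s1) * p1 s1 \<le> exp (?n * x) * p1 x" if "s1 \<le> x" for x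
  proof (rule DERIV_nonneg_imp_nondecreasing[OF that])
    fix y assume "s1 \<le> y"
    then have "0 \<le> exp (?n * y) * (p2 y + ?n * p1 y)"
      using assms(1)[of y] b by (subst ode_p) (simp add: source_eq)
    moreover have "((\<lambda>s. exp (?n * s) * p1 s) has_real_derivative exp (?n * y) * (p2 y + ?n * p1 y)) (at y)"
      using has_real_derivative_exp_weight[OF p1_deriv', of ?n y] by (simp only: add.commute)
    ultimately show "\<exists>d. ((\<lambda>s. exp (?n * s) * p1 s) has_real_derivative d) (at y) \<and> 0 \<le> d" by blast
  qed
  let ?a = "m * g * p s1"
  have lb: "- ?a * exp (?n * (s1 - x)) \<le> p1 x" if "s1 \<le> x" for x
  proof -
    have "- ?a \<le> p1 s1" using assms(1)[of s1] by (simp add: G_def)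
    then have "exp (?n * s1) * (- ?a) \<le> exp (?n * x) * p1 x" using e[OF that]
      by (smt (verit) exp_gt_zero mult_left_mono)
    then have "exp (?n * s1) * (- ?a) * exp (- (?n * x)) \<le> exp (?n * x) * p1 x * exp (- (?n * x))"
      by (rule mult_right_mono) simp
    moreover have "exp (?n * x) * p1 x * exp (- (?n * x)) = p1 x" by (simp add: exp_minus)
    moreover have "exp (?n * s1) * (- ?a) * exp (- (?n * x)) = - ?a * exp (?n * (s1 - x))"
      by (simp add: right_diff_distrib exp_diff exp_minus divide_inverse)
    ultimately show ?thesis by (simp only:)
  qed
  define r where "r x = p x - ?a / ?n * exp (?n * (s1 - x))" for x
  have "r s1 \<le> r s"
  proof (rule DERIV_nonneg_imp_nondecreasing[OF assms(2)])
    fix x assume "s1 \<le> x"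
    have "((\<lambda>x. exp (?n * (s1 - x))) has_real_derivative - ?n * exp (?n * (s1 - x))) (at x)"
      by (auto intro!: derivative_eq_intros)
    from DERIV_diff[OF p_deriv[of x] DERIV_cmult[OF this, of "?a / ?n"]]
    have "(r has_real_derivative p1 x + ?a * exp (?n * (s1 - x))) (at x)"
      unfolding r_def[abs_def] using N by (auto simp: field_simps elim!: DERIV_cong)
    moreover have "0 \<le> p1 x + ?a * exp (?n * (s1 - x))" using lb[OF \<open>s1 \<le> x\<close>] by simp
    ultimately show "\<exists>y. (r has_real_derivative y) (at x) \<and> 0 \<le> y" by blast
  qed
  moreover have "r s \<le> p s" using m N p_pos[of s1] by (simp add: r_def)
  moreover have "r s1 = p s1 * (1 - m * g / ?n)" using N by (simp add: r_def field_simps)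
  ultimately show ?thesis by simp
qed

text \<open>If \<open>G\<close> were positive somewhere, it would stay positive and \<open>F\<close>
  would be bounded below. The divergence form of the equation would then give p1 \<ge> (b / 2) F for
  large s, which \<open>blow_up\<close> excludes.\<close>

lemma G_nonpos: "G s \<le> 0"
proof (rule ccontr)
  assume "\<not> G s \<le> 0"
  then have Gp: "x \<ge> s \<Longrightarrow> G x \<ge> 0" for x using G_stays_positive[of s x] by simp
  define c where "c = p s * (1 - m * g / (N - 2))"
  have c: "c > 0" unfolding c_def using p_pos N by (intro mult_pos_pos) (auto simp: field_simps)
  define c1 where "c1 = (m * c) powr (1 / m)"
  have c1: "c1 > 0" using c m by (simp add: c1_def)
  have Fc: "c1 \<le> F x" if "x \<ge> s" for x
  proof -
    have "c \<le> p x" unfolding c_def by (rule p_bounded_below[OF Gp that])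
    then have "m * c \<le> F x powr m" using m by (simp add: p_def field_simps)
    then have "(m * c) powr (1 / m) \<le> (F x powr m) powr (1 / m)" using m c by (intro powr_mono2) auto
    then show ?thesis using m F_pos[of x] by (simp add: powr_powr c1_def)
  qed
  \<comment> \<open>The divergence form of the profile equation: h' = b (g - N) e^(N s) F, which is
    nonnegative because \<gamma> \<ge> n.\<close>
  define h where "h x = exp ((N - 2) * x) * p1 x - b * exp (N * x) * F x" for x
  have hm: "h s \<le> h x" if "s \<le> x" for x
  proof (rule DERIV_nonneg_imp_nondecreasing[OF that])
    fix y
    have "(h has_real_derivative exp ((N - 2) * y) * ((N - 2) * p1 y + p2 y) - b * (exp (N * y) * (N * F y + F1 y))) (at y)"
      unfolding h_def[abs_def] mult.assoc
      by (intro DERIV_diff DERIV_cmult has_real_derivative_exp_weight F_deriv p1_deriv')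
    then have "(h has_real_derivative exp ((N - 2) * y) * (p2 y + (N - 2) * p1 y) - b * exp (N * y) * (N * F y + F1 y)) (at y)"
      by (simp only: add.commute mult.assoc)
    moreover have "exp ((N - 2) * y) * exp (2 * y) = exp (N * y)"
      by (simp add: left_diff_distrib flip: exp_add)
    then have "exp ((N - 2) * y) * (p2 y + (N - 2) * p1 y) = b * exp (N * y) * (g * F y + F1 y)"
      unfolding ode_p by (metis mult.assoc mult.commute)
    moreover have "b * exp (N * y) * (N * F y + F1 y) \<le> b * exp (N * y) * (g * F y + F1 y)"
      using b N F_pos[of y] by (intro mult_left_mono) auto
    ultimately show "\<exists>d. (h has_real_derivative d) (at y) \<and> 0 \<le> d" by (metis diff_ge_0_iff_ge)
  qed
  define H where "H = \<bar>h s\<bar>"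
  \<comment> \<open>Beyond this point \<open>H\<close> is at most half of b e^(N x) F, since F \<ge>
    c1. The maximum with 0 ensures e^((N - 2) x) \<le> e^(N x).\<close>
  define s0 where "s0 = max (max s 0) (ln (1 + 2 * H / (b * c1)))"
  have "(b / 2) * F x \<le> p1 x" if x: "x \<ge> s0" for x
  proof -
    have x0: "x \<ge> 0" "x \<ge> s" using x by (auto simp: s0_def)
    have "1 + 2 * H / (b * c1) > 0" using b c1 by (simp add: H_def add_pos_nonneg)
    moreover have "ln (1 + 2 * H / (b * c1)) \<le> x" using x by (simp add: s0_def)
    ultimately have "1 + 2 * H / (b * c1) \<le> exp x" by (metis exp_le_cancel_iff exp_ln)
    then have "2 * H \<le> exp x * (b * c1)" using b c1 by (simp add: field_simps) (smt (verit) mult_pos_pos)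
    also have "\<dots> \<le> exp (N * x) * (b * F x)" using Fc[of x] x0 b N c1
      by (intro mult_mono) (auto simp: mult_le_cancel_right1)
    finally have H2: "H \<le> b * exp (N * x) * F x / 2" by (simp add: mult_ac)
    have "b * exp (N * x) * F x - H \<le> exp ((N - 2) * x) * p1 x" using hm[of x] x0 by (simp add: h_def H_def)
    then have "b * exp (N * x) * F x / 2 \<le> exp ((N - 2) * x) * p1 x" using H2 by simp
    moreover have "exp ((N - 2) * x) * (b * F x / 2) \<le> b * exp (N * x) * F x / 2"
    proof -
      have "exp ((N - 2) * x) \<le> exp (N * x)" using x0 by (simp add: mult_right_mono)
      then have "exp ((N - 2) * x) * (b * F x / 2) \<le> exp (N * x) * (b * F x / 2)"
        using b F_pos[of x] by (intro mult_right_mono) auto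
      then show ?thesis by (simp add: mult_ac)
    qed
    ultimately have "exp ((N - 2) * x) * (b * F x / 2) \<le> exp ((N - 2) * x) * p1 x"
      by (rule order_trans[rotated])
    then have "b * F x / 2 \<le> p1 x" by (simp only: mult_le_cancel_left_pos[OF exp_gt_zero])
    then show ?thesis by simp
  qed
  from blow_up[OF _ this] b show False by simp
qed

lemma profile_antimono:
  assumes "s \<le> t" shows "exp (g * t) * F t \<le> exp (g * s) * F s"
proof (rule DERIV_nonpos_imp_nonincreasing[OF assms])
  fix x
  have "((\<lambda>s. exp (g * s) * F s) has_real_derivative exp (g * x) * (g * F x + F1 x)) (at x)"
    by (rule has_real_derivative_exp_weight[OF F_deriv])
  moreover have "exp (g * x) * (g * F x + F1 x) \<le> 0"
    unfolding source_eq using G_nonpos[of x] by (simp add: mult_nonneg_nonpos)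
  ultimately show "\<exists>y. ((\<lambda>s. exp (g * s) * F s) has_real_derivative y) (at x) \<and> y \<le> 0" by blast
qed

lemma p_tendsto_0: "(p \<longlongrightarrow> 0) at_top"
proof (rule tendsto_sandwich)
  show "\<forall>\<^sub>F s in at_top. 0 \<le> p s" using p_pos by (auto intro!: always_eventually less_imp_le)
  show "\<forall>\<^sub>F s in at_top. p s \<le> (F 0 * exp (- g * s)) powr m / m"
  proof (rule eventually_mono[OF eventually_ge_at_top[of 0]])
    fix s :: real assume "0 \<le> s"
    then have "F s \<le> F 0 * exp (- g * s)" using profile_antimono[of 0 s] by (simp add: exp_minus field_simps)
    then show "p s \<le> (F 0 * exp (- g * s)) powr m / m"
      unfolding p_def using m F_pos[of s] by (intro divide_right_mono powr_mono2) auto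
  qed
  have e: "(F 0 * exp (- g * s)) powr m / m = F 0 powr m / m * exp (- (g * m) * s)" for s
    using F_pos[of 0] by (simp add: powr_mult powr_def[of "exp _"] mult_ac)
  have "((\<lambda>s. exp (- (g * m) * s)) \<longlongrightarrow> 0) at_top"
    using m N by (intro filterlim_compose[OF exp_at_bot] filterlim_tendsto_neg_mult_at_bot[OF tendsto_const]) (auto simp: filterlim_ident)
  then have "((\<lambda>s. F 0 powr m / m * exp (- (g * m) * s)) \<longlongrightarrow> F 0 powr m / m * 0) at_top"
    by (intro tendsto_intros)
  then show "((\<lambda>s. (F 0 * exp (- g * s)) powr m / m) \<longlongrightarrow> 0) at_top" unfolding e by simp
qed simp

text \<open>The defect \<open>Y\<close>, left side minus right side, is nondecreasing: Y' = b (g -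
  2) e^(2 s) F. If it were positive once, the slope of \<open>p\<close> would eventually be at least
  half of it, contrary to the convergence of \<open>p\<close> to 0.\<close>

lemma flux_bound: "p1 s + (N - 2) * p s \<le> b * exp (2 * s) * F s"
proof (rule ccontr)
  define Y where "Y s = p1 s + (N - 2) * p s - b * exp (2 * s) * F s" for s
  assume "\<not> ?thesis"
  then have c: "Y s > 0" by (simp add: Y_def)
  have Ym: "Y s \<le> Y x" if "s \<le> x" for x
  proof (rule DERIV_nonneg_imp_nondecreasing[OF that])
    fix y
    have "(Y has_real_derivative (p2 y + (N - 2) * p1 y) - b * (exp (2 * y) * (2 * F y + F1 y))) (at y)"
      unfolding Y_def[abs_def] mult.assoc
      by (intro DERIV_diff DERIV_add DERIV_cmult has_real_derivative_exp_weight F_deriv p1_deriv' p_deriv)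
    then have "(Y has_real_derivative (p2 y + (N - 2) * p1 y) - b * exp (2 * y) * (2 * F y + F1 y)) (at y)"
      by (simp only: mult.assoc)
    moreover have "b * exp (2 * y) * (2 * F y + F1 y) \<le> p2 y + (N - 2) * p1 y"
      unfolding ode_p using b N F_pos[of y] by (intro mult_left_mono) auto
    ultimately show "\<exists>d. (Y has_real_derivative d) (at y) \<and> 0 \<le> d" by (metis diff_ge_0_iff_ge)
  qed
  have "\<forall>\<^sub>F x in at_top. p x < Y s / (2 * (N - 2))"
    using order_tendstoD(2)[OF p_tendsto_0, of "Y s / (2 * (N - 2))"] c N by simp
  then obtain x0 where x0: "\<And>x. x \<ge> x0 \<Longrightarrow> p x < Y s / (2 * (N - 2))" by (auto simp: eventually_at_top_linorder)
  define x1 where "x1 = max s x0"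
  have d: "Y s / 2 \<le> p1 x" if "x1 \<le> x" for x
  proof -
    have "Y s \<le> p1 x + (N - 2) * p x" using Ym[of x] that b F_pos[of x]
      by (smt (verit) Y_def exp_gt_zero max.bounded_iff mult_nonneg_nonneg x1_def)
    moreover have "(N - 2) * p x \<le> Y s / 2" using x0[of x] that N by (simp add: x1_def field_simps)
    ultimately show ?thesis by simp
  qed
  \<comment> \<open>A slope of at least Y s / 2 over an interval of length 2 raises \<open>p\<close>
    to at least Y s, whereas \<open>p\<close> is already below Y s / (2 (N - 2)).\<close>
  have "p x1 - Y s / 2 * x1 \<le> p (x1 + 2) - Y s / 2 * (x1 + 2)"
  proof (rule DERIV_nonneg_imp_nondecreasing[where f="\<lambda>x. p x - Y s / 2 * x"])
    fix x assume "x1 \<le> x"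
    have "((\<lambda>x. p x - Y s / 2 * x) has_real_derivative p1 x - Y s / 2) (at x)"
      by (auto intro!: derivative_eq_intros p_deriv)
    then show "\<exists>d. ((\<lambda>x. p x - Y s / 2 * x) has_real_derivative d) (at x) \<and> 0 \<le> d"
      using d[OF \<open>x1 \<le> x\<close>] by fastforce
  qed simp
  then have "Y s \<le> p (x1 + 2)" using p_pos[of x1] by (simp add: field_simps)
  moreover have "p (x1 + 2) < Y s / (2 * (N - 2))" by (rule x0) (simp add: x1_def)
  moreover have "Y s / (2 * (N - 2)) \<le> Y s" using c N by (simp add: field_simps)
  ultimately show False by simp
qed

text \<open>Since F = F^(1 - m) m p, the right side of \<open>flux_bound\<close> is \<open>p\<close>
  times a coefficient of size at most e^((2 - g (1 - m)) s) up to a constant, which tends to 0.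
  Eventually p' \<le> -(N - 2 - \<epsilon>) p.\<close>

lemma p_decay:
  assumes \<epsilon>: "\<epsilon> > 0" and g: "g * (1 - m) > 2"
  obtains C s0 where "C > 0" "\<And>s. s \<ge> s0 \<Longrightarrow> p s \<le> C * exp (- (N - 2 - \<epsilon>) * s)"
proof -
  let ?D = "b * m * F 0 powr (1 - m)"
  have "((\<lambda>s. ?D * exp ((2 - g * (1 - m)) * s)) \<longlongrightarrow> ?D * 0) at_top"
    using g by (intro tendsto_intros filterlim_compose[OF exp_at_bot] filterlim_tendsto_neg_mult_at_bot[OF tendsto_const])
      (auto simp: filterlim_ident)
  then have "\<forall>\<^sub>F s in at_top. ?D * exp ((2 - g * (1 - m)) * s) < \<epsilon>" using \<epsilon> by (intro order_tendstoD(2)) auto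
  then obtain s1 where s1: "\<And>s. s \<ge> s1 \<Longrightarrow> ?D * exp ((2 - g * (1 - m)) * s) < \<epsilon>" by (auto simp: eventually_at_top_linorder)
  define s0 where "s0 = max s1 0"
  let ?k = "N - 2 - \<epsilon>"
  have slope: "?k * p s + p1 s \<le> 0" if "s \<ge> s0" for s
  proof -
    have "F s \<le> F 0 * exp (- g * s)"
      using profile_antimono[of 0 s] that by (simp add: exp_minus field_simps s0_def)
    then have "F s powr (1 - m) \<le> (F 0 * exp (- g * s)) powr (1 - m)"
      using m F_pos[of s] by (intro powr_mono2) auto
    also have "\<dots> = F 0 powr (1 - m) * exp (- (g * (1 - m)) * s)"
      using F_pos[of 0] by (simp add: powr_mult powr_def[of "exp _"] mult_ac)
    finally have Fm: "F s powr (1 - m) \<le> F 0 powr (1 - m) * exp (- (g * (1 - m)) * s)" .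
    have "p1 s + (N - 2) * p s \<le> b * exp (2 * s) * (F s powr (1 - m) * (m * p s))"
      using flux_bound[of s] F_powr(3)[of s] by simp
    also have "\<dots> \<le> b * exp (2 * s) * (F 0 powr (1 - m) * exp (- (g * (1 - m)) * s) * (m * p s))"
      using Fm b m p_pos[of s] by (intro mult_left_mono mult_right_mono) auto
    also have "\<dots> = ?D * exp ((2 - g * (1 - m)) * s) * p s"
      by (simp add: exp_add[symmetric] exp_diff exp_minus field_simps)
    also have "\<dots> \<le> \<epsilon> * p s" using s1[of s] that p_pos[of s] by (intro mult_right_mono) (auto simp: s0_def)
    finally show ?thesis by (simp add: algebra_simps)
  qed
  have "p s \<le> p s0 * exp (?k * s0) * exp (- ?k * s)" if "s \<ge> s0" for s
  proof -
    have "exp (?k * s) * p s \<le> exp (?k * s0) * p s0"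
    proof (rule DERIV_nonpos_imp_nonincreasing[OF that])
      fix x assume "s0 \<le> x"
      have "((\<lambda>s. exp (?k * s) * p s) has_real_derivative exp (?k * x) * (?k * p x + p1 x)) (at x)"
        by (rule has_real_derivative_exp_weight[OF p_deriv])
      moreover have "exp (?k * x) * (?k * p x + p1 x) \<le> 0"
        using slope[OF \<open>s0 \<le> x\<close>] by (simp add: mult_nonneg_nonpos)
      ultimately show "\<exists>y. ((\<lambda>s. exp (?k * s) * p s) has_real_derivative y) (at x) \<and> y \<le> 0" by blast
    qed
    then have "exp (?k * s) * p s * exp (- ?k * s) \<le> exp (?k * s0) * p s0 * exp (- ?k * s)"
      by (rule mult_right_mono) simp
    moreover have "exp (?k * s) * exp (- ?k * s) = 1" unfolding exp_add[symmetric] by (simp add: algebra_simps)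
    then have "exp (?k * s) * p s * exp (- ?k * s) = p s" by (metis mult.commute mult.left_commute mult_1)
    ultimately show ?thesis by (metis mult.commute)
  qed
  then show ?thesis using that[of "p s0 * exp (?k * s0)" s0] p_pos[of s0] by simp
qed

end

section \<open>Kato's inequality\<close>

lemma max_power_deriv:
  "((\<lambda>s::real. (max 0 s) ^ (n + 2)) has_real_derivative real (n + 2) * (max 0 s) ^ (n + 1)) (at s)"
proof (cases s "0::real" rule: linorder_cases)
  case less
  have "((\<lambda>_. 0::real) has_real_derivative 0) (at s)" by simp
  then have "((\<lambda>s::real. (max 0 s) ^ (n + 2)) has_real_derivative 0) (at s)"
    by (rule has_field_derivative_transform_within_open[where S="{..<0}"]) (use less in auto)
  then show ?thesis using less by simp
next
  case greater
  have "((\<lambda>s. s ^ (n + 2)) has_real_derivative real (n + 2) * s ^ (n + 1)) (at s)"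
    using DERIV_pow[of "n + 2" s] by simp
  then have "((\<lambda>s::real. (max 0 s) ^ (n + 2)) has_real_derivative real (n + 2) * s ^ (n + 1)) (at s)"
    by (rule has_field_derivative_transform_within_open[where S="{0<..}"]) (use greater in auto)
  then show ?thesis using greater by simp
next
  case equal
  have "((\<lambda>h::real. (max 0 h) ^ (n + 2) / h) \<longlongrightarrow> 0) (at 0)"
  proof (rule Lim_null_comparison)
    show "\<forall>\<^sub>F h in at 0. norm ((max 0 h) ^ (n + 2) / h) \<le> \<bar>h::real\<bar> ^ (n + 1)"
    proof (rule always_eventually, rule allI)
      fix h :: real
      show "norm ((max 0 h) ^ (n + 2) / h) \<le> \<bar>h\<bar> ^ (n + 1)" by (cases "h > 0") (auto simp: mult_nonpos_nonneg)
    qed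
    have "((\<lambda>h::real. \<bar>h\<bar> ^ (n + 1)) \<longlongrightarrow> \<bar>0\<bar> ^ (n + 1)) (at 0)" by (intro tendsto_intros)
    then show "((\<lambda>h::real. \<bar>h\<bar> ^ (n + 1)) \<longlongrightarrow> 0) (at 0)" by simp
  qed
  then show ?thesis using equal by (simp add: DERIV_def)
qed

lemma max_cube_deriv:
  "((\<lambda>s::real. (max 0 s) ^ 3) has_real_derivative 3 * (max 0 s)\<^sup>2) (at s)"
  "((\<lambda>s::real. (max 0 s)\<^sup>2) has_real_derivative 2 * max 0 s) (at s)"
  using max_power_deriv[of 1 s] max_power_deriv[of 0 s] by (simp_all add: eval_nat_numeral)

text \<open>The cubes make this approximation of the positive part \<open>C\<^sup>2\<close>, and the cube root keeps it convex.\<close>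

definition pos_approx :: "real \<Rightarrow> real \<Rightarrow> real" where
  "pos_approx e s = (e ^ 3 + (max 0 s) ^ 3) powr (1 / 3) - e"
definition pos_approx' :: "real \<Rightarrow> real \<Rightarrow> real" where
  "pos_approx' e s = (max 0 s)\<^sup>2 * (e ^ 3 + (max 0 s) ^ 3) powr (- 2 / 3)"
definition pos_approx'' :: "real \<Rightarrow> real \<Rightarrow> real" where
  "pos_approx'' e s = 2 * max 0 s * e ^ 3 * (e ^ 3 + (max 0 s) ^ 3) powr (- 5 / 3)"

lemma pos_approx_deriv:
  assumes "e > 0"
  shows "(pos_approx e has_real_derivative pos_approx' e s) (at s)"
    "(pos_approx' e has_real_derivative pos_approx'' e s) (at s)"
    "pos_approx'' e s \<ge> 0" "continuous_on S (pos_approx'' e)"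
proof -
  let ?q = "e ^ 3 + (max 0 s) ^ 3"
  have q: "?q > 0" using assms by (simp add: add_pos_nonneg)
  have d: "((\<lambda>s. e ^ 3 + (max 0 s) ^ 3) has_real_derivative 3 * (max 0 s)\<^sup>2) (at s)"
    using DERIV_add[OF DERIV_const max_cube_deriv(1)] by simp
  have dp: "((\<lambda>s. (e ^ 3 + (max 0 s) ^ 3) powr r) has_real_derivative r * ?q powr (r - 1) * (3 * (max 0 s)\<^sup>2)) (at s)" for r
    using DERIV_chain2[OF has_real_derivative_powr[OF q] d] .
  have "(pos_approx e has_real_derivative (1 / 3 * ?q powr (1 / 3 - 1) * (3 * (max 0 s)\<^sup>2) - 0)) (at s)"
    unfolding pos_approx_def[abs_def] by (intro DERIV_diff dp DERIV_const)
  then show "(pos_approx e has_real_derivative pos_approx' e s) (at s)"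
    by (simp add: pos_approx'_def mult.commute)
  have "(pos_approx' e has_real_derivative
     (2 * max 0 s * ?q powr (- 2 / 3) + (- 2 / 3 * ?q powr (- 2 / 3 - 1) * (3 * (max 0 s)\<^sup>2)) * (max 0 s)\<^sup>2)) (at s)"
    unfolding pos_approx'_def[abs_def] by (rule DERIV_mult[OF max_cube_deriv(2) dp])
  moreover have "?q powr (- 2 / 3) = ?q * ?q powr (- 5 / 3)"
    using powr_add[of ?q 1 "- 5 / 3"] q by simp
  then have "2 * max 0 s * ?q powr (- 2 / 3) + (- 2 / 3 * ?q powr (- 2 / 3 - 1) * (3 * (max 0 s)\<^sup>2)) * (max 0 s)\<^sup>2
      = pos_approx'' e s"
    by (simp add: pos_approx''_def algebra_simps eval_nat_numeral)
  ultimately show "(pos_approx' e has_real_derivative pos_approx'' e s) (at s)" by simp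
  show "pos_approx'' e s \<ge> 0" using assms by (simp add: pos_approx''_def)
  have "e ^ 3 + (max 0 s) ^ 3 \<noteq> 0" for s using assms by (smt (verit) zero_less_power zero_le_power)
  then show "continuous_on S (pos_approx'' e)"
    unfolding pos_approx''_def[abs_def] by (intro continuous_intros) auto
qed

lemma pos_approx_bounds:
  assumes "e > 0"
  shows "0 \<le> pos_approx e s" "pos_approx e s \<le> max 0 s" "max 0 s - e \<le> pos_approx e s"
    "0 \<le> pos_approx' e s" "pos_approx' e s \<le> 1"
proof -
  let ?q = "e ^ 3 + (max 0 s) ^ 3"
  have c: "(x ^ 3) powr (1 / 3) = x" if "x \<ge> 0" for x :: real
  proof (cases "x = 0")
    case False
    then show ?thesis using that by (simp add: powr_powr flip: powr_numeral)
  qed simp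
  have "(e ^ 3) powr (1 / 3) \<le> ?q powr (1 / 3)" using assms by (intro powr_mono2) auto
  then show "0 \<le> pos_approx e s" using c assms by (simp add: pos_approx_def)
  have "?q \<le> (e + max 0 s) ^ 3" using assms by (simp add: power3_eq_cube algebra_simps)
  then have "?q powr (1 / 3) \<le> ((e + max 0 s) ^ 3) powr (1 / 3)" using assms by (intro powr_mono2) auto
  then show "pos_approx e s \<le> max 0 s" using c[of "e + max 0 s"] assms by (simp add: pos_approx_def)
  have "((max 0 s) ^ 3) powr (1 / 3) \<le> ?q powr (1 / 3)" using assms by (intro powr_mono2) auto
  then show "max 0 s - e \<le> pos_approx e s" using c[of "max 0 s"] by (simp add: pos_approx_def)
  show "0 \<le> pos_approx' e s" by (simp add: pos_approx'_def)
  show "pos_approx' e s \<le> 1"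
  proof (cases "s > 0")
    case True
    have "(max 0 s)\<^sup>2 = ((max 0 s) ^ 3) powr (2 / 3)"
      using True by (simp add: powr_powr flip: powr_numeral)
    also have "\<dots> \<le> ?q powr (2 / 3)" using assms by (intro powr_mono2) auto
    finally have "(max 0 s)\<^sup>2 * ?q powr (- 2 / 3) \<le> ?q powr (2 / 3) * ?q powr (- 2 / 3)"
      by (rule mult_right_mono) simp
    also have "\<dots> = 1" using assms True by (simp add: powr_add[symmetric] add_pos_pos less_imp_neq[symmetric])
    finally show ?thesis by (simp add: pos_approx'_def)
  qed (simp add: pos_approx'_def)
qed

lemma pos_approx'_tendsto:
  "(\<lambda>k. pos_approx' (inverse (real (Suc k))) s) \<longlonglongrightarrow> (if s > 0 then 1 else 0)"
proof (cases "s > 0")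
  case True
  have "(\<lambda>k. s\<^sup>2 * ((inverse (real (Suc k))) ^ 3 + s ^ 3) powr (- 2 / 3)) \<longlonglongrightarrow> s\<^sup>2 * (0 ^ 3 + s ^ 3) powr (- 2 / 3)"
    using True by (intro tendsto_mult tendsto_const tendsto_powr tendsto_add tendsto_power LIMSEQ_inverse_real_of_nat) auto
  moreover have "s\<^sup>2 * (0 ^ 3 + s ^ 3) powr (- 2 / 3) = 1"
    using True by (simp add: powr_powr powr_add[symmetric] flip: powr_numeral)
  ultimately show ?thesis using True by (simp only: pos_approx'_def max_absorb2 less_imp_le if_True)
qed (simp add: pos_approx'_def max_def)

text \<open>The part of \<open>cauchy_solution\<close> that concerns the equation. This class
  contains the self-similar solutions and is preserved by the rescalings, whatever the initial
  data.\<close>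

definition fde_sol :: "real \<Rightarrow> ('a::euclidean_space \<Rightarrow> real \<Rightarrow> real) \<Rightarrow> bool" where
  "fde_sol m u \<longleftrightarrow>
     (\<forall>x t. x \<noteq> 0 \<and> t > 0 \<longrightarrow> u x t > 0) \<and>
     C21_on ((- {0}) \<times> {0<..}) u \<and>
     (\<forall>x t. x \<noteq> 0 \<and> t > 0 \<longrightarrow> deriv (u x) t = laplacian (\<lambda>y. u y t powr m / m) x)"

lemma fde_solD:
  assumes "fde_sol m u"
  shows "x \<noteq> 0 \<Longrightarrow> t > 0 \<Longrightarrow> u x t > 0"
    "t > 0 \<Longrightarrow> Ck_on 2 (- {0}) (\<lambda>y. u y t)"
    "x \<noteq> 0 \<Longrightarrow> t > 0 \<Longrightarrow> (u x has_real_derivative laplacian (\<lambda>y. u y t powr m / m) x) (at t)"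
    "continuous_on ((- {0}) \<times> {0<..}) (\<lambda>(x, t). u x t)"
    "continuous_on ((- {0}) \<times> {0<..}) (\<lambda>(x, t). laplacian (\<lambda>y. u y t powr m / m) x)"
proof -
  note u = assms[unfolded fde_sol_def C21_on_def]
  show "x \<noteq> 0 \<Longrightarrow> t > 0 \<Longrightarrow> u x t > 0" using u by auto
  show "t > 0 \<Longrightarrow> Ck_on 2 (- {0}) (\<lambda>y. u y t)"
  proof -
    assume t: "t > 0"
    have "continuous_on (- {0}) (\<lambda>x. pd j (pd i (\<lambda>y. u y t)) x)" if "i \<in> Basis" "j \<in> Basis" for i j
    proof -
      have "continuous_on ((- {0}) \<times> {0<..}) (\<lambda>(x, t). pd j (pd i (\<lambda>y. u y t)) x)" using u that by auto
      from continuous_on_compose2[OF this, of "- {0}" "\<lambda>x. (x, t)"] t show ?thesis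
        by (simp add: continuous_on_Pair continuous_on_id image_subset_iff)
    qed
    then show ?thesis using u t unfolding Ck_on_2 by auto
  qed
  show "x \<noteq> 0 \<Longrightarrow> t > 0 \<Longrightarrow> (u x has_real_derivative laplacian (\<lambda>y. u y t powr m / m) x) (at t)"
    using u by (auto simp: DERIV_deriv_iff_real_differentiable[symmetric])
  show "continuous_on ((- {0}) \<times> {0<..}) (\<lambda>(x, t). u x t)" using u by auto
  have "continuous_on ((- {0}) \<times> {0<..}) (\<lambda>(x, t). deriv (u x) t)" using u by auto
  then show "continuous_on ((- {0}) \<times> {0<..}) (\<lambda>(x, t). laplacian (\<lambda>y. u y t powr m / m) x)"
    by (rule continuous_on_eq) (use u in auto)
qed

lemma Ck_on_2_power:
  fixes h :: "'a::euclidean_space \<Rightarrow> real"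
  assumes U: "open U" and h: "Ck_on 2 U h" "\<And>y. y \<in> U \<Longrightarrow> h y > 0" and m: "m > 0"
  shows "Ck_on 2 U (\<lambda>y. h y powr m / m)"
    "\<And>x i. x \<in> U \<Longrightarrow> pd i (\<lambda>y. h y powr m / m) x = h x powr (m - 1) * pd i h x"
proof -
  have pos: "s > 0" if "s \<in> h ` U" for s using that h(2) by auto
  have d1: "((\<lambda>s. s powr m / m) has_real_derivative s powr (m - 1)) (at s)" if "s \<in> h ` U" for s
    using DERIV_cdivide[OF has_real_derivative_powr[OF pos[OF that], of m], of m] m by simp
  have d2: "((\<lambda>s. s powr (m - 1)) has_real_derivative (m - 1) * s powr (m - 1 - 1)) (at s)" if "s \<in> h ` U" for s
    by (rule has_real_derivative_powr[OF pos[OF that]])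
  have c: "continuous_on (h ` U) (\<lambda>s. (m - 1) * s powr (m - 1 - 1))"
    using pos by (intro continuous_intros) force
  show "Ck_on 2 U (\<lambda>y. h y powr m / m)"
    "\<And>x i. x \<in> U \<Longrightarrow> pd i (\<lambda>y. h y powr m / m) x = h x powr (m - 1) * pd i h x"
    by (rule Ck_on_2_compose(1,2)[OF U h(1) d1 d2 c]; assumption)+
qed

lemma fde_sol_power:
  assumes "fde_sol m u" "t > 0" "m > 0"
  shows "Ck_on 2 (- {0}) (\<lambda>y. u y t powr m / m)"
  using assms fde_solD by (intro Ck_on_2_power) auto

lemma fde_sol_power_diff_continuous:
  assumes u: "fde_sol m u" and v: "fde_sol m v" and m: "m > 0"
  shows "continuous_on ((- {0}) \<times> {0<..}) (\<lambda>(x, t). u x t powr m / m - v x t powr m / m)"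
  using fde_solD(4)[OF u] fde_solD(4)[OF v] fde_solD(1)[OF u] fde_solD(1)[OF v] m
  unfolding split_beta by (intro continuous_intros) (auto simp: less_imp_neq[symmetric] dest!: less_imp_neq)

section \<open>Integrals against test functions supported away from the origin\<close>

lemma product_zero_extension:
  fixes g :: "'a::euclidean_space \<Rightarrow> real \<Rightarrow> real"
  assumes K: "compact K" "K \<subseteq> - {0}" "\<And>x. x \<notin> K \<Longrightarrow> \<xi> x = 0" and \<xi>: "continuous_on UNIV \<xi>"
    and g: "continuous_on ((- {0}) \<times> {0<..}) (\<lambda>(x, t). g x t)"
  shows "continuous_on (UNIV \<times> {0<..}) (\<lambda>(x, t). g x t * \<xi> x)"
proof -
  have "continuous_on ((- K) \<times> {0<..}) (\<lambda>(x, t). g x t * \<xi> x)"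
    by (rule continuous_on_eq[where f="\<lambda>_. 0"]) (use K in auto)
  moreover have "continuous_on ((- {0}) \<times> {0<..}) (\<lambda>z. \<xi> (fst z))"
    by (rule continuous_on_compose2[OF \<xi>]) (auto intro!: continuous_intros)
  then have "continuous_on ((- {0}) \<times> {0<..}) (\<lambda>(x, t). g x t * \<xi> x)"
    using g unfolding split_beta by (intro continuous_intros)
  moreover have "open ((- K) \<times> {0::real<..})" "open ((- {0::'a}) \<times> {0::real<..})"
    using K compact_imp_closed by (auto intro!: open_Times)
  ultimately have "continuous_on ((- K) \<times> {0<..} \<union> (- {0}) \<times> {0<..}) (\<lambda>(x, t). g x t * \<xi> x)"
    by (intro continuous_on_open_Un) auto
  moreover have "(- K) \<times> {0<..} \<union> (- {0}) \<times> {0<..} = (UNIV :: 'a set) \<times> {0::real<..}" using K by auto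
  ultimately show ?thesis by simp
qed

lemma compact_support_integral:
  fixes F :: "'a::euclidean_space \<Rightarrow> real"
  assumes "continuous_on UNIV F" "K \<subseteq> cbox a b" "\<And>x. x \<notin> K \<Longrightarrow> F x = 0"
  shows "(\<integral>x. F x \<partial>lborel) = integral (cbox a b) F" "integrable lborel F"
proof -
  show i: "integrable lborel F"
    by (rule integrable_compact_support[OF compact_cbox continuous_on_subset[OF assms(1) subset_UNIV]])
       (use assms in auto)
  have "(\<integral>x. F x \<partial>lborel) = integral UNIV F" using integral_lborel[OF i] by simp
  also have "\<dots> = integral (cbox a b) F"
    by (rule integral_spike_set) (rule negligible_subset[OF negligible_empty], use assms in force)+
  finally show "(\<integral>x. F x \<partial>lborel) = integral (cbox a b) F" .
qed

text \<open>A product with such a function is continuous on the whole space, whatever the other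
  factor does at the origin. This gives meaning to integrals over the whole space and allows
  differentiation under the integral sign in time.\<close>

locale test_function =
  fixes \<xi> :: "'a::euclidean_space \<Rightarrow> real" and K
  assumes K: "compact K" "K \<subseteq> - {0}" and supp: "\<And>x. x \<notin> K \<Longrightarrow> \<xi> x = 0"
    and cont: "continuous_on UNIV \<xi>"
begin

lemma slice_continuous:
  fixes g :: "'a \<Rightarrow> real \<Rightarrow> real"
  assumes "continuous_on ((- {0}) \<times> {0<..}) (\<lambda>(x, t). g x t)" "t > 0"
  shows "continuous_on UNIV (\<lambda>x. g x t * \<xi> x)"
proof -
  have "continuous_on UNIV (\<lambda>x::'a. (x, t))" "range (\<lambda>x. (x, t)) \<subseteq> UNIV \<times> {0<..}"
    using assms(2) by (auto intro!: continuous_intros)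
  from continuous_on_compose2[OF product_zero_extension[OF K supp cont assms(1)] this] show ?thesis by simp
qed

lemma slice_integrable:
  fixes g :: "'a \<Rightarrow> real \<Rightarrow> real"
  assumes "continuous_on ((- {0}) \<times> {0<..}) (\<lambda>(x, t). g x t)" "t > 0"
  shows "integrable lborel (\<lambda>x. g x t * \<xi> x)"
  by (rule integrable_compact_support[OF K(1) continuous_on_subset[OF slice_continuous[OF assms] subset_UNIV]])
     (use supp in auto)

lemma swapped_continuous:
  fixes g :: "'a \<Rightarrow> real \<Rightarrow> real"
  assumes g: "continuous_on ((- {0}) \<times> {0<..}) (\<lambda>(x, t). g x t)"
  shows "continuous_on ({0<..} \<times> cbox l h) (\<lambda>(t, x). g x t * \<xi> x)"
proof -
  have "continuous_on ({0<..} \<times> cbox l h) (\<lambda>z::real \<times> 'a. (snd z, fst z))"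
    "(\<lambda>z. (snd z, fst z)) ` ({0<..} \<times> cbox l h) \<subseteq> UNIV \<times> {0<..}"
    by (auto intro!: continuous_intros)
  from continuous_on_compose2[OF product_zero_extension[OF K supp cont g] this] show ?thesis
    by (simp add: split_beta)
qed

lemma box: obtains l h where "K \<subseteq> cbox l h"
  using bounded_subset_cbox_symmetric compact_imp_bounded K(1) by metis

text \<open>The Leibniz rule is applied on a box around the support. At the origin \<xi> vanishes,
  so the integrand is constantly 0 there although g is uncontrolled.\<close>

lemma integral_deriv:
  fixes g g' :: "'a \<Rightarrow> real \<Rightarrow> real"
  assumes g: "continuous_on ((- {0}) \<times> {0<..}) (\<lambda>(x, t). g x t)"
    and g': "continuous_on ((- {0}) \<times> {0<..}) (\<lambda>(x, t). g' x t)"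
    and d: "\<And>x t. x \<noteq> 0 \<Longrightarrow> t > 0 \<Longrightarrow> (g x has_real_derivative g' x t) (at t)"
    and t: "t > 0"
  shows "((\<lambda>t. \<integral>x. g x t * \<xi> x \<partial>lborel) has_real_derivative (\<integral>x. g' x t * \<xi> x \<partial>lborel)) (at t)"
proof -
  obtain l h where lh: "K \<subseteq> cbox l h" by (rule box)
  have e: "(\<integral>x. q x t * \<xi> x \<partial>lborel) = integral (cbox l h) (\<lambda>x. q x t * \<xi> x)" 
    if "continuous_on ((- {0}) \<times> {0<..}) (\<lambda>(x, t). q x t)" "t > 0" for q :: "'a \<Rightarrow> real \<Rightarrow> real" and t
    by (rule compact_support_integral(1)[OF slice_continuous[OF that] lh]) (simp add: supp)
  have "((\<lambda>t. integral (cbox l h) (\<lambda>x. g x t * \<xi> x)) has_real_derivative integral (cbox l h) (\<lambda>x. g' x t * \<xi> x)) (at t within {0<..})"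
  proof (rule leibniz_rule_field_derivative)
    show "((\<lambda>t. g x t * \<xi> x) has_real_derivative g' x s * \<xi> x) (at s within {0<..})"
      if "s \<in> {0<..}" "x \<in> cbox l h" for s x
    proof (cases "x = 0")
      case True
      then show ?thesis using supp[of x] K by auto
    next
      case False
      then show ?thesis using DERIV_cmult_right[OF d[OF False], of s "\<xi> x"] that
        by (auto intro: has_field_derivative_at_within)
    qed
    show "(\<lambda>x. g x s * \<xi> x) integrable_on cbox l h" if "s \<in> {0<..}" for s
      using slice_continuous[OF g, of s] that by (auto intro!: integrable_continuous intro: continuous_on_subset)
    show "continuous_on ({0<..} \<times> cbox l h) (\<lambda>(t, x). g' x t * \<xi> x)" by (rule swapped_continuous[OF g'])
  qed (use t in auto)
  then have "((\<lambda>t. integral (cbox l h) (\<lambda>x. g x t * \<xi> x)) has_real_derivative integral (cbox l h) (\<lambda>x. g' x t * \<xi> x)) (at t)"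
    using t by (simp add: at_within_open[of t "{0<..}"])
  then have "((\<lambda>t. \<integral>x. g x t * \<xi> x \<partial>lborel) has_real_derivative integral (cbox l h) (\<lambda>x. g' x t * \<xi> x)) (at t)"
    by (rule has_field_derivative_transform_within_open[where S="{0<..}"]) (use t e[OF g] in auto)
  then show ?thesis using e[OF g' t] by simp
qed

lemma integral_continuous:
  fixes g :: "'a \<Rightarrow> real \<Rightarrow> real"
  assumes g: "continuous_on ((- {0}) \<times> {0<..}) (\<lambda>(x, t). g x t)" and T: "T \<subseteq> {0<..}"
  shows "continuous_on T (\<lambda>t. \<integral>x. g x t * \<xi> x \<partial>lborel)"
proof -
  obtain l h where lh: "K \<subseteq> cbox l h" by (rule box)
  have e: "(\<integral>x. g x t * \<xi> x \<partial>lborel) = integral (cbox l h) (\<lambda>x. g x t * \<xi> x)" if "t > 0" for t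
    by (rule compact_support_integral(1)[OF slice_continuous[OF g that] lh]) (simp add: supp)
  have "continuous_on {0<..} (\<lambda>t. integral (cbox l h) (\<lambda>x. g x t * \<xi> x))"
    by (rule integral_continuous_on_param[OF swapped_continuous[OF g]])
  then have "continuous_on T (\<lambda>t. integral (cbox l h) (\<lambda>x. g x t * \<xi> x))" by (rule continuous_on_subset[OF _ T])
  then show ?thesis by (rule continuous_on_eq) (use e T in auto)
qed

end

locale fde_pair = test_function \<xi> K for \<xi> :: "'a::euclidean_space \<Rightarrow> real" and K +
  fixes m :: real and u v :: "'a \<Rightarrow> real \<Rightarrow> real"
  assumes m: "m > 0" and u: "fde_sol m u" and v: "fde_sol m v" and \<xi>2: "Ck_on 2 UNIV \<xi>"
begin

definition "w x t = u x t - v x t"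
definition "z x t = u x t powr m / m - v x t powr m / m"
text \<open>At once the time derivative of \<open>w\<close> and the Laplacian of \<open>z\<close>;
  the equation enters the estimates through this double role.\<close>

definition "w' x t = laplacian (\<lambda>y. u y t powr m / m) x - laplacian (\<lambda>y. v y t powr m / m) x"

lemma w_deriv: "x \<noteq> 0 \<Longrightarrow> t > 0 \<Longrightarrow> (w x has_real_derivative w' x t) (at t)"
  unfolding w_def[abs_def] w'_def by (intro DERIV_diff fde_solD(3)[OF u] fde_solD(3)[OF v])

lemma cont_w: "continuous_on ((- {0}) \<times> {0<..}) (\<lambda>(x, t). w x t)"
  using continuous_on_diff[OF fde_solD(4)[OF u] fde_solD(4)[OF v]] by (simp add: split_beta w_def)

lemma cont_w': "continuous_on ((- {0}) \<times> {0<..}) (\<lambda>(x, t). w' x t)"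
  using continuous_on_diff[OF fde_solD(5)[OF u] fde_solD(5)[OF v]] by (simp add: split_beta w'_def)

lemma cont_z: "continuous_on ((- {0}) \<times> {0<..}) (\<lambda>(x, t). z x t)"
  unfolding z_def by (rule fde_sol_power_diff_continuous[OF u v m])

lemma z2: "t > 0 \<Longrightarrow> Ck_on 2 (- {0}) (\<lambda>y. z y t)"
  "t > 0 \<Longrightarrow> x \<noteq> 0 \<Longrightarrow> laplacian (\<lambda>y. z y t) x = w' x t"
  using Ck_on_2_diff[OF _ fde_sol_power[OF u] fde_sol_power[OF v], of t t] m
  by (auto simp: z_def[abs_def] w'_def)

lemma z_w_sgn: "x \<noteq> 0 \<Longrightarrow> t > 0 \<Longrightarrow> z x t > 0 \<longleftrightarrow> w x t > 0"
  using fde_solD(1)[OF u, of x t] fde_solD(1)[OF v, of x t] m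
  by (auto simp: z_def w_def divide_simps intro: powr_less_mono2)
     (metis less_eq_real_def linorder_not_less powr_mono2)

text \<open>The linear counterpart of Kato's inequality: tested without taking a sign, the identity
  is exact. It supplies the weak Laplacian of time averages.\<close>

lemma weak_identity:
  assumes "0 < a" "a \<le> b"
  shows "((\<lambda>t. \<integral>x. z x t * laplacian \<xi> x \<partial>lborel) has_integral
     (\<integral>x. w x b * \<xi> x \<partial>lborel) - (\<integral>x. w x a * \<xi> x \<partial>lborel)) {a..b}"
proof (rule fundamental_theorem_of_calculus[OF assms(2)])
  fix t assume t: "t \<in> {a..b}"
  then have t0: "t > 0" using assms by auto
  have "(\<integral>x. w' x t * \<xi> x \<partial>lborel) = (\<integral>x. \<xi> x * laplacian (\<lambda>y. z y t) x \<partial>lborel)"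
  proof (rule Bochner_Integration.integral_cong[OF refl])
    fix x show "w' x t * \<xi> x = \<xi> x * laplacian (\<lambda>y. z y t) x"
      using z2(2)[OF t0, of x] supp[of x] K by (cases "x = 0") auto
  qed
  also have "\<dots> = (\<integral>x. z x t * laplacian \<xi> x \<partial>lborel)"
    by (rule green_identity(1)[OF _ z2(1)[OF t0] \<xi>2 K supp]) auto
  finally have "((\<lambda>t. \<integral>x. w x t * \<xi> x \<partial>lborel) has_real_derivative (\<integral>x. z x t * laplacian \<xi> x \<partial>lborel)) (at t)"
    using integral_deriv[OF cont_w cont_w' w_deriv t0] by simp
  then show "((\<lambda>t. \<integral>x. w x t * \<xi> x \<partial>lborel) has_vector_derivative (\<integral>x. z x t * laplacian \<xi> x \<partial>lborel)) (at t within {a..b})"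
    by (simp add: has_real_derivative_iff_has_vector_derivative has_vector_derivative_at_within)
qed

lemma continuous_compose_pair:
  assumes "continuous_on UNIV (q :: real \<Rightarrow> real)" "continuous_on S (\<lambda>(x, t). r x t)"
  shows "continuous_on S (\<lambda>(x, t). q (r x t))"
  using continuous_on_compose2[OF assms] by (simp add: split_beta)

lemma test_integrable:
  fixes r :: "'a \<Rightarrow> real \<Rightarrow> real"
  assumes "continuous_on ((- {0}) \<times> {0<..}) (\<lambda>(x, t). r x t)" "t > 0"
  shows "integrable lborel (\<lambda>x. r x t * max 0 (laplacian \<xi> x))"
proof -
  have l: "continuous_on UNIV (laplacian \<xi>)" by (rule Ck_on_2_laplacian[OF \<xi>2])
  interpret L: test_function "\<lambda>x. max 0 (laplacian \<xi> x)" K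
    by unfold_locales (use K laplacian_zero_outside[OF K(1) supp] l in \<open>auto intro!: continuous_intros\<close>)
  show ?thesis by (rule L.slice_integrable[OF assms])
qed

text \<open>The approximate sign is taken of \<open>z\<close>, not of \<open>w\<close>, because
  \<open>w'\<close> is the Laplacian of \<open>z\<close>. Convexity of \<open>pos_approx\<close>
  then bounds the left integrand by \<xi> times the Laplacian of \<open>pos_approx e\<close> applied
  to \<open>z\<close>, and Green's identity moves the Laplacian to \<xi>.\<close>

lemma approx_derivative_bound:
  assumes e: "e > 0" and t: "t > 0" and \<xi>0: "\<And>x. \<xi> x \<ge> 0"
  shows "(\<integral>x. pos_approx' e (z x t) * w' x t * \<xi> x \<partial>lborel)
    \<le> (\<integral>x. max 0 (z x t) * max 0 (laplacian \<xi> x) \<partial>lborel)"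
proof -
  let ?h = "\<lambda>y. pos_approx e (z y t)"
  have op: "open (- {0::'a})" by auto
  note C = Ck_on_2_compose[OF op z2(1)[OF t], of "pos_approx e" "pos_approx' e" "pos_approx'' e",
      OF pos_approx_deriv(1)[OF e] pos_approx_deriv(2)[OF e] pos_approx_deriv(4)[OF e]]
  have h2: "Ck_on 2 (- {0}) ?h" by (rule C(1))
  note G = green_identity[OF _ h2 \<xi>2 K supp]
  have c1: "continuous_on UNIV (pos_approx' e)" using pos_approx_deriv(2)[OF e]
    by (meson DERIV_isCont continuous_at_imp_continuous_on)
  have "continuous_on ((- {0}) \<times> {0<..}) (\<lambda>(x, t). pos_approx' e (z x t) * w' x t)"
    using continuous_on_mult[OF continuous_compose_pair[OF c1 cont_z] cont_w'] by (simp add: split_beta)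
  then have "(\<integral>x. pos_approx' e (z x t) * w' x t * \<xi> x \<partial>lborel) \<le> (\<integral>x. \<xi> x * laplacian ?h x \<partial>lborel)"
  proof (intro integral_mono slice_integrable[OF _ t] G(2))
    fix x
    show "pos_approx' e (z x t) * w' x t * \<xi> x \<le> \<xi> x * laplacian ?h x"
    proof (cases "x = 0")
      case True then show ?thesis using supp[of x] K by auto
    next
      case False
      have "laplacian ?h x = pos_approx' e (z x t) * w' x t + pos_approx'' e (z x t) * (\<Sum>i\<in>Basis. (pd i (\<lambda>y. z y t) x)\<^sup>2)"
        using C(3)[of x] z2(2)[OF t False] False by simp
      also have "\<dots> \<ge> pos_approx' e (z x t) * w' x t"
        using pos_approx_deriv(3)[OF e] by (simp add: sum_nonneg)
      finally show ?thesis using \<xi>0[of x] by (simp add: mult.commute mult_left_mono)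
    qed
  qed auto
  also have "\<dots> = (\<integral>x. ?h x * laplacian \<xi> x \<partial>lborel)" by (rule G(1)) auto
  also have "\<dots> \<le> (\<integral>x. max 0 (z x t) * max 0 (laplacian \<xi> x) \<partial>lborel)"
  proof (intro integral_mono G(3))
    have "continuous_on ((- {0}) \<times> {0<..}) (\<lambda>(x, t). max 0 (z x t))"
      by (rule continuous_compose_pair[OF _ cont_z]) (auto intro!: continuous_intros)
    from test_integrable[OF this t] show "integrable lborel (\<lambda>x. max 0 (z x t) * max 0 (laplacian \<xi> x))" by simp
    fix x
    have "?h x * laplacian \<xi> x \<le> ?h x * max 0 (laplacian \<xi> x)"
      using pos_approx_bounds[OF e] by (intro mult_left_mono) auto
    also have "\<dots> \<le> max 0 (z x t) * max 0 (laplacian \<xi> x)"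
      using pos_approx_bounds[OF e] by (intro mult_right_mono) auto
    finally show "?h x * laplacian \<xi> x \<le> max 0 (z x t) * max 0 (laplacian \<xi> x)" .
  qed auto
  finally show ?thesis .
qed

text \<open>Since \<open>u - v\<close> and \<open>u\<^sup>m - v\<^sup>m\<close> have the same sign, both approximations of the Heaviside function
  have the same limit.\<close>

lemma kato:
  assumes ab: "0 < a" "a \<le> b" and \<xi>0: "\<And>x. \<xi> x \<ge> 0"
    and S: "\<And>t. t \<in> {a..b} \<Longrightarrow> (S has_real_derivative E t) (at t)"
    and E: "\<And>t. t \<in> {a..b} \<Longrightarrow> (\<integral>x. max 0 (z x t) * max 0 (laplacian \<xi> x) \<partial>lborel) \<le> E t"
  shows "(\<integral>x. max 0 (w x b) * \<xi> x \<partial>lborel) \<le> (\<integral>x. max 0 (w x a) * \<xi> x \<partial>lborel) + (S b - S a)"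
proof -
  define \<epsilon> where "\<epsilon> k = inverse (real (Suc k))" for k
  have \<epsilon>: "\<epsilon> k > 0" for k by (simp add: \<epsilon>_def)
  define J where "J k t = (\<integral>x. pos_approx (\<epsilon> k) (w x t) * \<xi> x \<partial>lborel)" for k t
  \<comment> \<open>Differentiation in time produces the approximate sign of \<open>w\<close>, while
    the Laplacian needs that of \<open>z\<close>; this is the discrepancy to be sent to 0.\<close>
  define err where "err k x t = (pos_approx' (\<epsilon> k) (w x t) - pos_approx' (\<epsilon> k) (z x t)) * w' x t" for k x t
  define e where "e k t = (\<integral>x. err k x t * \<xi> x \<partial>lborel)" for k t
  have c0: "continuous_on UNIV (pos_approx (\<epsilon> k))" and c1: "continuous_on UNIV (pos_approx' (\<epsilon> k))" for k
    using pos_approx_deriv(1,2)[OF \<epsilon>] by (meson DERIV_isCont continuous_at_imp_continuous_on)+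
  have cw: "continuous_on ((- {0}) \<times> {0<..}) (\<lambda>(x, t). pos_approx' (\<epsilon> k) (w x t) * w' x t)" for k
    using continuous_on_mult[OF continuous_compose_pair[OF c1 cont_w] cont_w'] by (simp add: split_beta)
  have cz: "continuous_on ((- {0}) \<times> {0<..}) (\<lambda>(x, t). pos_approx' (\<epsilon> k) (z x t) * w' x t)" for k
    using continuous_on_mult[OF continuous_compose_pair[OF c1 cont_z] cont_w'] by (simp add: split_beta)
  have cerr: "continuous_on ((- {0}) \<times> {0<..}) (\<lambda>(x, t). err k x t)" for k
    using continuous_on_diff[OF cw cz, of k k] by (simp add: split_beta err_def left_diff_distrib)
  have dJ: "(J k has_real_derivative (\<integral>x. pos_approx' (\<epsilon> k) (w x t) * w' x t * \<xi> x \<partial>lborel)) (at t)" if "t > 0" for k t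
    unfolding J_def[abs_def]
    using continuous_compose_pair[OF c0 cont_w] cw DERIV_chain2[OF pos_approx_deriv(1)[OF \<epsilon>] w_deriv] that
    by (rule integral_deriv)
  have bound: "(\<integral>x. pos_approx' (\<epsilon> k) (w x t) * w' x t * \<xi> x \<partial>lborel) \<le> E t + e k t" if t: "t \<in> {a..b}" for k t
  proof -
    have t0: "t > 0" using t ab by auto
    have "(\<integral>x. pos_approx' (\<epsilon> k) (w x t) * w' x t * \<xi> x \<partial>lborel)
       = (\<integral>x. pos_approx' (\<epsilon> k) (z x t) * w' x t * \<xi> x \<partial>lborel) + e k t"
      unfolding e_def err_def using slice_integrable[OF cw t0] slice_integrable[OF cz t0]
      by (subst Bochner_Integration.integral_add[symmetric]) (auto simp: algebra_simps)
    then show ?thesis using approx_derivative_bound[OF \<epsilon> t0 \<xi>0, of k] E[OF t] by simp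
  qed
  have ie: "e k integrable_on {a..b}" for k
    unfolding e_def[abs_def] using ab by (intro integrable_continuous_real integral_continuous[OF cerr]) auto
  have Jle: "J k b - J k a \<le> (S b - S a) + integral {a..b} (e k)" for k
  proof -
    have "((\<lambda>t. \<integral>x. pos_approx' (\<epsilon> k) (w x t) * w' x t * \<xi> x \<partial>lborel) has_integral J k b - J k a) {a..b}"
      using dJ ab by (intro fundamental_theorem_of_calculus)
        (auto simp: has_real_derivative_iff_has_vector_derivative[symmetric] intro: has_field_derivative_at_within)
    moreover have "(E has_integral S b - S a) {a..b}"
      using S ab by (intro fundamental_theorem_of_calculus)
        (auto simp: has_real_derivative_iff_has_vector_derivative[symmetric] intro: has_field_derivative_at_within)
    then have "((\<lambda>t. E t + e k t) has_integral (S b - S a) + integral {a..b} (e k)) {a..b}"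
      using integrable_integral[OF ie] by (rule has_integral_add)
    ultimately show ?thesis using bound by (rule has_integral_le)
  qed
  have elim: "(\<lambda>k. integral {a..b} (e k)) \<longlonglongrightarrow> 0"
  proof -
    \<comment> \<open>Both approximate signs lie in [0, 1], so |w'| |\<xi>| dominates the
      discrepancy for every k.\<close>
    interpret A: test_function "\<lambda>x. \<bar>\<xi> x\<bar>" K
      by unfold_locales (use K supp cont in \<open>auto intro!: continuous_intros\<close>)
    have cA: "continuous_on ((- {0}) \<times> {0<..}) (\<lambda>(x, t). \<bar>w' x t\<bar>)"
      by (rule continuous_compose_pair[OF _ cont_w']) (auto intro!: continuous_intros)
    have eb: "\<bar>err k x t * \<xi> x\<bar> \<le> \<bar>w' x t\<bar> * \<bar>\<xi> x\<bar>" for k x t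
    proof -
      have "\<bar>pos_approx' (\<epsilon> k) (w x t) - pos_approx' (\<epsilon> k) (z x t)\<bar> \<le> 1"
        using pos_approx_bounds(4,5)[OF \<epsilon>, of k] by (smt (verit))
      then show ?thesis unfolding err_def abs_mult by (intro mult_right_mono) (auto intro: mult_left_le_one_le)
    qed
    have "(\<lambda>k. integral {a..b} (e k)) \<longlonglongrightarrow> integral {a..b} (\<lambda>_. 0)"
    proof (rule dominated_convergence(2)[where h="\<lambda>t. \<integral>x. \<bar>w' x t\<bar> * \<bar>\<xi> x\<bar> \<partial>lborel"])
      show "(\<lambda>t. \<integral>x. \<bar>w' x t\<bar> * \<bar>\<xi> x\<bar> \<partial>lborel) integrable_on {a..b}"
        using ab by (intro integrable_continuous_real A.integral_continuous[OF cA]) auto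
      show "norm (e k t) \<le> (\<integral>x. \<bar>w' x t\<bar> * \<bar>\<xi> x\<bar> \<partial>lborel)" if "t \<in> {a..b}" for k t
        unfolding e_def using that ab eb
        by (intro order_trans[OF integral_norm_bound] integral_mono integrable_norm
              slice_integrable[OF cerr] A.slice_integrable[OF cA]) auto
      show "(\<lambda>k. e k t) \<longlonglongrightarrow> 0" if "t \<in> {a..b}" for t
      proof -
        have t0: "t > 0" using that ab by auto
        have "(\<lambda>k. \<integral>x. err k x t * \<xi> x \<partial>lborel) \<longlonglongrightarrow> (\<integral>x. 0 \<partial>(lborel :: 'a measure))"
        proof (rule integral_dominated_convergence[where w="\<lambda>x. \<bar>w' x t\<bar> * \<bar>\<xi> x\<bar>"])
          show "(\<lambda>x. err k x t * \<xi> x) \<in> borel_measurable lborel" for k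
            using slice_integrable[OF cerr t0] by (rule borel_measurable_integrable)
          show "integrable lborel (\<lambda>x. \<bar>w' x t\<bar> * \<bar>\<xi> x\<bar>)" by (rule A.slice_integrable[OF cA t0])
          have "(\<lambda>k. err k x t * \<xi> x) \<longlonglongrightarrow> 0" for x
          proof (cases "x = 0")
            case True then show ?thesis using supp[of x] K by auto
          next
            case False
            have "(\<lambda>k. err k x t * \<xi> x) \<longlonglongrightarrow>
              ((if w x t > 0 then 1 else 0) - (if z x t > 0 then 1 else 0)) * w' x t * \<xi> x"
              unfolding err_def \<epsilon>_def by (intro tendsto_intros pos_approx'_tendsto)
            then show ?thesis using z_w_sgn[OF False t0] by simp
          qed
          then show "AE x in lborel. (\<lambda>k. err k x t * \<xi> x) \<longlonglongrightarrow> 0" by simp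
          show "AE x in lborel. norm (err k x t * \<xi> x) \<le> \<bar>w' x t\<bar> * \<bar>\<xi> x\<bar>" for k using eb by simp
        qed simp
        then show ?thesis by (simp add: e_def)
      qed
    qed (rule ie)
    then show ?thesis by simp
  qed
  have Jlim: "(\<lambda>k. J k t) \<longlonglongrightarrow> (\<integral>x. max 0 (w x t) * \<xi> x \<partial>lborel)" if "t > 0" for t
    unfolding J_def
  proof (rule integral_dominated_convergence[where w="\<lambda>x. max 0 (w x t) * \<xi> x"])
    have "continuous_on ((- {0}) \<times> {0<..}) (\<lambda>(x, t). max 0 (w x t))"
      by (rule continuous_compose_pair[OF _ cont_w]) (auto intro!: continuous_intros)
    from slice_integrable[OF this that] show "integrable lborel (\<lambda>x. max 0 (w x t) * \<xi> x)" .
    then show "(\<lambda>x. max 0 (w x t) * \<xi> x) \<in> borel_measurable lborel" by (rule borel_measurable_integrable)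
    show "(\<lambda>x. pos_approx (\<epsilon> k) (w x t) * \<xi> x) \<in> borel_measurable lborel" for k
      using slice_integrable[OF continuous_compose_pair[OF c0 cont_w] that] by (rule borel_measurable_integrable)
    have "(\<lambda>k. pos_approx (\<epsilon> k) s) \<longlonglongrightarrow> max 0 s" for s
    proof (rule tendsto_sandwich)
      show "\<forall>\<^sub>F k in sequentially. max 0 s - \<epsilon> k \<le> pos_approx (\<epsilon> k) s" 
        "\<forall>\<^sub>F k in sequentially. pos_approx (\<epsilon> k) s \<le> max 0 s" using pos_approx_bounds[OF \<epsilon>] by auto
      have "(\<lambda>k. max 0 s - \<epsilon> k) \<longlonglongrightarrow> max 0 s - 0"
        unfolding \<epsilon>_def by (intro tendsto_intros LIMSEQ_inverse_real_of_nat)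
      then show "(\<lambda>k. max 0 s - \<epsilon> k) \<longlonglongrightarrow> max 0 s" by simp
    qed simp
    then show "AE x in lborel. (\<lambda>k. pos_approx (\<epsilon> k) (w x t) * \<xi> x) \<longlonglongrightarrow> max 0 (w x t) * \<xi> x"
      by (auto intro!: tendsto_intros)
    show "AE x in lborel. norm (pos_approx (\<epsilon> k) (w x t) * \<xi> x) \<le> max 0 (w x t) * \<xi> x" for k
      using pos_approx_bounds[OF \<epsilon>, of k] \<xi>0 by (auto simp: abs_mult intro!: mult_right_mono)
  qed
  have "(\<lambda>k. J k b - J k a) \<longlonglongrightarrow> (\<integral>x. max 0 (w x b) * \<xi> x \<partial>lborel) - (\<integral>x. max 0 (w x a) * \<xi> x \<partial>lborel)"
    using ab by (intro tendsto_diff Jlim) auto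
  moreover have "(\<lambda>k. (S b - S a) + integral {a..b} (e k)) \<longlonglongrightarrow> (S b - S a) + 0"
    by (intro tendsto_intros elim)
  ultimately have "(\<integral>x. max 0 (w x b) * \<xi> x \<partial>lborel) - (\<integral>x. max 0 (w x a) * \<xi> x \<partial>lborel) \<le> (S b - S a) + 0"
    by (rule LIMSEQ_le) (use Jle in blast)
  then show ?thesis by simp
qed

end

section \<open>Contraction in a weighted norm\<close>

text \<open>An explicit step from 0 at r = 1 to 1 at r = 2. Nesting cubes of positive parts makes it
  C^2, and its polynomial form yields the numerical bounds 9 and 72 for the first two
  derivatives.\<close>

definition cutoff :: "real \<Rightarrow> real" where
  "cutoff r = 1 - (max 0 (1 - (max 0 (r - 1)) ^ 3)) ^ 3"
definition cutoff' :: "real \<Rightarrow> real" where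
  "cutoff' r = 9 * (max 0 (1 - (max 0 (r - 1)) ^ 3))\<^sup>2 * (max 0 (r - 1))\<^sup>2"
definition cutoff'' :: "real \<Rightarrow> real" where
  "cutoff'' r = 18 * (max 0 (1 - (max 0 (r - 1)) ^ 3))\<^sup>2 * max 0 (r - 1)
     - 54 * max 0 (1 - (max 0 (r - 1)) ^ 3) * (max 0 (r - 1)) ^ 4"

lemma cutoff_deriv:
  "(cutoff has_real_derivative cutoff' r) (at r)"
  "(cutoff' has_real_derivative cutoff'' r) (at r)"
  "continuous_on S cutoff''"
proof -
  have "((\<lambda>r. r - 1) has_real_derivative 1) (at r)" by (auto intro!: derivative_eq_intros)
  note y3 = DERIV_chain2[OF max_cube_deriv(1) this] and y2 = DERIV_chain2[OF max_cube_deriv(2) this]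
  have x: "((\<lambda>r. 1 - (max 0 (r - 1)) ^ 3) has_real_derivative 0 - 3 * (max 0 (r - 1))\<^sup>2 * 1) (at r)"
    by (intro DERIV_diff DERIV_const y3)
  note x3 = DERIV_chain2[OF max_cube_deriv(1) x] and x2 = DERIV_chain2[OF max_cube_deriv(2) x]
  show "(cutoff has_real_derivative cutoff' r) (at r)"
    using DERIV_diff[OF DERIV_const[of 1] x3] by (simp add: cutoff_def[abs_def] cutoff'_def mult.assoc)
  show "(cutoff' has_real_derivative cutoff'' r) (at r)"
    using DERIV_mult[OF DERIV_cmult[OF x2, of 9] y2]
    by (simp add: cutoff'_def[abs_def] cutoff''_def power2_eq_square power4_eq_xxxx algebra_simps)
  show "continuous_on S cutoff''" unfolding cutoff''_def[abs_def] by (intro continuous_intros)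
qed

lemma cutoff_values:
  "r \<le> 1 \<Longrightarrow> cutoff r = 0" "r \<ge> 2 \<Longrightarrow> cutoff r = 1"
  "0 \<le> cutoff r" "cutoff r \<le> 1"
  "0 \<le> cutoff' r" "cutoff' r \<le> 9" "\<bar>cutoff'' r\<bar> \<le> 72"
  "r < 1 \<or> r > 2 \<Longrightarrow> cutoff' r = 0" "r < 1 \<or> r > 2 \<Longrightarrow> cutoff'' r = 0"
proof -
  define y where "y = max 0 (r - 1)"
  define x where "x = max 0 (1 - y ^ 3)"
  have y: "y \<ge> 0" by (simp add: y_def)
  have x: "0 \<le> x" "x \<le> 1" using y by (auto simp: x_def)
  have xy: "x = 0" if "y \<ge> 1" using that by (simp add: x_def)
  have eq: "cutoff r = 1 - x ^ 3" "cutoff' r = 9 * x\<^sup>2 * y\<^sup>2" "cutoff'' r = 18 * x\<^sup>2 * y - 54 * x * y ^ 4"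
    by (simp_all add: cutoff_def cutoff'_def cutoff''_def x_def y_def)
  show "r \<le> 1 \<Longrightarrow> cutoff r = 0" unfolding eq by (simp add: x_def y_def)
  have r2: "r \<ge> 2 \<Longrightarrow> x = 0" by (rule xy) (simp add: y_def)
  then show "r \<ge> 2 \<Longrightarrow> cutoff r = 1" unfolding eq by simp
  show "0 \<le> cutoff r" "cutoff r \<le> 1" unfolding eq using x by (simp_all add: power_le_one)
  show "0 \<le> cutoff' r" unfolding eq by simp
  have "x\<^sup>2 * y\<^sup>2 \<le> 1 \<and> x\<^sup>2 * y \<le> 1 \<and> x * y ^ 4 \<le> 1"
  proof (cases "y \<ge> 1")
    case True then show ?thesis using xy by simp
  next
    case False
    then show ?thesis using x y by (intro conjI mult_le_one) (auto simp: power_le_one)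
  qed
  moreover have "0 \<le> x\<^sup>2 * y" "0 \<le> x * y ^ 4" using x y by auto
  ultimately show "cutoff' r \<le> 9" "\<bar>cutoff'' r\<bar> \<le> 72" unfolding eq mult.assoc by linarith+
  have "r < 1 \<or> r > 2 \<Longrightarrow> x = 0 \<or> y = 0" using r2 by (auto simp: y_def)
  then show "r < 1 \<or> r > 2 \<Longrightarrow> cutoff' r = 0" "r < 1 \<or> r > 2 \<Longrightarrow> cutoff'' r = 0"
    unfolding eq by auto
qed

definition Wt :: "real \<Rightarrow> 'a::euclidean_space \<Rightarrow> real" where
  "Wt \<nu> x = (1 + (norm x)\<^sup>2) powr (- \<nu>)"

lemma Wt_pos: "Wt \<nu> x > 0" and Wt_le_1: "\<nu> \<ge> 0 \<Longrightarrow> Wt \<nu> x \<le> 1"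
  unfolding Wt_def using powr_mono2'[of "-\<nu>" 1 "1 + (norm x)\<^sup>2"] by (auto simp: add_nonneg_eq_0_iff add_pos_nonneg less_imp_neq[symmetric])

text \<open>Quotients of squares make this a function of |x|^2. The transition layers are \<delta>^2
  \<le> |x|^2 \<le> 2 \<delta>^2 and R^2 \<le> |x|^2 \<le> 2 R^2.\<close>

definition cut_weight :: "real \<Rightarrow> real \<Rightarrow> real \<Rightarrow> 'a::euclidean_space \<Rightarrow> real" where
  "cut_weight \<nu> \<delta> R x = cutoff ((norm x)\<^sup>2 / \<delta>\<^sup>2) * (1 - cutoff ((norm x)\<^sup>2 / R\<^sup>2)) * Wt \<nu> x"

lemma cut_weight_bounds: "0 \<le> cut_weight \<nu> \<delta> R x" "cut_weight \<nu> \<delta> R x \<le> Wt \<nu> x"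
  unfolding cut_weight_def using cutoff_values(3,4) Wt_pos[of \<nu> x]
  by (auto intro!: mult_nonneg_nonneg mult_left_le_one_le mult_le_one)

lemma cut_weight_eq:
  assumes "0 < \<delta>" "0 < R" "2 * \<delta>\<^sup>2 \<le> (norm x)\<^sup>2" "(norm x)\<^sup>2 \<le> R\<^sup>2"
  shows "cut_weight \<nu> \<delta> R x = Wt \<nu> x"
  unfolding cut_weight_def using assms by (simp add: cutoff_values(1,2) pos_le_divide_eq)

lemma cut_weight_supp:
  assumes "0 < \<delta>" "0 < R" "x \<notin> {x. \<delta> \<le> norm x \<and> norm x \<le> 2 * R}"
  shows "cut_weight \<nu> \<delta> R x = 0"
proof (cases "norm x < \<delta>")
  case True
  then have "(norm x)\<^sup>2 \<le> \<delta>\<^sup>2" by (intro power_mono) auto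
  then show ?thesis unfolding cut_weight_def using assms by (simp add: cutoff_values(1))
next
  case False
  then have "(2 * R)\<^sup>2 \<le> (norm x)\<^sup>2" using assms by (intro power_mono) auto
  then have "2 * R\<^sup>2 \<le> (norm x)\<^sup>2" by (simp add: power_mult_distrib) (smt (verit) zero_le_power2)
  then show ?thesis unfolding cut_weight_def using assms by (simp add: cutoff_values(2) pos_le_divide_eq)
qed

lemma powr_deriv_shift:
  assumes "q \<ge> (0::real)"
  shows "((\<lambda>q. (1 + q) powr (- \<nu>)) has_real_derivative - \<nu> * (1 + q) powr (- \<nu> - 1)) (at q)"
    "((\<lambda>q. - \<nu> * (1 + q) powr (- \<nu> - 1)) has_real_derivative \<nu> * (\<nu> + 1) * (1 + q) powr (- \<nu> - 2)) (at q)"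
proof -
  have d: "((\<lambda>q. 1 + q) has_real_derivative 1) (at q)" by (auto intro!: derivative_eq_intros)
  have p: "((\<lambda>q. (1 + q) powr r) has_real_derivative r * (1 + q) powr (r - 1)) (at q)" for r
    using DERIV_chain2[OF has_real_derivative_powr d, of r] assms by simp
  show "((\<lambda>q. (1 + q) powr (- \<nu>)) has_real_derivative - \<nu> * (1 + q) powr (- \<nu> - 1)) (at q)" by (rule p)
  show "((\<lambda>q. - \<nu> * (1 + q) powr (- \<nu> - 1)) has_real_derivative \<nu> * (\<nu> + 1) * (1 + q) powr (- \<nu> - 2)) (at q)"
    using DERIV_cmult[OF p, of "- \<nu>" "- \<nu> - 1"] by (simp add: algebra_simps)
qed

text \<open>The weight is superharmonic for \<open>0 \<le> \<nu> \<le> n / 2 - 1\<close>; only the cutoff layers contribute.\<close>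

lemma cut_weight_laplacian:
  fixes \<nu> \<delta> R :: real
  assumes \<nu>: "0 \<le> \<nu>" "2 * (\<nu> + 1) \<le> real DIM('a)" and \<delta>R: "0 < \<delta>" "0 < R" "2 * \<delta>\<^sup>2 < R\<^sup>2"
  shows "Ck_on 2 UNIV (cut_weight \<nu> \<delta> R :: 'a::euclidean_space \<Rightarrow> real)"
    and "laplacian (cut_weight \<nu> \<delta> R) (x::'a) \<le> (18 * real DIM('a) + 576 + 72 * \<nu>) *
      (indicator {x. \<delta> \<le> norm x \<and> norm x \<le> 2 * \<delta>} x / \<delta>\<^sup>2
       + indicator {x. R \<le> norm x \<and> norm x \<le> 2 * R} x * (R powr (- (2 * \<nu>)) / R\<^sup>2))"
proof -
  define n where "n = real DIM('a)"
  define c where "c = inverse (\<delta>\<^sup>2)"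
  define d where "d = inverse (R\<^sup>2)"
  have c: "c > 0" and d: "d > 0" using \<delta>R by (auto simp: c_def d_def)
  define A where "A q = cutoff (q * c)" for q
  define A1 where "A1 q = cutoff' (q * c) * c" for q
  define A2 where "A2 q = cutoff'' (q * c) * c * c" for q
  define B where "B q = 1 - cutoff (q * d)" for q
  define B1 where "B1 q = - (cutoff' (q * d) * d)" for q
  define B2 where "B2 q = - (cutoff'' (q * d) * d * d)" for q
  define V where "V q = (1 + q) powr (- \<nu>)" for q
  define V1 where "V1 q = - \<nu> * (1 + q) powr (- \<nu> - 1)" for q
  define V2 where "V2 q = \<nu> * (\<nu> + 1) * (1 + q) powr (- \<nu> - 2)" for q
  \<comment> \<open>In q = |x|^2 the Laplacian is the operator 2 n d/dq + 4 q (d/dq)^2. The product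
    rule splits it into this operator on each of the three factors and the mixed products of first
    derivatives, which are estimated one by one.\<close>
  define G where "G q = A q * B q * V q" for q
  define G1 where "G1 q = (A1 q * B q + B1 q * A q) * V q + V1 q * (A q * B q)" for q
  define G2 where "G2 q = (A2 q * B q + 2 * A1 q * B1 q + B2 q * A q) * V q
     + 2 * V1 q * (A1 q * B q + B1 q * A q) + V2 q * (A q * B q)" for q
  have dc: "((\<lambda>q. q * k) has_real_derivative k) (at q)" for k q :: real by (auto intro!: derivative_eq_intros)
  have DA: "(A has_real_derivative A1 q) (at q)" for q
    unfolding A_def[abs_def] A1_def by (rule DERIV_chain2[OF cutoff_deriv(1) dc])
  have DA1: "(A1 has_real_derivative A2 q) (at q)" for q
    unfolding A1_def[abs_def] A2_def by (intro DERIV_cmult_right DERIV_chain2[OF cutoff_deriv(2) dc])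
  have DB: "(B has_real_derivative B1 q) (at q)" for q
    unfolding B_def[abs_def] B1_def using DERIV_diff[OF DERIV_const DERIV_chain2[OF cutoff_deriv(1) dc], of 1 d q] by simp
  have DB1: "(B1 has_real_derivative B2 q) (at q)" for q
    unfolding B1_def[abs_def] B2_def by (intro DERIV_minus DERIV_cmult_right DERIV_chain2[OF cutoff_deriv(2) dc])
  have DV: "(V has_real_derivative V1 q) (at q)" "(V1 has_real_derivative V2 q) (at q)" if "q \<ge> 0" for q
    unfolding V_def[abs_def] V1_def[abs_def] V2_def by (rule powr_deriv_shift[OF that])+
  have DG: "(G has_real_derivative G1 q) (at q)" if "q \<ge> 0" for q
    unfolding G_def[abs_def] G1_def
    by (rule DERIV_mult[OF DERIV_mult[OF DA DB] DV(1)[OF that]])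
  have DG1: "(G1 has_real_derivative G2 q) (at q)" if "q \<ge> 0" for q
  proof -
    note S = DERIV_add[OF DERIV_mult[OF DA1 DB] DERIV_mult[OF DB1 DA]]
    have "(G1 has_real_derivative ((A2 q * B q + B1 q * A1 q) + (B2 q * A q + A1 q * B1 q)) * V q
        + V1 q * (A1 q * B q + B1 q * A q) + (V2 q * (A q * B q) + (A1 q * B q + B1 q * A q) * V1 q)) (at q)"
      unfolding G1_def[abs_def]
      by (rule DERIV_add[OF DERIV_mult[OF S DV(1)[OF that]] DERIV_mult[OF DV(2)[OF that] DERIV_mult[OF DA DB]]])
    then show ?thesis by (simp add: G2_def algebra_simps)
  qed
  have cont: "continuous_on ((\<lambda>x::'a. (norm (x - 0))\<^sup>2) ` UNIV) G2"
  proof -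
    have cA: "continuous_on T A" "continuous_on T A1" "continuous_on T B" "continuous_on T B1" for T
      using DA DA1 DB DB1 by (meson DERIV_isCont continuous_at_imp_continuous_on)+
    have "continuous_on {0..} G2" unfolding G2_def[abs_def] V_def V1_def V2_def A2_def B2_def
      by (intro continuous_intros cA continuous_on_compose2[OF cutoff_deriv(3)[of UNIV]]) auto
    then show ?thesis by (rule continuous_on_subset) auto
  qed
  have eqG: "cut_weight \<nu> \<delta> R = (\<lambda>x::'a. G ((norm (x - 0))\<^sup>2))"
    by (simp add: fun_eq_iff cut_weight_def G_def A_def B_def V_def c_def d_def Wt_def divide_inverse)
  note rad = Ck_on_2_radial[of "UNIV :: 'a set" G G1 0 G2, OF open_UNIV DG[OF zero_le_power2] DG1[OF zero_le_power2] cont]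
  show "Ck_on 2 UNIV (cut_weight \<nu> \<delta> R :: 'a \<Rightarrow> real)" unfolding eqG by (rule rad(1))
  define q where "q = (norm x)\<^sup>2"
  have q0: "q \<ge> 0" by (simp add: q_def)
  have lap: "laplacian (cut_weight \<nu> \<delta> R) x = 2 * n * G1 q + 4 * q * G2 q"
    unfolding eqG n_def q_def using rad(3)[of x] by simp
  let ?M = "18 * n + 576 + 72 * \<nu>"
  have AB: "0 \<le> A q" "A q \<le> 1" "0 \<le> B q" "B q \<le> 1" "0 \<le> A1 q" "B1 q \<le> 0"
    using cutoff_values(3-5) c d by (auto simp: A_def B_def A1_def B1_def)
  have V: "0 < V q" "V q \<le> 1" "V1 q \<le> 0"
    using q0 \<nu> powr_mono2'[of "-\<nu>" 1 "1 + q"] by (auto simp: V_def V1_def)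
  have Vp: "(1 + q) powr (- \<nu>) = (1 + q) * (1 + q) powr (- \<nu> - 1)"
       "(1 + q) powr (- \<nu> - 1) = (1 + q) * (1 + q) powr (- \<nu> - 2)"
  proof -
    have e: "1 + (- \<nu> - 1) = - \<nu>" "1 + (- \<nu> - 2) = - \<nu> - 1" by simp_all
    show "(1 + q) powr (- \<nu>) = (1 + q) * (1 + q) powr (- \<nu> - 1)"
       "(1 + q) powr (- \<nu> - 1) = (1 + q) * (1 + q) powr (- \<nu> - 2)"
      using q0 powr_add[of "1 + q" 1 "- \<nu> - 1"] powr_add[of "1 + q" 1 "- \<nu> - 2"] unfolding e by simp_all
  qed
  \<comment> \<open>The superharmonicity of the weight; this is where 2 (\<nu> + 1) \<le> n
    enters.\<close>
  have LV: "2 * n * V1 q + 4 * q * V2 q \<le> 0"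
  proof -
    have "2 * n * V1 q + 4 * q * V2 q = 2 * \<nu> * (1 + q) powr (- \<nu> - 2) * (2 * (\<nu> + 1) * q - n * (1 + q))"
      unfolding V1_def V2_def Vp(2) by (simp add: algebra_simps)
    moreover have "2 * (\<nu> + 1) * q \<le> n * (1 + q)"
      using \<nu> q0 by (intro order_trans[OF mult_right_mono[OF \<nu>(2)]]) (auto simp: n_def algebra_simps)
    ultimately show ?thesis using \<nu> by (simp add: mult_nonneg_nonpos)
  qed
  have qV1: "- (q * V1 q) \<le> \<nu> * V q"
    using q0 \<nu> unfolding V_def V1_def Vp(1) by (simp add: mult_right_mono mult_left_mono mult.left_commute[of q])
  \<comment> \<open>The constants come from the bounds 9 and 72: 2 n 9 = 18 n, and 4 (q k) 72 \<le>
    576 because q k \<le> 2 in the layer.\<close>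
  have layer: "2 * n * (cutoff' (q * k) * k) + 4 * q * \<bar>cutoff'' (q * k) * k * k\<bar> \<le> (18 * n + 576) * k * indicator {1..2} (q * k)"
    if k: "k > 0" for k
  proof (cases "q * k \<in> {1..2}")
    case True
    have "2 * n * (cutoff' (q * k) * k) \<le> 2 * n * (9 * k)"
      using cutoff_values(6) k by (intro mult_left_mono mult_right_mono) (auto simp: n_def)
    moreover have "4 * q * \<bar>cutoff'' (q * k) * k * k\<bar> = 4 * (q * k) * \<bar>cutoff'' (q * k)\<bar> * k"
      using k by (simp add: abs_mult)
    moreover have "4 * (q * k) * \<bar>cutoff'' (q * k)\<bar> * k \<le> 4 * 2 * 72 * k"
      using cutoff_values(7)[of "q * k"] k True by (intro mult_mono) auto
    ultimately have "2 * n * (cutoff' (q * k) * k) + 4 * q * \<bar>cutoff'' (q * k) * k * k\<bar> \<le> 2 * n * (9 * k) + 4 * 2 * 72 * k"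
      by linarith
    then show ?thesis using True by (simp add: distrib_right)
  next
    case False
    then have "q * k < 1 \<or> q * k > 2" by auto
    then show ?thesis using cutoff_values(8,9) False by simp
  qed
  \<comment> \<open>The two layers are disjoint because 2 \<delta>^2 < R^2.\<close>
  have prod0: "A1 q * B1 q = 0"
  proof (cases "q * c > 2")
    case True then show ?thesis by (simp add: A1_def cutoff_values(8))
  next
    case False
    then have "q \<le> 2 * \<delta>\<^sup>2" using \<delta>R by (simp add: c_def field_simps)
    then have "q * d < 1" using \<delta>R by (simp add: d_def field_simps)
    then show ?thesis by (simp add: B1_def cutoff_values(8))
  qed
  have LA: "2 * n * A1 q + 4 * q * A2 q \<le> (18 * n + 576) * c * indicator {1..2} (q * c)"
    using layer[OF c] q0 by (smt (verit) A1_def A2_def abs_ge_self mult_left_mono)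
  have LB: "2 * n * B1 q + 4 * q * B2 q \<le> (18 * n + 576) * d * indicator {1..2} (q * d)"
  proof -
    have "4 * q * B2 q \<le> 4 * q * \<bar>cutoff'' (q * d) * d * d\<bar>" unfolding B2_def using q0 by (intro mult_left_mono) auto
    moreover have "2 * n * B1 q \<le> 2 * n * (cutoff' (q * d) * d)"
      using AB(6) cutoff_values(5)[of "q * d"] d by (intro mult_left_mono) (auto simp: n_def B1_def)
    ultimately show ?thesis using layer[OF d] by linarith
  qed
  \<comment> \<open>In the inner layer the mixed term has a favourable sign, since the cutoff
    increases while the weight decreases. Only the outer layer costs, with 8 times 9 giving 72
    \<nu>.\<close>
  have cross: "8 * q * (V1 q * (A1 q * B q + B1 q * A q)) \<le> 72 * \<nu> * d * V q * indicator {1..2} (q * d)"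
  proof -
    have "V1 q * (A1 q * B q) \<le> 0" using V AB by (simp add: mult_nonpos_nonneg)
    then have 1: "8 * q * (V1 q * (A1 q * B q)) \<le> 0" using q0 by (simp add: mult_nonneg_nonpos)
    have "- B1 q * A q \<le> 9 * d * indicator {1..2} (q * d)"
    proof (cases "q * d \<in> {1..2}")
      case True
      have "- B1 q * A q \<le> - B1 q * 1" using AB by (intro mult_left_mono) auto
      then have "- B1 q * A q \<le> - B1 q" by simp
      also have "\<dots> \<le> 9 * d" using cutoff_values(6)[of "q * d"] d by (simp add: B1_def mult_right_mono)
      finally show ?thesis using True by simp
    next
      case False
      then have "q * d < 1 \<or> q * d > 2" by auto
      then show ?thesis using False by (simp add: B1_def cutoff_values(8))
    qed
    then have "(- (q * V1 q)) * (- B1 q * A q) \<le> (\<nu> * V q) * (9 * d * indicator {1..2} (q * d))"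
    proof (rule mult_mono[OF qV1])
      show "0 \<le> \<nu> * V q" using \<nu> V by simp
      show "0 \<le> - B1 q * A q" using AB by (simp add: mult_nonpos_nonneg)
    qed
    then have "8 * q * (V1 q * (B1 q * A q)) \<le> 72 * \<nu> * d * V q * indicator {1..2} (q * d)" by (simp add: mult_ac)
    with 1 have "8 * q * (V1 q * (A1 q * B q)) + 8 * q * (V1 q * (B1 q * A q)) \<le> 72 * \<nu> * d * V q * indicator {1..2} (q * d)"
      by linarith
    then show ?thesis by (simp only: distrib_left)
  qed
  have "2 * n * G1 q + 4 * q * G2 q = (2 * n * V1 q + 4 * q * V2 q) * (A q * B q)
     + (2 * n * A1 q + 4 * q * A2 q) * (B q * V q) + (2 * n * B1 q + 4 * q * B2 q) * (A q * V q)
     + 8 * q * (V1 q * (A1 q * B q + B1 q * A q)) + 8 * q * (A1 q * B1 q) * V q"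
    unfolding G1_def G2_def by (simp add: algebra_simps)
  also have "\<dots> \<le> 0 + (18 * n + 576) * c * indicator {1..2} (q * c) 
     + ((18 * n + 576) * d * indicator {1..2} (q * d)) * V q
     + 72 * \<nu> * d * V q * indicator {1..2} (q * d) + 0"
  proof (intro add_mono)
    show "(2 * n * V1 q + 4 * q * V2 q) * (A q * B q) \<le> 0" using LV AB by (simp add: mult_nonpos_nonneg)
    have n0: "n \<ge> 0" by (simp add: n_def)
    have "(2 * n * A1 q + 4 * q * A2 q) * (B q * V q) \<le> ((18 * n + 576) * c * indicator {1..2} (q * c)) * (B q * V q)"
      using LA AB V by (intro mult_right_mono) auto
    also have "\<dots> \<le> (18 * n + 576) * c * indicator {1..2} (q * c)"
      using AB V c n0 by (intro mult_left_le mult_le_one) auto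
    finally show "(2 * n * A1 q + 4 * q * A2 q) * (B q * V q) \<le> (18 * n + 576) * c * indicator {1..2} (q * c)" .
    have "(2 * n * B1 q + 4 * q * B2 q) * (A q * V q) \<le> ((18 * n + 576) * d * indicator {1..2} (q * d)) * (A q * V q)"
      using LB AB V by (intro mult_right_mono) auto
    also have "\<dots> \<le> ((18 * n + 576) * d * indicator {1..2} (q * d)) * V q"
      using AB V d n0 by (intro mult_left_mono mult_left_le_one_le) auto
    finally show "(2 * n * B1 q + 4 * q * B2 q) * (A q * V q) \<le> ((18 * n + 576) * d * indicator {1..2} (q * d)) * V q" .
  qed (use cross prod0 in auto)
  also have "\<dots> = (18 * n + 576) * c * indicator {1..2} (q * c) + ?M * (d * V q * indicator {1..2} (q * d))"
    by (simp add: algebra_simps)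
  also have "\<dots> \<le> ?M * (indicator {x. \<delta> \<le> norm x \<and> norm x \<le> 2 * \<delta>} x / \<delta>\<^sup>2)
      + ?M * (indicator {x. R \<le> norm x \<and> norm x \<le> 2 * R} x * (R powr (- (2 * \<nu>)) / R\<^sup>2))"
  proof (intro add_mono mult_left_mono)
    have ann: "r \<le> norm x \<and> norm x \<le> 2 * r" if "r > 0" "q * inverse (r\<^sup>2) \<in> {1..2}" for r
    proof -
      have "r\<^sup>2 \<le> (norm x)\<^sup>2" "(norm x)\<^sup>2 \<le> 2 * r\<^sup>2" using that by (auto simp: q_def field_simps)
      moreover have "2 * r\<^sup>2 \<le> (2 * r)\<^sup>2" by (simp add: power_mult_distrib)
      ultimately show ?thesis using that(1) by (smt (verit) norm_ge_zero power2_le_imp_le)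
    qed
    have "c * indicator {1..2} (q * c) \<le> indicator {x. \<delta> \<le> norm x \<and> norm x \<le> 2 * \<delta>} x / \<delta>\<^sup>2"
      using ann[OF \<delta>R(1)] by (auto simp: indicator_def c_def divide_inverse)
    then show "(18 * n + 576) * c * indicator {1..2} (q * c) \<le> ?M * (indicator {x. \<delta> \<le> norm x \<and> norm x \<le> 2 * \<delta>} x / \<delta>\<^sup>2)"
      using c \<nu> unfolding mult.assoc by (intro mult_mono) (auto simp: n_def)
    show "d * V q * indicator {1..2} (q * d) \<le> indicator {x. R \<le> norm x \<and> norm x \<le> 2 * R} x * (R powr (- (2 * \<nu>)) / R\<^sup>2)"
    proof (cases "q * d \<in> {1..2}")
      case True
      then have a: "R \<le> norm x \<and> norm x \<le> 2 * R" using ann[OF \<delta>R(2)] by (simp add: d_def)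
      have "R\<^sup>2 \<le> 1 + q" using True \<delta>R by (simp add: d_def field_simps)
      then have "V q \<le> (R\<^sup>2) powr (- \<nu>)" unfolding V_def using \<nu> \<delta>R by (intro powr_mono2') auto
      also have "\<dots> = R powr (- (2 * \<nu>))" using \<delta>R by (simp add: powr_powr flip: powr_numeral)
      finally show ?thesis using a True d by (simp add: d_def divide_inverse mult.commute)
    qed (use \<nu> in auto)
    show "0 \<le> ?M" using \<nu> by (simp add: n_def)
  qed
  finally show "laplacian (cut_weight \<nu> \<delta> R) x \<le> (18 * real DIM('a) + 576 + 72 * \<nu>) *
      (indicator {x. \<delta> \<le> norm x \<and> norm x \<le> 2 * \<delta>} x / \<delta>\<^sup>2
       + indicator {x. R \<le> norm x \<and> norm x \<le> 2 * R} x * (R powr (- (2 * \<nu>)) / R\<^sup>2))"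
    unfolding lap n_def by (simp only: distrib_left)
qed

lemma measure_cball_scaled:
  fixes x :: "'a::euclidean_space"
  assumes "r > 0"
  shows "measure lborel (cball x r) = measure lborel (cball (0::'a) 1) * r ^ DIM('a)"
proof -
  have "measure lborel (cball x r) = unit_ball_vol (real DIM('a)) * r ^ DIM('a)" using assms by (simp add: content_cball)
  moreover have "measure lborel (cball (0::'a) 1) = unit_ball_vol (real DIM('a))" by (simp add: content_cball)
  ultimately show ?thesis by simp
qed

text \<open>The growth of a solution that makes the contraction independent of the behaviour at the origin and
  at infinity; the time singularity \<open>t powr (-\<theta>)\<close> is integrable.\<close>

definition admissible :: "real \<Rightarrow> real \<Rightarrow> real \<Rightarrow> real \<Rightarrow> real \<Rightarrow> ('a::euclidean_space \<Rightarrow> real \<Rightarrow> real) \<Rightarrow> bool" where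
  "admissible m a \<kappa> \<theta> T u \<longleftrightarrow> (\<exists>C\<ge>0. \<forall>x t. x \<noteq> 0 \<and> 0 < t \<and> t \<le> T \<longrightarrow>
     u x t powr m \<le> C * norm x powr (- a) \<and> u x t powr m \<le> C * t powr (- \<theta>) * norm x powr (- \<kappa>))"

text \<open>The part of \<open>cauchy_solution\<close> that concerns initial data, stated for any
  function of space and time. Local integrability of the data provides their measurability.\<close>

definition initial_trace :: "('a::euclidean_space \<Rightarrow> real \<Rightarrow> real) \<Rightarrow> ('a \<Rightarrow> real) \<Rightarrow> bool" where
  "initial_trace u u0 \<longleftrightarrow> L1_loc u0 \<and> (\<forall>K. compact K \<and> K \<subseteq> - {0} \<longrightarrow>
     ((\<lambda>t. L1_norm_weighted (\<lambda>_. 1) K (\<lambda>x. u x t - u0 x)) \<longlongrightarrow> 0) (at_right 0))"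

lemma annulus_integral:
  fixes g :: "'a::euclidean_space \<Rightarrow> real"
  assumes "integrable lborel g" "c \<ge> 0" "r > 0" "\<And>x. g x \<le> c * indicator {x. r \<le> norm x \<and> norm x \<le> 2 * r} x"
  shows "(\<integral>x. g x \<partial>lborel) \<le> c * (measure lborel (cball (0::'a) 1) * (2 * r) ^ DIM('a))"
proof -
  have f: "emeasure lborel (cball (0::'a) (2 * r)) < \<infinity>" by (rule emeasure_compact_finite[OF compact_cball])
  have "(\<integral>x. g x \<partial>lborel) \<le> (\<integral>x. c * indicator (cball 0 (2 * r)) x \<partial>(lborel :: 'a measure))"
  proof (rule integral_mono[OF assms(1)])
    show "integrable lborel (\<lambda>x::'a. c * indicator (cball 0 (2 * r)) x :: real)"
      using f by (intro integrable_mult_right integrable_real_indicator) auto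
    fix x show "g x \<le> c * indicator (cball 0 (2 * r)) x"
      using assms(4)[of x] assms(2)
      by (cases "norm x \<le> 2 * r"; cases "r \<le> norm x") (auto simp: indicator_def)
  qed
  also have "\<dots> = c * measure lborel (cball (0::'a) (2 * r))" by simp
  also have "\<dots> = c * (measure lborel (cball (0::'a) 1) * (2 * r) ^ DIM('a))"
    using measure_cball_scaled[of "2 * r" "0::'a"] assms(3) by simp
  finally show ?thesis .
qed

text \<open>The positive part of u^m - v^m is at most u^m, so bounds on \<open>u\<close> alone
  suffice. Each error term is a bound for u^m, times one for the Laplacian of the weight, times the
  volume of the layer: \<delta>^(-a) \<delta>^(-2) \<delta>^n at the origin, and t^(-\<theta>)
  R^(-\<kappa>) R^(-2 \<nu> - 2) R^n far out, both integrated in time.\<close>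

lemma contraction_cut:
  fixes u v :: "'a::euclidean_space \<Rightarrow> real \<Rightarrow> real"
  assumes m: "m > 0" and u: "fde_sol m u" and v: "fde_sol m v"
    and C: "C \<ge> 0" "\<And>x t. x \<noteq> 0 \<Longrightarrow> 0 < t \<Longrightarrow> t \<le> T \<Longrightarrow> u x t powr m \<le> C * norm x powr (- a)"
      "\<And>x t. x \<noteq> 0 \<Longrightarrow> 0 < t \<Longrightarrow> t \<le> T \<Longrightarrow> u x t powr m \<le> C * t powr (- \<theta>) * norm x powr (- \<kappa>)"
    and a: "0 \<le> a" "0 \<le> \<kappa>" and \<theta>: "\<theta> < 1"
    and \<nu>: "0 \<le> \<nu>" "2 * (\<nu> + 1) \<le> real DIM('a)" and \<delta>R: "0 < \<delta>" "0 < R" "2 * \<delta>\<^sup>2 < R\<^sup>2"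
    and t: "0 < t0" "t0 \<le> t" "t \<le> T"
  defines "L \<equiv> (18 * real DIM('a) + 576 + 72 * \<nu>) * (C / m) * (measure lborel (cball (0::'a) 1) * 2 ^ DIM('a))"
  shows "(\<integral>x. max 0 (u x t - v x t) * cut_weight \<nu> \<delta> R x \<partial>lborel)
    \<le> (\<integral>x. max 0 (u x t0 - v x t0) * cut_weight \<nu> \<delta> R x \<partial>lborel)
      + L * (\<delta> powr (real DIM('a) - 2 - a) * t + R powr (real DIM('a) - 2 - \<kappa> - 2 * \<nu>) * (t powr (1 - \<theta>) / (1 - \<theta>)))"
proof -
  let ?K = "{x::'a. \<delta> \<le> norm x \<and> norm x \<le> 2 * R}"
  let ?\<xi> = "cut_weight \<nu> \<delta> R :: 'a \<Rightarrow> real"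
  let ?n = "real DIM('a)"
  define M where "M = 18 * ?n + 576 + 72 * \<nu>"
  define b where "b = measure lborel (cball (0::'a) 1)"
  have M: "M \<ge> 0" using \<nu> by (simp add: M_def)
  have b: "b \<ge> 0" by (simp add: b_def)
  have cK: "compact ?K"
  proof -
    have "?K = cball 0 (2 * R) - ball 0 \<delta>" by (auto simp: not_less)
    then show ?thesis by (simp add: compact_diff)
  qed
  note cw = cut_weight_laplacian[OF \<nu> \<delta>R]
  interpret fde_pair ?\<xi> ?K m u v
  proof
    show "continuous_on UNIV ?\<xi>" by (rule Ck_on_2_continuous(1)[OF cw(1)])
  qed (use cK m u v \<delta>R cw(1) cut_weight_supp[OF \<delta>R(1,2)] in auto)
  define E where "E s = L * (\<delta> powr (?n - 2 - a) + R powr (?n - 2 - \<kappa> - 2 * \<nu>) * s powr (- \<theta>))" for s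
  define S where "S s = L * (\<delta> powr (?n - 2 - a) * s + R powr (?n - 2 - \<kappa> - 2 * \<nu>) * (s powr (1 - \<theta>) / (1 - \<theta>)))" for s
  have L: "L \<ge> 0" unfolding L_def using M b C m by (auto simp: M_def b_def)
  have bound: "(\<integral>x. max 0 (z x s) * max 0 (laplacian ?\<xi> x) \<partial>lborel) \<le> E s" if s: "s \<in> {t0..t}" for s
  proof -
    have s0: "0 < s" "s \<le> T" using s t by auto
    have zle: "max 0 (z x s) \<le> u x s powr m / m" for x using m by (auto simp: z_def)
    let ?I1 = "indicator {x::'a. \<delta> \<le> norm x \<and> norm x \<le> 2 * \<delta>}"
    let ?I2 = "indicator {x::'a. R \<le> norm x \<and> norm x \<le> 2 * R}"
    let ?c1 = "M * (C / m) * (\<delta> powr (- a) / \<delta>\<^sup>2)"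
    let ?c2 = "M * (C / m) * (s powr (- \<theta>) * R powr (- \<kappa>) * (R powr (- (2 * \<nu>)) / R\<^sup>2))"
    have pt: "max 0 (z x s) * max 0 (laplacian ?\<xi> x) \<le> ?c1 * ?I1 x + ?c2 * ?I2 x" for x
    proof (cases "x = 0")
      case True
      have "laplacian ?\<xi> x = 0"
        by (rule laplacian_zero_outside[OF cK supp]) (use True \<delta>R in auto)
      then show ?thesis using True \<delta>R by simp
    next
      case False
      have lm: "max 0 (laplacian ?\<xi> x) \<le> M * (?I1 x / \<delta>\<^sup>2 + ?I2 x * (R powr (- (2 * \<nu>)) / R\<^sup>2))"
        using cw(2)[of x] M by (auto simp: M_def)
      have "max 0 (z x s) * max 0 (laplacian ?\<xi> x)
          \<le> (u x s powr m / m) * (M * (?I1 x / \<delta>\<^sup>2 + ?I2 x * (R powr (- (2 * \<nu>)) / R\<^sup>2)))"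
        using lm zle m by (intro mult_mono) auto
      also have "\<dots> = M * ((u x s powr m / m * ?I1 x) * (1 / \<delta>\<^sup>2)) + M * ((u x s powr m / m * ?I2 x) * (R powr (- (2 * \<nu>)) / R\<^sup>2))"
        by (simp add: algebra_simps)
      also have "\<dots> \<le> M * ((C * \<delta> powr (- a) / m * ?I1 x) * (1 / \<delta>\<^sup>2))
            + M * ((C * s powr (- \<theta>) * R powr (- \<kappa>) / m * ?I2 x) * (R powr (- (2 * \<nu>)) / R\<^sup>2))"
      proof (rule add_mono; rule mult_left_mono[OF mult_right_mono M])
        show "u x s powr m / m * ?I1 x \<le> C * \<delta> powr (- a) / m * ?I1 x"
        proof (cases "\<delta> \<le> norm x")
          case True
          have "u x s powr m \<le> C * norm x powr (- a)" by (rule C(2)[OF False s0])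
          also have "\<dots> \<le> C * \<delta> powr (- a)" using True C \<delta>R a by (intro mult_left_mono powr_mono2') auto
          finally show ?thesis using m by (intro mult_right_mono divide_right_mono) auto
        qed simp
        show "u x s powr m / m * ?I2 x \<le> C * s powr (- \<theta>) * R powr (- \<kappa>) / m * ?I2 x"
        proof (cases "R \<le> norm x")
          case True
          have "u x s powr m \<le> C * s powr (- \<theta>) * norm x powr (- \<kappa>)" by (rule C(3)[OF False s0])
          also have "\<dots> \<le> C * s powr (- \<theta>) * R powr (- \<kappa>)" using True C \<delta>R a by (intro mult_left_mono powr_mono2') auto
          finally show ?thesis using m by (intro mult_right_mono divide_right_mono) auto
        qed simp
      qed auto
      finally show ?thesis by (simp add: mult_ac)
    qed
    have meas: "{x::'a. r \<le> norm x \<and> norm x \<le> 2 * r} \<in> sets lborel" for r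
      unfolding Collect_conj_eq by (intro sets.Int) measurable
    have f: "emeasure lborel {x::'a. r \<le> norm x \<and> norm x \<le> 2 * r} < \<infinity>" for r
      by (rule le_less_trans[OF emeasure_mono[of _ "cball 0 (2 * r)"]]) (use emeasure_compact_finite[OF compact_cball] in \<open>auto simp: less_top\<close>)
    have iI: "integrable lborel (\<lambda>x. c * indicator {x::'a. r \<le> norm x \<and> norm x \<le> 2 * r} x :: real)" for c r
      using f meas by (intro integrable_mult_right integrable_real_indicator) auto
    have "continuous_on ((- {0}) \<times> {0<..}) (\<lambda>(x, t). max 0 (z x t))"
      by (rule continuous_compose_pair[OF _ cont_z]) (auto intro!: continuous_intros)
    from test_integrable[OF this s0(1)]
    have "(\<integral>x. max 0 (z x s) * max 0 (laplacian ?\<xi> x) \<partial>lborel) \<le> (\<integral>x. ?c1 * ?I1 x + ?c2 * ?I2 x \<partial>lborel)"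
      by (rule integral_mono[OF _ Bochner_Integration.integrable_add[OF iI iI] pt])
    also have "\<dots> = (\<integral>x. ?c1 * ?I1 x \<partial>lborel) + (\<integral>x. ?c2 * ?I2 x \<partial>lborel)"
      by (rule Bochner_Integration.integral_add[OF iI iI])
    also have "\<dots> \<le> ?c1 * (b * (2 * \<delta>) ^ DIM('a)) + ?c2 * (b * (2 * R) ^ DIM('a))"
      unfolding b_def using M C m \<delta>R by (intro add_mono annulus_integral iI) auto
    also have "\<dots> = E s"
    proof -
      have p: "r powr (- k) / r\<^sup>2 * r ^ DIM('a) = r powr (?n - 2 - k)" if "r > 0" for r k :: real
      proof -
        have "r ^ DIM('a) = r powr ?n" "r\<^sup>2 = r powr 2" using that powr_realpow[of r "DIM('a)"] by simp_all
        then have "r powr (- k) / r\<^sup>2 * r ^ DIM('a) = r powr (- k - 2 + ?n)" by (simp only: powr_diff powr_add)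
        then show ?thesis by (simp add: algebra_simps)
      qed
      have p2: "R powr (- \<kappa>) * (R powr (- (2 * \<nu>)) / R\<^sup>2) * R ^ DIM('a) = R powr (?n - 2 - \<kappa> - 2 * \<nu>)"
      proof -
        have e: "- (\<kappa> + 2 * \<nu>) = - \<kappa> + - (2 * \<nu>)" "?n - 2 - (\<kappa> + 2 * \<nu>) = ?n - 2 - \<kappa> - 2 * \<nu>" by simp_all
        show ?thesis using p[OF \<delta>R(2), of "\<kappa> + 2 * \<nu>"] unfolding e powr_add by simp
      qed
      have "?c1 * (b * (2 * \<delta>) ^ DIM('a)) + ?c2 * (b * (2 * R) ^ DIM('a))
         = L * (\<delta> powr (- a) / \<delta>\<^sup>2 * \<delta> ^ DIM('a)
            + R powr (- \<kappa>) * (R powr (- (2 * \<nu>)) / R\<^sup>2) * R ^ DIM('a) * s powr (- \<theta>))"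
        unfolding L_def M_def[symmetric] b_def[symmetric] power_mult_distrib by (simp add: algebra_simps)
      then show ?thesis unfolding E_def p[OF \<delta>R(1)] p2 .
    qed
    finally show ?thesis .
  qed
  have dS: "(S has_real_derivative E s) (at s)" if "s \<in> {t0..t}" for s
  proof -
    have "((\<lambda>s. s powr (1 - \<theta>) / (1 - \<theta>)) has_real_derivative s powr (- \<theta>)) (at s)"
      using DERIV_cdivide[OF has_real_derivative_powr[of s "1 - \<theta>"], of "1 - \<theta>"] that t \<theta> by simp
    from DERIV_cmult[OF DERIV_add[OF DERIV_cmult[OF DERIV_ident, of "\<delta> powr (?n - 2 - a)"]
        DERIV_cmult[OF this, of "R powr (?n - 2 - \<kappa> - 2 * \<nu>)"]], of L]
    show ?thesis unfolding S_def[abs_def] E_def by simp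
  qed
  have "(\<integral>x. max 0 (w x t) * ?\<xi> x \<partial>lborel) \<le> (\<integral>x. max 0 (w x t0) * ?\<xi> x \<partial>lborel) + (S t - S t0)"
    by (rule kato[OF t(1,2) _ dS bound]) (rule cut_weight_bounds)
  \<comment> \<open>Dropping this term makes the error independent of the initial time, which can
    then go to 0; the error stays finite since \<theta> < 1.\<close>
  moreover have "S t0 \<ge> 0" unfolding S_def using L \<theta> t by (intro mult_nonneg_nonneg add_nonneg_nonneg) auto
  ultimately show ?thesis unfolding S_def w_def by linarith
qed

section \<open>Passage to the initial data\<close>

lemma L1_loc_measurable:
  assumes "L1_loc (f :: 'a::euclidean_space \<Rightarrow> real)" "compact K" "K \<subseteq> - {0}"
  shows "(\<lambda>x. indicator K x * f x) \<in> borel_measurable lebesgue"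
proof -
  have "set_integrable lebesgue K f" using assms by (simp add: L1_loc_def)
  then show ?thesis unfolding set_integrable_def by (auto dest: borel_measurable_integrable)
qed

lemma continuous_indicator_measurable:
  fixes f :: "'a::euclidean_space \<Rightarrow> real"
  assumes "compact K" "continuous_on K f"
  shows "(\<lambda>x. indicator K x * f x) \<in> borel_measurable lebesgue"
proof -
  have "(\<lambda>x. indicator K x *\<^sub>R f x) \<in> borel_measurable lborel"
    using borel_integrable_compact[OF assms] by (rule borel_measurable_integrable)
  then show ?thesis by (simp add: measurable_completion)
qed

lemma nn_integral_lebesgue_eq_integral:
  fixes f :: "'a::euclidean_space \<Rightarrow> real"
  assumes "integrable lborel f" "\<And>x. f x \<ge> 0"
  shows "(\<integral>\<^sup>+x. ennreal (f x) \<partial>lebesgue) = ennreal (\<integral>x. f x \<partial>lborel)"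
  unfolding nn_integral_completion using assms by (intro nn_integral_eq_integral) auto

text \<open>The annulus that carries \<open>cut_weight\<close>; note the outer radius 2 R.\<close>

definition cut_shell :: "real \<Rightarrow> real \<Rightarrow> 'a::euclidean_space set" where
  "cut_shell \<delta> R = {x. \<delta> \<le> norm x \<and> norm x \<le> 2 * R}"

lemma compact_cut_shell: "compact (cut_shell \<delta> R :: 'a::euclidean_space set)"
  and cut_shell_subset: "\<delta> > 0 \<Longrightarrow> (cut_shell \<delta> R :: 'a set) \<subseteq> - {0}"
proof -
  have "(cut_shell \<delta> R :: 'a set) = cball 0 (2 * R) - ball 0 \<delta>" by (auto simp: cut_shell_def not_less)
  then show "compact (cut_shell \<delta> R :: 'a set)" by (simp add: compact_diff)
qed (auto simp: cut_shell_def)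

lemma cut_weight_integrable:
  fixes g :: "'a::euclidean_space \<Rightarrow> real"
  assumes "0 \<le> \<nu>" "2 * (\<nu> + 1) \<le> real DIM('a)" "0 < \<delta>" "0 < R" "2 * \<delta>\<^sup>2 < R\<^sup>2" "continuous_on (- {0}) g"
  shows "integrable lborel (\<lambda>x. max 0 (g x) * cut_weight \<nu> \<delta> R x)"
proof (rule integrable_compact_support[OF compact_cut_shell])
  have "continuous_on UNIV (cut_weight \<nu> \<delta> R :: 'a \<Rightarrow> real)"
    by (rule Ck_on_2_continuous(1)[OF cut_weight_laplacian(1)[OF assms(1-5)]])
  then show "continuous_on (cut_shell \<delta> R) (\<lambda>x. max 0 (g x) * cut_weight \<nu> \<delta> R x)"
    using continuous_on_subset[OF assms(6) cut_shell_subset[OF assms(3)]]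
    by (intro continuous_intros) (auto intro: continuous_on_subset)
  show "x \<notin> cut_shell \<delta> R \<Longrightarrow> max 0 (g x) * cut_weight \<nu> \<delta> R x = 0" for x
    using cut_weight_supp[OF assms(3,4), of x] by (auto simp: cut_shell_def)
qed

text \<open>The bound holds from every initial time s > 0, and s goes to 0 by the L1 convergence on
  the compact shell that carries the cut weight, which is at most 1. Extended integrals are kept
  because the right side may be infinite.\<close>

lemma contraction_cut_initial:
  fixes u v :: "'a::euclidean_space \<Rightarrow> real \<Rightarrow> real"
  assumes m: "m > 0" and u: "fde_sol m u" and v: "fde_sol m v"
    and u0: "initial_trace u u0" and v0: "initial_trace v v0" and t: "t > 0"
    and \<nu>: "0 \<le> \<nu>" "2 * (\<nu> + 1) \<le> real DIM('a)" and \<delta>R: "0 < \<delta>" "0 < R" "2 * \<delta>\<^sup>2 < R\<^sup>2"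
    and e: "\<And>s. 0 < s \<Longrightarrow> s \<le> t \<Longrightarrow> (\<integral>x. max 0 (u x t - v x t) * cut_weight \<nu> \<delta> R x \<partial>lborel)
      \<le> (\<integral>x. max 0 (u x s - v x s) * cut_weight \<nu> \<delta> R x \<partial>lborel) + e" "e \<ge> 0"
  shows "(\<integral>\<^sup>+x. ennreal (max 0 (u x t - v x t) * cut_weight \<nu> \<delta> R x) \<partial>lebesgue)
     \<le> (\<integral>\<^sup>+x\<in>-{0}. ennreal (max 0 (u0 x - v0 x) * Wt \<nu> x) \<partial>lebesgue) + ennreal e"
proof -
  let ?\<xi> = "cut_weight \<nu> \<delta> R :: 'a \<Rightarrow> real"
  let ?K = "cut_shell \<delta> R :: 'a set"
  let ?N = "\<lambda>u u0 s. L1_norm_weighted (\<lambda>_. 1) ?K (\<lambda>x. u x s - u0 x :: real)"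
  let ?I = "\<lambda>s. \<integral>\<^sup>+x. ennreal (max 0 (u x s - v x s) * ?\<xi> x) \<partial>lebesgue"
  let ?J = "\<integral>\<^sup>+x\<in>-{0}. ennreal (max 0 (u0 x - v0 x) * Wt \<nu> x) \<partial>lebesgue"
  note K = compact_cut_shell[of \<delta> R, where 'a='a] cut_shell_subset[OF \<delta>R(1), of R, where 'a='a]
  have c: "continuous_on (- {0}) (\<lambda>x. u x s)" "continuous_on (- {0}) (\<lambda>x. v x s)" if "s > 0" for s
    using Ck_on_2_continuous(1)[OF fde_solD(2)[OF u that]] Ck_on_2_continuous(1)[OF fde_solD(2)[OF v that]] by auto
  have int: "integrable lborel (\<lambda>x. max 0 (u x s - v x s) * ?\<xi> x)" if "s > 0" for s
    by (rule cut_weight_integrable[OF \<nu> \<delta>R continuous_on_diff[OF c[OF that]]])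
  have 1: "?I t \<le> ?I s + ennreal e" if s: "0 < s" "s \<le> t" for s
    using e(1)[OF s] e(2) s t cut_weight_bounds(1)
    by (subst (1 2) nn_integral_lebesgue_eq_integral)
       (auto intro!: int mult_nonneg_nonneg integral_nonneg_AE ennreal_leI simp flip: ennreal_plus)
  have supp: "x \<notin> ?K \<Longrightarrow> ?\<xi> x = 0" for x using cut_weight_supp[OF \<delta>R(1,2), of x] by (auto simp: cut_shell_def)
  have mu0: "(\<lambda>x. indicator ?K x * u0 x) \<in> borel_measurable lebesgue" and mv0: "(\<lambda>x. indicator ?K x * v0 x) \<in> borel_measurable lebesgue"
    using u0 v0 L1_loc_measurable[OF _ K] by (auto simp: initial_trace_def)
  have m\<xi>: "?\<xi> \<in> borel_measurable lebesgue"
    using Ck_on_2_continuous(1)[OF cut_weight_laplacian(1)[OF \<nu> \<delta>R]]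
    by (simp add: borel_measurable_continuous_onI measurable_completion)
  have 2: "?I s \<le> ?J + (?N u u0 s + ?N v v0 s)" if s: "0 < s" for s
  proof -
    let ?f0 = "\<lambda>x. ennreal (max 0 (u0 x - v0 x) * ?\<xi> x)"
    let ?fu = "\<lambda>x. ennreal (\<bar>u x s - u0 x\<bar> * 1) * indicator ?K x"
    let ?fv = "\<lambda>x. ennreal (\<bar>v x s - v0 x\<bar> * 1) * indicator ?K x"
    have e0: "?f0 = (\<lambda>x. ennreal (max 0 (indicator ?K x * u0 x - indicator ?K x * v0 x) * ?\<xi> x))"
      using supp by (fastforce simp: indicator_def)
    have eu: "?fu = (\<lambda>x. ennreal \<bar>indicator ?K x * u x s - indicator ?K x * u0 x\<bar>)"
      and ev: "?fv = (\<lambda>x. ennreal \<bar>indicator ?K x * v x s - indicator ?K x * v0 x\<bar>)"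
      by (auto simp: indicator_def)
    have mu: "(\<lambda>x. indicator ?K x * u x s) \<in> borel_measurable lebesgue" "(\<lambda>x. indicator ?K x * v x s) \<in> borel_measurable lebesgue"
      using continuous_indicator_measurable[OF K(1) continuous_on_subset[OF c(1)[OF s] K(2)]]
        continuous_indicator_measurable[OF K(1) continuous_on_subset[OF c(2)[OF s] K(2)]] by auto
    have m0: "?f0 \<in> borel_measurable lebesgue" unfolding e0 using mu0 mv0 m\<xi> by measurable
    have mfu: "?fu \<in> borel_measurable lebesgue" unfolding eu using mu0 mu by measurable
    have mfv: "?fv \<in> borel_measurable lebesgue" unfolding ev using mv0 mu by measurable
    have "?I s \<le> (\<integral>\<^sup>+x. ?f0 x + (?fu x + ?fv x) \<partial>lebesgue)"
    proof (rule nn_integral_mono)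
      fix x :: 'a
      show "ennreal (max 0 (u x s - v x s) * ?\<xi> x) \<le> ?f0 x + (?fu x + ?fv x)"
      proof (cases "x \<in> ?K")
        case False then show ?thesis using supp by simp
      next
        case True
        have b: "0 \<le> ?\<xi> x" "?\<xi> x \<le> 1" using cut_weight_bounds[of \<nu> \<delta> R x] Wt_le_1[OF \<nu>(1), of x] by auto
        have "max 0 (u x s - v x s) * ?\<xi> x \<le> (max 0 (u0 x - v0 x) + (\<bar>u x s - u0 x\<bar> + \<bar>v x s - v0 x\<bar>)) * ?\<xi> x"
          using b by (intro mult_right_mono) auto
        also have "\<dots> \<le> max 0 (u0 x - v0 x) * ?\<xi> x + (\<bar>u x s - u0 x\<bar> + \<bar>v x s - v0 x\<bar>) * 1"
          unfolding distrib_right using b by (intro add_left_mono add_mono mult_left_mono) auto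
        finally have "ennreal (max 0 (u x s - v x s) * ?\<xi> x) \<le> ennreal (max 0 (u0 x - v0 x) * ?\<xi> x + (\<bar>u x s - u0 x\<bar> + \<bar>v x s - v0 x\<bar>))"
          by (intro ennreal_leI) simp
        then show ?thesis using True b by (simp flip: ennreal_plus)
      qed
    qed
    also have "\<dots> = (\<integral>\<^sup>+x. ?f0 x \<partial>lebesgue) + (?N u u0 s + ?N v v0 s)"
      unfolding L1_norm_weighted_def using m0 mfu mfv by (simp add: nn_integral_add)
    also have "(\<integral>\<^sup>+x. ?f0 x \<partial>lebesgue) \<le> ?J"
    proof (rule nn_integral_mono)
      fix x :: 'a
      show "?f0 x \<le> ennreal (max 0 (u0 x - v0 x) * Wt \<nu> x) * indicator (-{0}) x"
        using supp[of x] K(2) cut_weight_bounds[of \<nu> \<delta> R x]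
        by (cases "x = 0") (auto intro!: ennreal_leI mult_left_mono)
    qed
    finally show ?thesis by (simp add: add_right_mono)
  qed
  have lim: "((\<lambda>s. ?J + (?N u u0 s + ?N v v0 s) + ennreal e) \<longlongrightarrow> ?J + (0 + 0) + ennreal e) (at_right 0)"
    using u0 v0 K unfolding initial_trace_def by (intro tendsto_intros) auto
  have "\<forall>\<^sub>F s in at_right 0. s \<in> {0<..<t}" using t by (simp add: eventually_at_right_less eventually_conj_iff eventually_at_right[of 0 1]) (auto simp: eventually_at_right[of 0 1] intro!: exI[of _ t])
  then have "\<forall>\<^sub>F s in at_right 0. ?I t \<le> ?J + (?N u u0 s + ?N v v0 s) + ennreal e"
  proof (rule eventually_mono)
    fix s assume "s \<in> {0<..<t}"
    then show "?I t \<le> ?J + (?N u u0 s + ?N v v0 s) + ennreal e"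
      using order_trans[OF 1[of s] add_right_mono[OF 2[of s]]] by simp
  qed
  from tendsto_lowerbound[OF lim this] show ?thesis by simp
qed

text \<open>The conditions a < n - 2 and \<kappa> > n - 2 - 2 \<nu> say exactly that the powers of
  \<delta> and R in the error of \<open>contraction_cut\<close> vanish as \<delta> tends to 0 and R
  to infinity. Fatou's lemma then removes the cutoffs.\<close>

lemma contraction:
  fixes u v :: "'a::euclidean_space \<Rightarrow> real \<Rightarrow> real"
  assumes m: "m > 0" and u: "fde_sol m u" and v: "fde_sol m v"
    and u0: "initial_trace u u0" and v0: "initial_trace v v0" and t: "t > 0"
    and adm: "admissible m a \<kappa> \<theta> t u"
    and a: "0 \<le> a" "a < real DIM('a) - 2" "0 \<le> \<kappa>" "real DIM('a) - 2 - 2 * \<nu> < \<kappa>" and \<theta>: "\<theta> < 1"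
    and \<nu>: "0 \<le> \<nu>" "2 * (\<nu> + 1) \<le> real DIM('a)"
  shows "(\<integral>\<^sup>+x\<in>-{0}. ennreal (max 0 (u x t - v x t) * Wt \<nu> x) \<partial>lebesgue)
     \<le> (\<integral>\<^sup>+x\<in>-{0}. ennreal (max 0 (u0 x - v0 x) * Wt \<nu> x) \<partial>lebesgue)"
proof -
  let ?n = "real DIM('a)"
  obtain C where C: "C \<ge> 0" "\<And>x s. x \<noteq> 0 \<Longrightarrow> 0 < s \<Longrightarrow> s \<le> t \<Longrightarrow> u x s powr m \<le> C * norm x powr (- a)"
      "\<And>x s. x \<noteq> 0 \<Longrightarrow> 0 < s \<Longrightarrow> s \<le> t \<Longrightarrow> u x s powr m \<le> C * s powr (- \<theta>) * norm x powr (- \<kappa>)"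
    using adm unfolding admissible_def by blast
  define L where "L = (18 * ?n + 576 + 72 * \<nu>) * (C / m) * (measure lborel (cball (0::'a) 1) * 2 ^ DIM('a))"
  have L: "L \<ge> 0" using \<nu> m C by (auto simp: L_def)
  \<comment> \<open>The shift by 2 gives \<delta> \<le> 1 and R \<ge> 2, hence 2 \<delta>^2 < R^2
    already for the first index.\<close>
  define \<delta> where "\<delta> j = inverse (real (j + 2))" for j :: nat
  define R where "R j = real (j + 2)" for j :: nat
  have \<delta>R: "0 < \<delta> j" "0 < R j" "2 * (\<delta> j)\<^sup>2 < (R j)\<^sup>2" for j
  proof -
    show "0 < \<delta> j" "0 < R j" by (auto simp: \<delta>_def R_def)
    have "(\<delta> j)\<^sup>2 \<le> 1" by (intro power_le_one) (auto simp: \<delta>_def field_simps)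
    moreover have "(2::real)\<^sup>2 \<le> (R j)\<^sup>2" by (intro power_mono) (auto simp: R_def)
    ultimately show "2 * (\<delta> j)\<^sup>2 < (R j)\<^sup>2" by simp
  qed
  define er where "er j = L * (\<delta> j powr (?n - 2 - a) * t + R j powr (?n - 2 - \<kappa> - 2 * \<nu>) * (t powr (1 - \<theta>) / (1 - \<theta>)))" for j
  have er0: "er j \<ge> 0" for j unfolding er_def using L t \<theta> by (intro mult_nonneg_nonneg add_nonneg_nonneg) auto
  have Rlim: "filterlim R at_top sequentially"
    unfolding R_def by (rule filterlim_compose[OF filterlim_real_sequentially]) (rule filterlim_add_const_nat_at_top)
  have "(\<lambda>j. \<delta> j powr (?n - 2 - a)) \<longlonglongrightarrow> 0"
  proof -
    have "((\<lambda>r. r powr (- (?n - 2 - a))) \<longlongrightarrow> 0) at_top" using a by (intro tendsto_neg_powr filterlim_ident) auto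
    from filterlim_compose[OF this Rlim] have "(\<lambda>j. R j powr (- (?n - 2 - a))) \<longlonglongrightarrow> 0" .
    moreover have "\<delta> j powr (?n - 2 - a) = R j powr (- (?n - 2 - a))" for j
      unfolding \<delta>_def R_def powr_minus by (simp add: inverse_powr)
    ultimately show ?thesis by (simp only:)
  qed
  moreover have "(\<lambda>j. R j powr (?n - 2 - \<kappa> - 2 * \<nu>)) \<longlonglongrightarrow> 0"
    using a Rlim by (intro tendsto_neg_powr) auto
  ultimately have "er \<longlonglongrightarrow> L * (0 * t + 0 * (t powr (1 - \<theta>) / (1 - \<theta>)))"
    unfolding er_def by (intro tendsto_intros)
  then have erl: "(\<lambda>j. ennreal (er j)) \<longlonglongrightarrow> 0" using tendsto_ennrealI[of er 0] by simp
  let ?J = "\<integral>\<^sup>+x\<in>-{0}. ennreal (max 0 (u0 x - v0 x) * Wt \<nu> x) \<partial>lebesgue"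
  let ?F = "\<lambda>j x. ennreal (max 0 (u x t - v x t) * cut_weight \<nu> (\<delta> j) (R j) x)"
  have 1: "(\<integral>\<^sup>+x. ?F j x \<partial>lebesgue) \<le> ?J + ennreal (er j)" for j
  proof (rule contraction_cut_initial[OF m u v u0 v0 t \<nu> \<delta>R _ er0])
    fix s assume s: "0 < s" "s \<le> t"
    show "(\<integral>x. max 0 (u x t - v x t) * cut_weight \<nu> (\<delta> j) (R j) x \<partial>lborel)
      \<le> (\<integral>x. max 0 (u x s - v x s) * cut_weight \<nu> (\<delta> j) (R j) x \<partial>lborel) + er j"
      unfolding er_def L_def
      by (intro contraction_cut[where T=t and t=t and m=m and u=u and v=v]) (use s m u v C a \<theta> \<nu> \<delta>R in auto)
  qed
  have meas: "?F j \<in> borel_measurable lebesgue" for j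
  proof -
    have "integrable lborel (\<lambda>x. max 0 (u x t - v x t) * cut_weight \<nu> (\<delta> j) (R j) x)"
      using Ck_on_2_continuous(1)[OF fde_solD(2)[OF u t]] Ck_on_2_continuous(1)[OF fde_solD(2)[OF v t]]
      by (intro cut_weight_integrable[OF \<nu> \<delta>R] continuous_on_diff)
    then have "(\<lambda>x. max 0 (u x t - v x t) * cut_weight \<nu> (\<delta> j) (R j) x) \<in> borel_measurable lebesgue"
      by (intro measurable_completion) (rule borel_measurable_integrable)
    then show ?thesis by measurable
  qed
  have "(\<integral>\<^sup>+x\<in>-{0}. ennreal (max 0 (u x t - v x t) * Wt \<nu> x) \<partial>lebesgue) \<le> (\<integral>\<^sup>+x. liminf (\<lambda>j. ?F j x) \<partial>lebesgue)"
  proof (rule nn_integral_mono)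
    fix x :: 'a
    show "ennreal (max 0 (u x t - v x t) * Wt \<nu> x) * indicator (-{0}) x \<le> liminf (\<lambda>j. ?F j x)"
    proof (cases "x = 0")
      case False
      obtain j0 where j0: "real j0 \<ge> norm x" "real j0 \<ge> 2 / norm x"
        using real_arch_simple[of "max (norm x) (2 / norm x)"] by auto
      have "?F j x = ennreal (max 0 (u x t - v x t) * Wt \<nu> x)" if "j \<ge> j0" for j
      proof -
        have "norm x \<le> R j" "2 / norm x \<le> R j" using j0 that by (auto simp: R_def)
        then have n: "norm x \<le> R j" "2 * \<delta> j \<le> norm x" using False by (auto simp: R_def \<delta>_def field_simps)
        have "(norm x)\<^sup>2 \<le> (R j)\<^sup>2" using n by (intro power_mono) auto
        moreover have "(2 * \<delta> j)\<^sup>2 \<le> (norm x)\<^sup>2" using n \<delta>R(1)[of j] by (intro power_mono) auto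
        then have "2 * (\<delta> j)\<^sup>2 \<le> (norm x)\<^sup>2" by (simp add: power_mult_distrib) (smt (verit) zero_le_power2)
        ultimately show ?thesis using cut_weight_eq[OF \<delta>R(1,2), of j x j] by simp
      qed
      then have "(\<lambda>j. ?F j x) \<longlonglongrightarrow> ennreal (max 0 (u x t - v x t) * Wt \<nu> x)"
        by (intro tendsto_eventually) (auto simp: eventually_sequentially)
      then have "liminf (\<lambda>j. ?F j x) = ennreal (max 0 (u x t - v x t) * Wt \<nu> x)"
        by (rule lim_imp_Liminf[OF sequentially_bot])
      then show ?thesis using False by simp
    qed simp
  qed
  also have "\<dots> \<le> liminf (\<lambda>j. \<integral>\<^sup>+x. ?F j x \<partial>lebesgue)" by (rule nn_integral_liminf[OF meas])
  also have "\<dots> \<le> liminf (\<lambda>j. ?J + ennreal (er j))" using 1 by (intro Liminf_mono) auto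
  also have "\<dots> = ?J"
  proof -
    have "(\<lambda>j. ?J + ennreal (er j)) \<longlonglongrightarrow> ?J + 0" by (intro tendsto_intros erl)
    then show ?thesis using lim_imp_Liminf[OF sequentially_bot] by fastforce
  qed
  finally show ?thesis .
qed

section \<open>Rescaling and self-similar solutions\<close>

lemma lebesgue_scaled:
  assumes "k > 0"
  shows "(lebesgue :: 'a::euclidean_space measure) = density (distr lebesgue lebesgue (\<lambda>x. k *\<^sub>R x)) (\<lambda>_. ennreal (k ^ DIM('a)))"
proof (rule measure_eqI)
  fix S :: "'a set" assume S: "S \<in> sets lebesgue"
  have pre: "(\<lambda>x. k *\<^sub>R x) -` S = (\<lambda>x. inverse k *\<^sub>R x) ` S"
    using assms by (auto simp: image_iff intro!: bexI[of _ "k *\<^sub>R _"])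
  have "emeasure (density (distr lebesgue lebesgue (\<lambda>x. k *\<^sub>R x)) (\<lambda>_. ennreal (k ^ DIM('a)))) S
     = ennreal (k ^ DIM('a)) * emeasure lebesgue ((\<lambda>x. inverse k *\<^sub>R x) ` S)"
    using S by (simp add: emeasure_density_const emeasure_distr pre)
  also have "\<dots> = emeasure lebesgue S"
    using assms emeasure_lebesgue_affine[of "inverse k" 0 S]
    by (simp add: power_inverse mult.assoc[symmetric] ennreal_mult[symmetric])
  finally show "emeasure lebesgue S = emeasure (density (distr lebesgue lebesgue (\<lambda>x. k *\<^sub>R x)) (\<lambda>_. ennreal (k ^ DIM('a)))) S" ..
qed simp

lemma nn_integral_scaled:
  fixes f :: "'a::euclidean_space \<Rightarrow> ennreal"
  assumes "k > 0" "f \<in> borel_measurable lebesgue"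
  shows "(\<integral>\<^sup>+x. f x \<partial>lebesgue) = ennreal (k ^ DIM('a)) * (\<integral>\<^sup>+x. f (k *\<^sub>R x) \<partial>lebesgue)"
  using assms by (subst lebesgue_scaled[OF assms(1)]) (simp add: nn_integral_density nn_integral_distr nn_integral_cmult)

lemma pd_scale: 
  assumes "f differentiable (at x)" shows "pd (c *\<^sub>R h) f x = c * pd h f x"
  using linear_scale[OF has_derivative_linear[OF pd_has_derivative[OF assms]]] by simp

lemma inner_grad:
  fixes x :: "'a::euclidean_space"
  assumes "f differentiable (at y)" shows "pd x f y = x \<bullet> grad f y"
proof -
  have lin: "linear (\<lambda>h. pd h f y)" by (rule has_derivative_linear[OF pd_has_derivative[OF assms]])
  have "pd x f y = pd (\<Sum>i\<in>Basis. (x \<bullet> i) *\<^sub>R i) f y" by (simp add: euclidean_representation)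
  also have "\<dots> = (\<Sum>i\<in>Basis. (x \<bullet> i) * pd i f y)"
    using linear_sum[OF lin, of "\<lambda>i. (x \<bullet> i) *\<^sub>R i" Basis] linear_scale[OF lin] by simp
  also have "\<dots> = x \<bullet> grad f y" by (simp add: grad_def inner_sum_right mult.commute)
  finally show ?thesis .
qed

text \<open>Common form of all rescalings below: amplitude \<open>c t\<close>, spatial scale \<open>k t\<close>, profile \<open>g\<close> at time \<open>l t\<close>.\<close>

lemma C21_on_scaled:
  fixes g :: "'a::euclidean_space \<Rightarrow> real \<Rightarrow> real"
  assumes k: "continuous_on {0<..} k" "\<And>t. t > 0 \<Longrightarrow> k t > 0"
    and c: "continuous_on {0<..} c" and l: "continuous_on {0<..} l" "\<And>t. t > 0 \<Longrightarrow> l t > 0"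
    and g: "\<And>t. t > 0 \<Longrightarrow> Ck_on 2 (- {0}) (\<lambda>y. g y t)"
    and g0: "continuous_on ((- {0}) \<times> {0<..}) (\<lambda>(x, t). g x t)"
    and g1: "\<And>i. i \<in> Basis \<Longrightarrow> continuous_on ((- {0}) \<times> {0<..}) (\<lambda>(x, t). pd i (\<lambda>y. g y t) x)"
    and g2: "\<And>i j. i \<in> Basis \<Longrightarrow> j \<in> Basis \<Longrightarrow> continuous_on ((- {0}) \<times> {0<..}) (\<lambda>(x, t). pd j (pd i (\<lambda>y. g y t)) x)"
    and d: "\<And>x t. x \<noteq> 0 \<Longrightarrow> t > 0 \<Longrightarrow> ((\<lambda>s. c s * g (k s *\<^sub>R x) (l s)) has_real_derivative D x t) (at t)"
    and D: "continuous_on ((- {0}) \<times> {0<..}) (\<lambda>(x, t). D x t)"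
  shows "C21_on ((- {0}) \<times> {0<..}) (\<lambda>x t. c t * g (k t *\<^sub>R x) (l t))"
proof -
  let ?Q = "(- {0::'a}) \<times> {0::real<..}"
  have pre: "(\<lambda>x. k t *\<^sub>R x) -` (- {0}) = (- {0::'a})" if "t > 0" for t using k(2)[OF that] by auto
  have C: "Ck_on 2 (- {0}) (\<lambda>x. c t * g (k t *\<^sub>R x) (l t))" if "t > 0" for t
    using Ck_on_2_scaled(1)[OF _ g[OF l(2)[OF that]] refl, of "k t" "c t"] pre[OF that] by auto
  have p1: "pd i (\<lambda>x. c t * g (k t *\<^sub>R x) (l t)) x = c t * k t * pd i (\<lambda>y. g y (l t)) (k t *\<^sub>R x)"
    if "x \<noteq> 0" "t > 0" for x i t
    using g[OF l(2)[OF that(2)]] k(2)[OF that(2)] that(1) by (intro pd_scaled(2)) (auto simp: Ck_on_2)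
  have p2: "pd j (pd i (\<lambda>x. c t * g (k t *\<^sub>R x) (l t))) x = c t * k t * k t * pd j (pd i (\<lambda>y. g y (l t))) (k t *\<^sub>R x)"
    if "x \<noteq> 0" "t > 0" "i \<in> Basis" for x i j t
  proof -
    have "pd j (pd i (\<lambda>x. c t * g (k t *\<^sub>R x) (l t))) x = pd j (\<lambda>x. c t * k t * pd i (\<lambda>y. g y (l t)) (k t *\<^sub>R x)) x"
      by (rule pd_cong[of "- {0}"]) (use that p1 in auto)
    also have "\<dots> = c t * k t * k t * pd j (pd i (\<lambda>y. g y (l t))) (k t *\<^sub>R x)"
      using g[OF l(2)[OF that(2)]] k(2)[OF that(2)] that by (intro pd_scaled(2)) (auto simp: Ck_on_2)
    finally show ?thesis .
  qed
  have s: "continuous_on ?Q (\<lambda>z. r (snd z))" if "continuous_on {0<..} r" for r :: "real \<Rightarrow> real"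
    by (rule continuous_on_compose2[OF that]) (auto intro!: continuous_intros)
  have comp: "continuous_on ?Q (\<lambda>z. r (k (snd z) *\<^sub>R fst z) (l (snd z)))"
    if "continuous_on ?Q (\<lambda>(x, t). r x t)" for r :: "'a \<Rightarrow> real \<Rightarrow> real"
  proof -
    have "continuous_on ?Q (\<lambda>z. (k (snd z) *\<^sub>R fst z, l (snd z)))"
      by (intro continuous_intros s k l)
    moreover have "(\<lambda>z. (k (snd z) *\<^sub>R fst z, l (snd z))) ` ?Q \<subseteq> ?Q" using k(2) l(2) by fastforce
    ultimately show ?thesis using continuous_on_compose2[OF that] by fastforce
  qed
  show ?thesis unfolding C21_on_def
  proof (intro conjI ballI)
    fix z assume z: "z \<in> ?Q"
    then show "case z of (x, t) \<Rightarrow> (\<lambda>t. c t * g (k t *\<^sub>R x) (l t)) differentiable at t \<and>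
        (\<lambda>y. c t * g (k t *\<^sub>R y) (l t)) differentiable at x \<and> (\<forall>i\<in>Basis. pd i (\<lambda>y. c t * g (k t *\<^sub>R y) (l t)) differentiable at x)"
      using d C by (auto simp: Ck_on_2 real_differentiable_def)
  next
    show "continuous_on ?Q (\<lambda>(x, t). c t * g (k t *\<^sub>R x) (l t))"
      unfolding split_beta by (intro continuous_intros s c comp g0)
    show "continuous_on ?Q (\<lambda>(x, t). deriv (\<lambda>t. c t * g (k t *\<^sub>R x) (l t)) t)"
      by (rule continuous_on_eq[OF D]) (use d in \<open>auto intro!: DERIV_imp_deriv[symmetric]\<close>)
    fix i :: 'a assume i: "i \<in> Basis"
    have "continuous_on ?Q (\<lambda>z. c (snd z) * k (snd z) * pd i (\<lambda>y. g y (l (snd z))) (k (snd z) *\<^sub>R fst z))"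
      by (intro continuous_intros s c k comp[OF g1[OF i]])
    then show "continuous_on ?Q (\<lambda>(x, t). pd i (\<lambda>y. c t * g (k t *\<^sub>R y) (l t)) x)"
      by (rule continuous_on_eq) (auto intro!: p1[symmetric])
    fix j :: 'a assume j: "j \<in> Basis"
    have "continuous_on ?Q (\<lambda>z. c (snd z) * k (snd z) * k (snd z) * pd j (pd i (\<lambda>y. g y (l (snd z)))) (k (snd z) *\<^sub>R fst z))"
      by (intro continuous_intros s c k comp[OF g2[OF i j]])
    then show "continuous_on ?Q (\<lambda>(x, t). pd j (pd i (\<lambda>y. c t * g (k t *\<^sub>R y) (l t))) x)"
      by (rule continuous_on_eq) (auto intro!: p2[symmetric] i)
  qed
qed

lemma laplacian_power_scaled:
  fixes h :: "'a::euclidean_space \<Rightarrow> real"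
  assumes h: "Ck_on 2 (- {0}) (\<lambda>y. h y powr m / m)" and hp: "\<And>y. y \<noteq> 0 \<Longrightarrow> h y > 0"
    and "c > 0" "k > 0" "x \<noteq> 0"
  shows "laplacian (\<lambda>y. (c * h (k *\<^sub>R y)) powr m / m) x = c powr m * k\<^sup>2 * laplacian (\<lambda>y. h y powr m / m) (k *\<^sub>R x)"
proof -
  have "laplacian (\<lambda>y. (c * h (k *\<^sub>R y)) powr m / m) x = laplacian (\<lambda>y. c powr m * (h (k *\<^sub>R y) powr m / m)) x"
    by (rule laplacian_cong[of "- {0}"]) (use assms in \<open>auto simp: powr_mult less_imp_le\<close>)
  also have "\<dots> = c powr m * k\<^sup>2 * laplacian (\<lambda>y. h y powr m / m) (k *\<^sub>R x)"
    using Ck_on_2_scaled(2)[OF _ h refl, of k x "c powr m"] assms by auto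
  finally show ?thesis .
qed

text \<open>The relation \<open>c * l = c powr m * k\<^sup>2\<close> balances the factor produced by
  the time derivative against the one produced by the Laplacian of the power. It covers the
  self-similar rescaling as well as the rescaling of time alone.\<close>

lemma fde_sol_scaled:
  fixes u :: "'a::euclidean_space \<Rightarrow> real \<Rightarrow> real"
  assumes m: "m > 0" and u: "fde_sol m u" and p: "c > 0" "k > 0" "l > 0" and e: "c * l = c powr m * k\<^sup>2"
  shows "fde_sol m (\<lambda>x t. c * u (k *\<^sub>R x) (l * t))"
proof -
  note U = fde_solD[OF u]
  note u' = u[unfolded fde_sol_def C21_on_def]
  let ?L = "\<lambda>x t. laplacian (\<lambda>y. u y t powr m / m) x"
  have d: "((\<lambda>s. c * u (k *\<^sub>R x) (l * s)) has_real_derivative c * (?L (k *\<^sub>R x) (l * t) * l)) (at t)"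
    if "x \<noteq> 0" "t > 0" for x t
    using U(3)[of "k *\<^sub>R x" "l * t"] that p
    by (intro DERIV_cmult DERIV_chain2[of "u (k *\<^sub>R x)"]) (auto intro!: derivative_eq_intros)
  have D: "continuous_on ((- {0}) \<times> {0<..}) (\<lambda>(x, t). c * (?L (k *\<^sub>R x) (l * t) * l))"
  proof -
    have "continuous_on ((- {0}) \<times> {0<..}) (\<lambda>z. (k *\<^sub>R fst z, l * snd z) :: 'a \<times> real)"
      "(\<lambda>z. (k *\<^sub>R fst z, l * snd z)) ` ((- {0}) \<times> {0<..}) \<subseteq> (- {0::'a}) \<times> {0<..}"
      using p by (auto intro!: continuous_intros)
    from continuous_on_compose2[OF U(5) this] show ?thesis
      unfolding split_beta by (auto intro!: continuous_intros)
  qed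
  have "C21_on ((- {0}) \<times> {0<..}) (\<lambda>x t. c * u (k *\<^sub>R x) (l * t))"
    by (rule C21_on_scaled[where c="\<lambda>_. c" and k="\<lambda>_. k" and l="\<lambda>t. l * t", OF _ _ _ _ _ U(2,4) _ _ d D])
       (use p u' in \<open>auto intro!: continuous_intros\<close>)
  moreover have "c * (?L (k *\<^sub>R x) (l * t) * l) = laplacian (\<lambda>y. (c * u (k *\<^sub>R y) (l * t)) powr m / m) x"
    if "x \<noteq> 0" "t > 0" for x t
    using laplacian_power_scaled[OF fde_sol_power[OF u _ m] U(1) p(1,2) that(1), of "l * t"] p that e
    by (simp add: mult_ac)
  ultimately show ?thesis unfolding fde_sol_def using U(1) p d by (auto simp: DERIV_imp_deriv)
qed

text \<open>By the chain rule and the profile equation the time derivative is t^(-\<alpha> - 1)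
  times the Laplacian of f^m / m at the rescaled point. The Laplacian of V^m / m carries the power
  t^(-\<alpha> m - 2 \<beta>), and the two exponents agree because \<alpha> (1 - m) = 2 \<beta> -
  1.\<close>

lemma fde_sol_self_similar:
  fixes f :: "'a::euclidean_space \<Rightarrow> real"
  assumes f: "self_similar_profile m \<alpha> \<beta> lam f" and m: "m > 0" and \<alpha>: "\<alpha> * (1 - m) = 2 * \<beta> - 1"
  shows "fde_sol m (self_similar \<alpha> \<beta> f)"
proof -
  have fp: "x \<noteq> 0 \<Longrightarrow> f x > 0" and f2: "Ck_on 2 (- {0}) f"
    and eq: "x \<noteq> 0 \<Longrightarrow> laplacian (\<lambda>y. f y powr m / m) x + \<alpha> * f x + \<beta> * (x \<bullet> grad f x) = 0" for x
    using f unfolding self_similar_profile_def by blast+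
  have fd: "x \<noteq> 0 \<Longrightarrow> f differentiable (at x)" for x using f2 by (auto simp: Ck_on_2)
  have fm: "Ck_on 2 (- {0}) (\<lambda>y. f y powr m / m)"
    using f2 fp m by (intro Ck_on_2_power) auto
  have pw: "continuous_on {0<..} (\<lambda>t::real. t powr r)" for r by (intro continuous_intros) auto
  let ?D = "\<lambda>x t. t powr (- \<alpha> - 1) * laplacian (\<lambda>y. f y powr m / m) (t powr (- \<beta>) *\<^sub>R x)"
  have d: "((\<lambda>s. s powr (- \<alpha>) * f (s powr (- \<beta>) *\<^sub>R x)) has_real_derivative ?D x t) (at t)"
    if x: "x \<noteq> 0" and t: "t > 0" for x t
  proof -
    let ?y = "t powr (- \<beta>) *\<^sub>R x"
    have y: "?y \<noteq> 0" using x t by simp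
    have "((\<lambda>s. s powr (- \<beta>) *\<^sub>R x) has_derivative (\<lambda>h. (- \<beta> * t powr (- \<beta> - 1) * h) *\<^sub>R x)) (at t)"
      by (rule has_derivative_scaleR_left[OF has_real_derivative_powr[OF t, of "- \<beta>", unfolded has_field_derivative_def]])
    from has_derivative_compose[OF this pd_has_derivative[OF fd[OF y]]]
    have "((\<lambda>s. f (s powr (- \<beta>) *\<^sub>R x)) has_real_derivative (- \<beta> * t powr (- \<beta> - 1)) * pd x f ?y) (at t)"
      unfolding pd_scale[OF fd[OF y]] has_field_derivative_def
      by (rule has_derivative_eq_rhs) (simp add: fun_eq_iff mult_ac)
    from DERIV_mult[OF has_real_derivative_powr[OF t, of "- \<alpha>"] this]
    have *: "((\<lambda>s. s powr (- \<alpha>) * f (s powr (- \<beta>) *\<^sub>R x)) has_real_derivative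
        - \<alpha> * t powr (- \<alpha> - 1) * f ?y + - \<beta> * t powr (- \<beta> - 1) * pd x f ?y * t powr (- \<alpha>)) (at t)" .
    have "?y \<bullet> grad f ?y = t powr (- \<beta>) * pd x f ?y" using inner_grad[OF fd[OF y], of x] by simp
    then have L: "laplacian (\<lambda>y. f y powr m / m) ?y = - \<alpha> * f ?y - \<beta> * (t powr (- \<beta>) * pd x f ?y)"
      using eq[OF y] t by simp
    have e: "t powr (- \<beta> - 1) * t powr (- \<alpha>) = t powr (- \<alpha> - 1) * t powr (- \<beta>)"
      by (simp add: powr_add[symmetric] algebra_simps)
    have "?D x t = - \<alpha> * t powr (- \<alpha> - 1) * f ?y - \<beta> * pd x f ?y * (t powr (- \<alpha> - 1) * t powr (- \<beta>))"
      unfolding L by (simp add: right_diff_distrib)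
    then have "?D x t = - \<alpha> * t powr (- \<alpha> - 1) * f ?y + - \<beta> * t powr (- \<beta> - 1) * pd x f ?y * t powr (- \<alpha>)"
      unfolding e[symmetric] by simp
    with * show ?thesis by simp
  qed
  have D: "continuous_on ((- {0}) \<times> {0<..}) (\<lambda>(x, t). ?D x t)"
  proof -
    have c: "continuous_on ((- {0::'a}) \<times> {0<..}) (\<lambda>z. snd z powr r)" for r :: real
      by (intro continuous_intros) auto
    have "continuous_on ((- {0::'a}) \<times> {0<..}) (\<lambda>z. snd z powr (- \<beta>) *\<^sub>R fst z)" by (intro continuous_intros) auto
    moreover have "(\<lambda>z. snd z powr (- \<beta>) *\<^sub>R fst z) ` ((- {0::'a}) \<times> {0<..}) \<subseteq> - {0}" by auto
    ultimately have "continuous_on ((- {0}) \<times> {0<..}) (\<lambda>z. laplacian (\<lambda>y. f y powr m / m) (snd z powr (- \<beta>) *\<^sub>R fst z))"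
      by (rule continuous_on_compose2[OF Ck_on_2_laplacian[OF fm]])
    then show ?thesis unfolding split_beta by (intro continuous_intros c)
  qed
  have slice: "continuous_on ((- {0::'a}) \<times> {0::real<..}) (\<lambda>(x, t). r x)" if "continuous_on (- {0}) r" for r :: "'a \<Rightarrow> real"
    unfolding split_beta by (rule continuous_on_compose2[OF that]) (auto intro!: continuous_intros)
  have "C21_on ((- {0}) \<times> {0<..}) (\<lambda>x t. t powr (- \<alpha>) * f (t powr (- \<beta>) *\<^sub>R x))"
  proof (rule C21_on_scaled[where g="\<lambda>x t. f x" and c="\<lambda>t. t powr (- \<alpha>)" and k="\<lambda>t. t powr (- \<beta>)" and l="\<lambda>t. t", OF pw _ pw _ _ f2 _ _ _ d D])
    show "continuous_on ((- {0}) \<times> {0::real<..}) (\<lambda>(x, t). f x)"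
      by (rule slice[OF Ck_on_2_continuous(1)[OF f2]])
    show "continuous_on ((- {0}) \<times> {0::real<..}) (\<lambda>(x, t). pd i f x)" if "i \<in> Basis" for i
      by (rule slice[OF Ck_on_2_continuous(2)[OF f2 that]])
    show "continuous_on ((- {0}) \<times> {0::real<..}) (\<lambda>(x, t). pd j (pd i f) x)" if "i \<in> Basis" "j \<in> Basis" for i j
      by (rule slice) (use f2 that in \<open>auto simp: Ck_on_2\<close>)
  qed (auto intro!: continuous_intros)
  moreover have "?D x t = laplacian (\<lambda>y. (t powr (- \<alpha>) * f (t powr (- \<beta>) *\<^sub>R y)) powr m / m) x" if "x \<noteq> 0" "t > 0" for x t
  proof -
    have e: "- (\<alpha> * m) - 2 * \<beta> = - \<alpha> - 1" using \<alpha> by (simp add: algebra_simps)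
    have "(t powr (- \<alpha>)) powr m * (t powr (- \<beta>))\<^sup>2 = t powr (- \<alpha> - 1)"
      unfolding e[symmetric] using that by (simp add: powr_powr power2_eq_square flip: powr_add)
    then show ?thesis
      using laplacian_power_scaled[OF fm fp, of "t powr (- \<alpha>)" "t powr (- \<beta>)" x] that by simp
  qed
  ultimately show ?thesis
    unfolding fde_sol_def self_similar_def[abs_def] using fp d by (auto simp: DERIV_imp_deriv)
qed

section \<open>Initial data of rescaled and self-similar solutions\<close>

lemma integrable_lebesgue_scaled:
  fixes F :: "'a::euclidean_space \<Rightarrow> real"
  assumes "k > 0" "integrable lebesgue F"
  shows "integrable lebesgue (\<lambda>x. F (k *\<^sub>R x))"
proof -
  have m: "F \<in> borel_measurable lebesgue" using assms(2) by (rule borel_measurable_integrable)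
  have "(\<integral>\<^sup>+x. ennreal (norm (F x)) \<partial>lebesgue) = ennreal (k ^ DIM('a)) * (\<integral>\<^sup>+x. ennreal (norm (F (k *\<^sub>R x))) \<partial>lebesgue)"
    by (rule nn_integral_scaled[OF assms(1)]) (use m in measurable)
  moreover have "(\<integral>\<^sup>+x. ennreal (norm (F x)) \<partial>lebesgue) < \<infinity>" using assms(2) by (simp add: integrable_iff_bounded)
  ultimately have "(\<integral>\<^sup>+x. ennreal (norm (F (k *\<^sub>R x))) \<partial>lebesgue) < \<infinity>"
    using assms(1) by (auto simp: ennreal_mult_less_top)
  moreover have "(\<lambda>x. F (k *\<^sub>R x)) \<in> borel_measurable lebesgue"
    by (rule measurable_compose[OF lebesgue_measurable_scaling m])
  ultimately show ?thesis by (simp add: integrable_iff_bounded)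
qed

lemma indicator_scaled:
  assumes "k > 0"
  shows "indicator ((\<lambda>x. k *\<^sub>R x) ` K) (k *\<^sub>R x) = (indicator K (x::'a::real_vector) :: 'b::zero_neq_one)"
  using assms by (auto simp: indicator_def)

lemma scaled_compact:
  fixes K :: "'a::euclidean_space set"
  assumes "k > 0" "compact K" "K \<subseteq> - {0}"
  shows "compact ((\<lambda>x. k *\<^sub>R x) ` K)" "(\<lambda>x. k *\<^sub>R x) ` K \<subseteq> - {0}"
  using assms by (auto intro: compact_scaling)

lemma L1_loc_scaled:
  fixes u0 :: "'a::euclidean_space \<Rightarrow> real"
  assumes u0: "L1_loc u0" and k: "k > 0"
  shows "L1_loc (\<lambda>x. c * u0 (k *\<^sub>R x))"
  unfolding L1_loc_def
proof (intro allI impI, elim conjE)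
  fix K :: "'a set" assume K: "compact K" "K \<subseteq> - {0}"
  have "integrable lebesgue (\<lambda>x. indicator ((\<lambda>x. k *\<^sub>R x) ` K) x *\<^sub>R u0 x)"
    using u0 scaled_compact[OF k K] by (auto simp: L1_loc_def set_integrable_def)
  from integrable_lebesgue_scaled[OF k this]
  have "set_integrable lebesgue K (\<lambda>x. u0 (k *\<^sub>R x))" by (simp add: set_integrable_def indicator_scaled[OF k])
  then show "(\<lambda>x. c * u0 (k *\<^sub>R x)) absolutely_integrable_on K" by (rule set_integrable_mult_right) 
qed

lemma initial_trace_scaled:
  fixes u :: "'a::euclidean_space \<Rightarrow> real \<Rightarrow> real"
  assumes u: "fde_sol m u" "initial_trace u u0" and p: "c > 0" "k > 0" "l > 0"
  shows "initial_trace (\<lambda>x t. c * u (k *\<^sub>R x) (l * t)) (\<lambda>x. c * u0 (k *\<^sub>R x))"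
  unfolding initial_trace_def
proof (intro conjI allI impI, goal_cases)
  case 1
  then show ?case using u p by (intro L1_loc_scaled) (auto simp: initial_trace_def)
next
  case (2 K)
  let ?K = "(\<lambda>x. k *\<^sub>R x) ` K"
  note K' = scaled_compact[OF p(2), of K]
  have K: "compact ?K" "?K \<subseteq> - {0}" using K' 2 by auto
  have e: "L1_norm_weighted (\<lambda>_. 1) K (\<lambda>x. c * u (k *\<^sub>R x) (l * t) - c * u0 (k *\<^sub>R x))
     = ennreal (c / k ^ DIM('a)) * L1_norm_weighted (\<lambda>_. 1) ?K (\<lambda>x. u x (l * t) - u0 x)" if t: "t > 0" for t
  proof -
    have lt: "l * t > 0" using t p by simp
    let ?F = "\<lambda>x. ennreal (\<bar>u x (l * t) - u0 x\<bar> * 1) * indicator ?K x"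
    have F: "?F = (\<lambda>x. ennreal \<bar>indicator ?K x * u x (l * t) - indicator ?K x * u0 x\<bar>)"
      by (auto simp: indicator_def)
    have "(\<lambda>x. indicator ?K x * u x (l * t)) \<in> borel_measurable lebesgue"
      using Ck_on_2_continuous(1)[OF fde_solD(2)[OF u(1) lt]] K
      by (intro continuous_indicator_measurable continuous_on_subset[OF _ K(2)]) auto
    moreover have "(\<lambda>x. indicator ?K x * u0 x) \<in> borel_measurable lebesgue"
      using u(2) by (intro L1_loc_measurable[OF _ K]) (auto simp: initial_trace_def)
    ultimately have mF: "?F \<in> borel_measurable lebesgue" unfolding F by measurable
    have "(\<integral>\<^sup>+x. ?F x \<partial>lebesgue) = ennreal (k ^ DIM('a)) * (\<integral>\<^sup>+x. ?F (k *\<^sub>R x) \<partial>lebesgue)"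
      by (rule nn_integral_scaled[OF p(2) mF])
    moreover have "L1_norm_weighted (\<lambda>_. 1) K (\<lambda>x. c * u (k *\<^sub>R x) (l * t) - c * u0 (k *\<^sub>R x))
       = (\<integral>\<^sup>+x. ennreal c * ?F (k *\<^sub>R x) \<partial>lebesgue)"
      unfolding L1_norm_weighted_def indicator_scaled[OF p(2)] using p(1)
      by (intro nn_integral_cong) (simp add: right_diff_distrib[symmetric] abs_mult ennreal_mult mult.assoc)
    moreover have "(\<integral>\<^sup>+x. ennreal c * ?F (k *\<^sub>R x) \<partial>lebesgue) = ennreal c * (\<integral>\<^sup>+x. ?F (k *\<^sub>R x) \<partial>lebesgue)"
      by (rule nn_integral_cmult) (rule measurable_compose[OF lebesgue_measurable_scaling mF])
    moreover have "ennreal (c / k ^ DIM('a)) * (ennreal (k ^ DIM('a)) * z) = ennreal c * z" for z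
      using p by (simp add: mult.assoc[symmetric] ennreal_mult[symmetric])
    ultimately show ?thesis unfolding L1_norm_weighted_def by simp
  qed
  have "((\<lambda>t. L1_norm_weighted (\<lambda>_. 1) ?K (\<lambda>x. u x t - u0 x)) \<longlongrightarrow> 0) (at_right 0)"
    using u(2) K by (simp add: initial_trace_def)
  moreover have "filterlim (\<lambda>t. l * t) (at_right 0) (at_right 0)"
  proof -
    have "((\<lambda>t. l * t) \<longlongrightarrow> l * 0) (at_right 0)" by (intro tendsto_intros)
    then show ?thesis using p(3) by (simp add: filterlim_at eventually_at_right_less) (auto simp: eventually_at_filter)
  qed
  ultimately have "((\<lambda>t. L1_norm_weighted (\<lambda>_. 1) ?K (\<lambda>x. u x (l * t) - u0 x)) \<longlongrightarrow> 0) (at_right 0)"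
    by (rule filterlim_compose)
  then have "((\<lambda>t. ennreal (c / k ^ DIM('a)) * L1_norm_weighted (\<lambda>_. 1) ?K (\<lambda>x. u x (l * t) - u0 x)) \<longlongrightarrow> ennreal (c / k ^ DIM('a)) * 0) (at_right 0)"
    by (intro ennreal_tendsto_cmult) auto
  then have "((\<lambda>t. ennreal (c / k ^ DIM('a)) * L1_norm_weighted (\<lambda>_. 1) ?K (\<lambda>x. u x (l * t) - u0 x)) \<longlongrightarrow> 0) (at_right 0)"
    by simp
  then show ?case
    by (rule Lim_transform_eventually) (auto simp: eventually_at_filter e intro!: always_eventually)
qed

lemma L1_loc_continuous:
  fixes g :: "'a::euclidean_space \<Rightarrow> real"
  assumes "continuous_on (- {0}) g"
  shows "L1_loc g"
  unfolding L1_loc_def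
proof (intro allI impI, elim conjE)
  fix K :: "'a set" assume K: "compact K" "K \<subseteq> - {0}"
  have i: "integrable lborel (\<lambda>x. indicator K x *\<^sub>R g x)"
    by (rule borel_integrable_compact[OF K(1) continuous_on_subset[OF assms K(2)]])
  then show "g absolutely_integrable_on K" 
    unfolding set_integrable_def using integrable_completion[OF borel_measurable_integrable[OF i]] i by simp
qed

lemma tendsto_0_ennrealI:
  fixes F :: "_ \<Rightarrow> ennreal"
  assumes "\<And>\<epsilon>. \<epsilon> > 0 \<Longrightarrow> \<forall>\<^sub>F x in G. F x < ennreal \<epsilon>"
  shows "(F \<longlongrightarrow> 0) G"
proof (rule order_tendstoI)
  fix a :: ennreal assume "0 < a"
  then obtain b where b: "0 < b" "b < a" using dense by blast
  then have "b < top" using less_le_trans[OF b(2) top_greatest] by simp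
  then have "b = ennreal (enn2real b)" "enn2real b > 0" using b by (auto simp: enn2real_positive_iff)
  then have "\<forall>\<^sub>F x in G. F x < b" using assms by metis
  then show "\<forall>\<^sub>F x in G. F x < a" using b by (auto elim: eventually_mono)
qed simp

lemma tendsto_powr_zero_at_right:
  assumes "r > (0::real)" shows "((\<lambda>t. t powr r) \<longlongrightarrow> 0) (at_right 0)"
proof -
  have "((\<lambda>t. t powr r) \<longlongrightarrow> 0 powr r) (at_right 0)"
    using assms by (intro tendsto_powr' tendsto_intros) (auto simp: eventually_at_filter)
  then show ?thesis by simp
qed

text \<open>As \<beta> < 0, the argument t^(-\<beta>) x tends to 0 with t, uniformly on compact
  sets. The initial data are therefore read off from the limit of |x|^\<gamma> f at the origin, and
  the convergence on \<open>K\<close> is even uniform.\<close>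

lemma initial_trace_self_similar:
  fixes f :: "'a::euclidean_space \<Rightarrow> real"
  assumes lim: "((\<lambda>x. norm x powr \<gamma> * f x) \<longlongrightarrow> A) (at 0)" and \<beta>: "\<beta> < 0" and \<alpha>: "\<alpha> = \<gamma> * \<beta>" and \<gamma>: "\<gamma> \<ge> 0"
  shows "initial_trace (self_similar \<alpha> \<beta> f) (\<lambda>x. A * norm x powr (- \<gamma>))"
  unfolding initial_trace_def
proof (intro conjI allI impI, goal_cases)
  case 1
  show ?case by (intro L1_loc_continuous continuous_intros) auto
next
  case (2 K)
  then have K: "compact K" "K \<subseteq> - {0}" by auto
  obtain M where M: "M > 0" "\<And>x. x \<in> K \<Longrightarrow> norm x \<le> M"
    using compact_imp_bounded[OF K(1)] by (auto simp: bounded_pos)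
  obtain B where B: "B > 0" "\<And>x. x \<in> K \<Longrightarrow> norm x powr (- \<gamma>) \<le> B"
  proof -
    have "compact ((\<lambda>x. norm x powr (- \<gamma>)) ` K)" using K by (intro compact_continuous_image continuous_intros) auto
    then have "bounded ((\<lambda>x. norm x powr (- \<gamma>)) ` K)" by (rule compact_imp_bounded)
    then obtain B where "B > 0" "\<forall>x\<in>K. norm (norm x powr (- \<gamma>)) \<le> B"
      unfolding bounded_pos by blast
    then show ?thesis using that[of B] by auto
  qed
  define c where "c = measure lborel K"
  have mK: "emeasure lebesgue K = ennreal c"
    using K emeasure_compact_finite[of K] unfolding c_def
    by (simp add: emeasure_eq_ennreal_measure borel_compact less_top)
  show ?case
  proof (rule tendsto_0_ennrealI)
    fix \<epsilon> :: real assume \<epsilon>: "\<epsilon> > 0"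
    \<comment> \<open>The denominator contains c + 1 because \<open>K\<close> may be a null set; the
      total error is then at most half of \<epsilon>.\<close>
    define e where "e = \<epsilon> / (2 * (B * (c + 1)))"
    have c0: "c \<ge> 0" by (simp add: c_def)
    have e: "e > 0" using \<epsilon> B c0 by (simp add: e_def)
    have "\<forall>\<^sub>F y in at 0. dist (norm y powr \<gamma> * f y) A < e" using lim e by (simp add: tendsto_iff)
    then obtain \<rho> where \<rho>: "\<rho> > 0" "\<And>y. y \<noteq> 0 \<Longrightarrow> norm y < \<rho> \<Longrightarrow> \<bar>norm y powr \<gamma> * f y - A\<bar> < e"
      by (auto simp: eventually_at dist_norm)
    have "((\<lambda>t. M * t powr (- \<beta>)) \<longlongrightarrow> M * 0) (at_right 0)"
      using \<beta> by (intro tendsto_mult_left tendsto_powr_zero_at_right) simp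
    then have "\<forall>\<^sub>F t in at_right 0. M * t powr (- \<beta>) < \<rho>" using \<rho> by (intro order_tendstoD(2)) auto
    then show "\<forall>\<^sub>F t in at_right 0. L1_norm_weighted (\<lambda>_. 1) K (\<lambda>x. self_similar \<alpha> \<beta> f x t - A * norm x powr (- \<gamma>)) < ennreal \<epsilon>"
      using eventually_at_right_less[of 0]
    proof eventually_elim
      case (elim t)
      have pt: "\<bar>self_similar \<alpha> \<beta> f x t - A * norm x powr (- \<gamma>)\<bar> \<le> B * e" if x: "x \<in> K" for x
      proof -
        have x0: "x \<noteq> 0" using x K by auto
        let ?y = "t powr (- \<beta>) *\<^sub>R x"
        have y: "?y \<noteq> 0" "norm ?y < \<rho>" using x0 elim M(2)[OF x]
          by (auto simp: mult.commute) (smt (verit) mult_right_mono powr_ge_zero)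
        have "norm ?y powr \<gamma> = t powr (- \<alpha>) * norm x powr \<gamma>"
          using elim(2) by (simp add: powr_mult powr_powr \<alpha> mult.commute)
        then have "self_similar \<alpha> \<beta> f x t - A * norm x powr (- \<gamma>) = norm x powr (- \<gamma>) * (norm ?y powr \<gamma> * f ?y - A)"
          using x0 by (simp add: self_similar_def powr_minus field_simps)
        then have "\<bar>self_similar \<alpha> \<beta> f x t - A * norm x powr (- \<gamma>)\<bar> = norm x powr (- \<gamma>) * \<bar>norm ?y powr \<gamma> * f ?y - A\<bar>"
          by (simp add: abs_mult)
        also have "\<dots> \<le> B * e" using B(2)[OF x] \<rho>(2)[OF y] B(1) by (intro mult_mono) auto
        finally show ?thesis .
      qed
      have "L1_norm_weighted (\<lambda>_. 1) K (\<lambda>x. self_similar \<alpha> \<beta> f x t - A * norm x powr (- \<gamma>))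
         \<le> (\<integral>\<^sup>+x. ennreal (B * e) * indicator K x \<partial>lebesgue)"
        unfolding L1_norm_weighted_def using pt
        by (intro nn_integral_mono) (auto simp: indicator_def intro!: ennreal_leI)
      also have "\<dots> = ennreal (B * e) * ennreal c" using K mK by (subst nn_integral_cmult_indicator) (auto simp: borel_compact)
      also have "\<dots> = ennreal (B * e * c)" using c0 B e by (simp add: ennreal_mult)
      also have "\<dots> < ennreal \<epsilon>"
      proof (rule ennreal_lessI[OF \<epsilon>])
        have "B * e * c = \<epsilon> / 2 * (c / (c + 1))" using B(1) by (simp add: e_def)
        also have "\<dots> \<le> \<epsilon> / 2 * 1" using \<epsilon> c0 by (intro mult_left_mono) auto
        finally show "B * e * c < \<epsilon>" using \<epsilon> by simp
      qed
      finally show ?case .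
    qed
  qed
qed

section \<open>The profile equation along a ray\<close>

lemma log_line_deriv:
  fixes h :: "'a::euclidean_space \<Rightarrow> real"
  assumes "h differentiable (at (exp s *\<^sub>R e))"
  shows "((\<lambda>s. h (exp s *\<^sub>R e)) has_real_derivative exp s * pd e h (exp s *\<^sub>R e)) (at s)"
proof -
  have "((\<lambda>r. h (0 + r *\<^sub>R e)) has_real_derivative pd e h (0 + exp s *\<^sub>R e)) (at (exp s))"
    by (rule pd_has_real_derivative_line) (use assms in simp)
  from DERIV_chain2[OF this DERIV_exp] show ?thesis by (simp add: mult.commute)
qed

text \<open>Symmetry recovers h from its values on one ray: h is a function of q = |x|^2 through s =
  ln q / 2, and the radial formula in q becomes h'' + (n - 2) h' in s. The functions
  \<open>h1\<close> and \<open>h2\<close> are the first two derivatives in s.\<close>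

lemma radial_laplacian_log:
  fixes h :: "'a::euclidean_space \<Rightarrow> real"
  assumes h: "Ck_on 2 (- {0}) h" and rad: "\<And>x y. x \<noteq> 0 \<Longrightarrow> norm x = norm y \<Longrightarrow> h x = h y" and e: "e \<in> Basis"
  defines "h1 \<equiv> \<lambda>s. exp s * pd e h (exp s *\<^sub>R e)"
  defines "h2 \<equiv> \<lambda>s. exp s * pd e h (exp s *\<^sub>R e) + exp s * (exp s * pd e (pd e h) (exp s *\<^sub>R e))"
  shows "(h1 has_real_derivative h2 s) (at s)"
    "exp (2 * s) * laplacian h (exp s *\<^sub>R e) = h2 s + (real DIM('a) - 2) * h1 s"
proof -
  have ne: "exp s *\<^sub>R e \<noteq> 0" for s using e nonzero_Basis by auto
  have hd: "h differentiable (at (exp s *\<^sub>R e))" "pd e h differentiable (at (exp s *\<^sub>R e))" for s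
    using h ne[of s] e by (auto simp: Ck_on_2)
  have d0: "((\<lambda>s. h (exp s *\<^sub>R e)) has_real_derivative h1 s) (at s)" for s
    unfolding h1_def by (rule log_line_deriv[OF hd(1)])
  show d1: "(h1 has_real_derivative h2 s) (at s)" for s
    unfolding h1_def h2_def using DERIV_mult[OF DERIV_exp log_line_deriv[OF hd(2)[of s]]]
    by (simp add: mult.commute)
  define G where "G q = h (exp (ln q / 2) *\<^sub>R e)" for q
  define G1 where "G1 q = h1 (ln q / 2) / (2 * q)" for q
  define G2 where "G2 q = h2 (ln q / 2) / (4 * q * q) - h1 (ln q / 2) / (2 * q * q)" for q
  have lq: "((\<lambda>q. ln q / 2) has_real_derivative 1 / (2 * q)) (at q)" if "q > 0" for q :: real
    using that by (auto intro!: derivative_eq_intros)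
  have DG: "(G has_real_derivative G1 q) (at q)" if "q > 0" for q
    using DERIV_chain2[OF d0 lq[OF that]] by (simp add: G_def[abs_def] G1_def)
  have DG1: "(G1 has_real_derivative G2 q) (at q)" if "q > 0" for q
  proof -
    have "((\<lambda>q. 2 * q) has_real_derivative 2) (at q)" by (auto intro!: derivative_eq_intros)
    from DERIV_divide[OF DERIV_chain2[OF d1 lq[OF that]] this] that
    have "(G1 has_real_derivative (h2 (ln q / 2) * (1 / (2 * q)) * (2 * q) - h1 (ln q / 2) * 2) / (2 * q * (2 * q))) (at q)"
      by (simp add: G1_def[abs_def])
    moreover have "(h2 (ln q / 2) * (1 / (2 * q)) * (2 * q) - h1 (ln q / 2) * 2) / (2 * q * (2 * q)) = G2 q"
      using that by (simp add: G2_def field_simps)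
    ultimately show ?thesis by simp
  qed
  have cpd: "continuous_on T (\<lambda>s. r (exp s *\<^sub>R e))" if "continuous_on (- {0}) r" for r :: "'a \<Rightarrow> real" and T :: "real set"
    using ne by (intro continuous_on_compose2[OF that] continuous_intros) auto
  have ch2: "continuous_on UNIV h2" "continuous_on UNIV h1" unfolding h2_def h1_def
    using Ck_on_2_continuous(2)[OF h e] h e
    by (intro continuous_intros cpd; auto simp: Ck_on_2)+
  have cG2: "continuous_on ((\<lambda>x::'a. (norm (x - 0))\<^sup>2) ` (- {0})) G2"
    unfolding G2_def by (intro continuous_intros continuous_on_compose2[OF ch2(1)] continuous_on_compose2[OF ch2(2)]) auto
  have "laplacian (\<lambda>x::'a. G ((norm (x - 0))\<^sup>2)) x
       = 2 * real DIM('a) * G1 ((norm (x - 0))\<^sup>2) + 4 * (norm (x - 0))\<^sup>2 * G2 ((norm (x - 0))\<^sup>2)" if "x \<noteq> 0" for x :: 'a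
    by (rule Ck_on_2_radial(3)[OF _ DG DG1 cG2]) (use that in auto)
  moreover have "laplacian h x = laplacian (\<lambda>x::'a. G ((norm (x - 0))\<^sup>2)) x" if "x \<noteq> 0" for x
  proof (rule laplacian_cong[of "- {0}"])
    fix y :: 'a assume "y \<in> - {0}"
    then have y: "y \<noteq> 0" by simp
    have "ln ((norm y)\<^sup>2) / 2 = ln (norm y)" using y by (simp add: ln_realpow)
    then have "norm y = norm (exp (ln ((norm y)\<^sup>2) / 2) *\<^sub>R e)" using y e by simp
    from rad[OF y this] show "h y = G ((norm (y - 0))\<^sup>2)" by (simp add: G_def)
  qed (use that in auto)
  ultimately have L: "laplacian h (exp s *\<^sub>R e) = 2 * real DIM('a) * G1 ((exp s)\<^sup>2) + 4 * (exp s)\<^sup>2 * G2 ((exp s)\<^sup>2)"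
    using ne[of s] e by simp
  have q: "ln ((exp s)\<^sup>2) / 2 = s" "exp (2 * s) = (exp s)\<^sup>2" by (simp_all add: ln_realpow exp_double)
  show "exp (2 * s) * laplacian h (exp s *\<^sub>R e) = h2 s + (real DIM('a) - 2) * h1 s"
    unfolding L G1_def G2_def q by (simp add: field_simps)
qed

section \<open>Bounds for profiles and self-similar solutions\<close>

locale profile =
  fixes m \<alpha> \<beta> \<gamma> lam :: real and f :: "'a::euclidean_space \<Rightarrow> real"
  assumes n3: "DIM('a) \<ge> 3" and m: "0 < m" "m < 1" and \<beta>: "\<beta> < 0"
    and \<alpha>: "\<alpha> * (1 - m) = 2 * \<beta> - 1" "\<alpha> = \<gamma> * \<beta>"
    and \<gamma>: "real DIM('a) \<le> \<gamma>" "m * \<gamma> < real DIM('a) - 2"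
    and f: "self_similar_profile m \<alpha> \<beta> lam f"
begin

lemma f_pos: "x \<noteq> 0 \<Longrightarrow> f x > 0" and f_C2: "Ck_on 2 (- {0}) f"
  and f_radial: "x \<noteq> 0 \<Longrightarrow> norm x = norm y \<Longrightarrow> f x = f y"
  and f_eq: "x \<noteq> 0 \<Longrightarrow> laplacian (\<lambda>y. f y powr m / m) x + \<alpha> * f x + \<beta> * (x \<bullet> grad f x) = 0"
  and f_lim: "((\<lambda>x. norm x powr \<gamma> * f x) \<longlongrightarrow> lam powr (1 / ((1 - m) * \<beta>))) (at 0)"
proof -
  have "\<alpha> / \<beta> = \<gamma>" using \<alpha>(2) \<beta> by simp
  moreover have "((\<lambda>x. norm x powr (\<alpha> / \<beta>) * f x) \<longlongrightarrow> lam powr (1 / ((1 - m) * \<beta>))) (at 0)"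
    using f unfolding self_similar_profile_def by blast
  ultimately show "((\<lambda>x. norm x powr \<gamma> * f x) \<longlongrightarrow> lam powr (1 / ((1 - m) * \<beta>))) (at 0)" by simp
qed (use f in \<open>unfold self_similar_profile_def, blast+\<close>)

text \<open>On the ray through e the profile equation is multiplied by |x|^2 = e^(2 s). A basis
  vector is taken as direction because \<open>Ck_on\<close> provides second derivatives along
  these.\<close>

lemma log_profile_instance:
  assumes e: "e \<in> Basis"
  shows "log_profile m \<gamma> (- \<beta>) (real DIM('a)) (\<lambda>s. f (exp s *\<^sub>R e)) (\<lambda>s. exp s * pd e f (exp s *\<^sub>R e))
    (\<lambda>s. let h = \<lambda>y. f y powr m / m in exp s * pd e h (exp s *\<^sub>R e) + exp s * (exp s * pd e (pd e h) (exp s *\<^sub>R e)))"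
proof
  let ?h = "\<lambda>y. f y powr m / m"
  have ne: "exp s *\<^sub>R e \<noteq> 0" for s using e nonzero_Basis by auto
  have h: "Ck_on 2 (- {0}) ?h" "\<And>x i. x \<noteq> 0 \<Longrightarrow> pd i ?h x = f x powr (m - 1) * pd i f x"
    using Ck_on_2_power[of "- {0}" f m] f_C2 f_pos m by auto
  have hr: "?h x = ?h y" if "x \<noteq> 0" "norm x = norm y" for x y using f_radial[OF that] by simp
  note R = radial_laplacian_log[OF h(1) hr e]
  have fd: "f differentiable (at (exp s *\<^sub>R e))" for s using f_C2 ne[of s] by (auto simp: Ck_on_2)
  show "0 < f (exp s *\<^sub>R e)" for s by (rule f_pos[OF ne])
  show "((\<lambda>s. f (exp s *\<^sub>R e)) has_real_derivative exp s * pd e f (exp s *\<^sub>R e)) (at s)" for s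
    by (rule log_line_deriv[OF fd])
  have eq1: "f (exp s *\<^sub>R e) powr (m - 1) * (exp s * pd e f (exp s *\<^sub>R e)) = exp s * pd e ?h (exp s *\<^sub>R e)" for s
    using h(2)[OF ne] by simp
  show "((\<lambda>s. f (exp s *\<^sub>R e) powr (m - 1) * (exp s * pd e f (exp s *\<^sub>R e))) has_real_derivative
     (let h = ?h in exp s * pd e h (exp s *\<^sub>R e) + exp s * (exp s * pd e (pd e h) (exp s *\<^sub>R e)))) (at s)" for s
    unfolding eq1 Let_def by (rule R(1))
  show "(let h = ?h in exp s * pd e h (exp s *\<^sub>R e) + exp s * (exp s * pd e (pd e h) (exp s *\<^sub>R e)))
     + (real DIM('a) - 2) * (f (exp s *\<^sub>R e) powr (m - 1) * (exp s * pd e f (exp s *\<^sub>R e)))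
     = - \<beta> * exp (2 * s) * (\<gamma> * f (exp s *\<^sub>R e) + exp s * pd e f (exp s *\<^sub>R e))" for s
  proof -
    have "(exp s *\<^sub>R e) \<bullet> grad f (exp s *\<^sub>R e) = exp s * pd e f (exp s *\<^sub>R e)"
      using inner_grad[OF fd[of s], of e] by simp
    then have "laplacian ?h (exp s *\<^sub>R e) = - \<beta> * (\<gamma> * f (exp s *\<^sub>R e) + exp s * pd e f (exp s *\<^sub>R e))"
      using f_eq[OF ne, of s] \<alpha>(2) by (simp add: algebra_simps)
    then show ?thesis unfolding eq1 Let_def using R(2)[of s] by (simp add: mult_ac)
  qed
qed (use m n3 \<gamma> \<beta> in auto)

text \<open>Near the origin the limit of |x|^\<gamma> f provides the bound, and monotonicity along
  rays carries it outward.\<close>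

lemma f_bound: obtains C where "C > 0" "\<And>x. x \<noteq> 0 \<Longrightarrow> f x \<le> C * norm x powr (- \<gamma>)"
proof -
  obtain e :: 'a where e: "e \<in> Basis" using nonempty_Basis by blast
  interpret L: log_profile m \<gamma> "- \<beta>" "real DIM('a)" "\<lambda>s. f (exp s *\<^sub>R e)" "\<lambda>s. exp s * pd e f (exp s *\<^sub>R e)"
    "\<lambda>s. let h = \<lambda>y. f y powr m / m in exp s * pd e h (exp s *\<^sub>R e) + exp s * (exp s * pd e (pd e h) (exp s *\<^sub>R e))"
    by (rule log_profile_instance[OF e])
  have fe: "f x = f (exp (ln (norm x)) *\<^sub>R e)" if "x \<noteq> 0" for x
    by (rule f_radial[OF that]) (use that e in simp)
  have ex: "exp (\<gamma> * ln (norm x)) = norm x powr \<gamma>" if "x \<noteq> 0" for x :: 'a using that by (simp add: powr_def)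
  let ?A = "lam powr (1 / ((1 - m) * \<beta>))"
  have "\<forall>\<^sub>F y in at 0. norm y powr \<gamma> * f y < ?A + 1" using f_lim by (rule order_tendstoD(2)) simp
  then obtain \<rho> where \<rho>: "\<rho> > 0" "\<And>y. y \<noteq> 0 \<Longrightarrow> norm y < \<rho> \<Longrightarrow> norm y powr \<gamma> * f y < ?A + 1"
    by (auto simp: eventually_at)
  have "norm x powr \<gamma> * f x \<le> ?A + 1" if x: "x \<noteq> 0" for x
  proof (cases "norm x < \<rho>")
    case True then show ?thesis using \<rho>(2)[OF x] by simp
  next
    case False
    let ?y = "(\<rho> / 2) *\<^sub>R e"
    have y: "?y \<noteq> 0" "norm ?y < \<rho>" "norm ?y \<le> norm x" using \<rho>(1) e False nonzero_Basis by auto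
    have "ln (norm ?y) \<le> ln (norm x)" using y x by (intro ln_mono) auto
    from L.profile_antimono[OF this] have "norm x powr \<gamma> * f x \<le> norm ?y powr \<gamma> * f ?y"
      unfolding fe[OF x, symmetric] fe[OF y(1), symmetric] ex[OF x] ex[OF y(1)] .
    then show ?thesis using \<rho>(2)[OF y(1,2)] by simp
  qed
  then have "f x \<le> (?A + 1) * norm x powr (- \<gamma>)" if "x \<noteq> 0" for x
    using that by (simp add: powr_minus field_simps)
  then show ?thesis using that[of "?A + 1"] by (simp add: add_nonneg_pos)
qed

text \<open>Two consequences matter: \<gamma> (1 - m) > 2, which starts the decay estimate, and the
  value 1, which is the threshold for integrability of the time singularity.\<close>

lemma beta_gamma: "- \<beta> * (\<gamma> * (1 - m) - 2) = 1"
  using \<alpha> by (simp add: algebra_simps)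

text \<open>The last clause, which needs \<open>\<gamma> \<ge> n\<close>, makes the time singularity of the self-similar solution at infinity
  integrable.\<close>

lemma f_decay:
  assumes \<epsilon>: "\<epsilon> > 0"
  obtains C k where "C > 0" "\<And>x. x \<noteq> 0 \<Longrightarrow> f x \<le> C * norm x powr (- k)" "\<gamma> \<le> k" "real DIM('a) - 2 - \<epsilon> \<le> m * k"
    "m * (- \<beta>) * (k - \<gamma>) < 1"
proof -
  obtain e :: 'a where e: "e \<in> Basis" using nonempty_Basis by blast
  interpret L: log_profile m \<gamma> "- \<beta>" "real DIM('a)" "\<lambda>s. f (exp s *\<^sub>R e)" "\<lambda>s. exp s * pd e f (exp s *\<^sub>R e)"
    "\<lambda>s. let h = \<lambda>y. f y powr m / m in exp s * pd e h (exp s *\<^sub>R e) + exp s * (exp s * pd e (pd e h) (exp s *\<^sub>R e))"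
    by (rule log_profile_instance[OF e])
  obtain C0 where C0: "C0 > 0" "\<And>x. x \<noteq> 0 \<Longrightarrow> f x \<le> C0 * norm x powr (- \<gamma>)" by (rule f_bound) blast
  define k where "k = (real DIM('a) - 2 - \<epsilon>) / m"
  have mk: "m * k = real DIM('a) - 2 - \<epsilon>" using m by (simp add: k_def)
  show ?thesis
  \<comment> \<open>If this rate does not improve on \<gamma>, the bound with \<gamma> itself serves
    and the time exponent is 0.\<close>
  proof (cases "k \<le> \<gamma>")
    case True
    then have "m * k \<le> m * \<gamma>" using m by simp
    then show ?thesis using that[of C0 \<gamma>] C0 mk by simp
  next
    case False
    have "2 < \<gamma> * (1 - m)"
      using beta_gamma \<beta> by (smt (verit) mult_minus_left mult_nonneg_nonpos zero_le_mult_iff)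
    from L.p_decay[OF \<epsilon> this] obtain C s0 where C: "C > 0" "\<And>s. s \<ge> s0 \<Longrightarrow> L.p s \<le> C * exp (- (real DIM('a) - 2 - \<epsilon>) * s)" by metis
    define C1 where "C1 = (m * C) powr (1 / m)"
    have C1: "f x \<le> C1 * norm x powr (- k)" if x: "x \<noteq> 0" "ln (norm x) \<ge> s0" for x
    proof -
      have fe: "f x = f (exp (ln (norm x)) *\<^sub>R e)" by (rule f_radial[OF x(1)]) (use x e in simp)
      have "f x powr m / m \<le> C * exp (- (m * k) * ln (norm x))" using C(2)[OF x(2)] fe unfolding L.p_def mk by simp
      then have "f x powr m \<le> (m * C) * norm x powr (- (m * k))" using m x by (simp add: powr_def field_simps)
      then have "(f x powr m) powr (1 / m) \<le> ((m * C) * norm x powr (- (m * k))) powr (1 / m)"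
        using m by (intro powr_mono2) auto
      then show ?thesis using m f_pos[OF x(1)] C by (simp add: powr_powr powr_mult C1_def)
    qed
    \<comment> \<open>Inside the radius e^s0 the bound with rate \<gamma> is converted into one with
      the larger rate k.\<close>
    define C2 where "C2 = C0 * exp s0 powr (k - \<gamma>)"
    have C2: "f x \<le> C2 * norm x powr (- k)" if x: "x \<noteq> 0" "ln (norm x) < s0" for x
    proof -
      have "norm x < exp s0" using x by (metis exp_less_cancel_iff exp_ln zero_less_norm_iff)
      then have "norm x powr (k - \<gamma>) \<le> exp s0 powr (k - \<gamma>)" using False by (intro powr_mono2) auto
      then have "C0 * (norm x powr (k - \<gamma>) * norm x powr (- k)) \<le> C0 * (exp s0 powr (k - \<gamma>) * norm x powr (- k))"
        using C0(1) by (intro mult_left_mono mult_right_mono) auto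
      then show ?thesis using C0(2)[OF x(1)] by (simp add: C2_def powr_add[symmetric] mult.assoc)
    qed
    \<comment> \<open>By \<open>beta_gamma\<close> the middle term is 1. The first term is
      nonpositive because \<gamma> \<ge> n and \<beta> < 0, and the last is negative.\<close>
    have "m * (- \<beta>) * (k - \<gamma>) = - \<beta> * (real DIM('a) - \<gamma>) + - \<beta> * (\<gamma> * (1 - m) - 2) + \<beta> * \<epsilon>"
      unfolding right_diff_distrib[of "m * - \<beta>"] using arg_cong[OF mk, of "\<lambda>z. \<beta> * z"] by (simp add: algebra_simps)
    also have "\<dots> < 1" unfolding beta_gamma using \<beta> \<gamma> \<epsilon> 
      by (smt (verit) mult_minus_left mult_nonneg_nonpos mult_neg_pos)
    finally have mb: "m * (- \<beta>) * (k - \<gamma>) < 1" .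
    have "f x \<le> (max C1 C2) * norm x powr (- k)" if "x \<noteq> 0" for x
      using C1[OF that] C2[OF that] mult_right_mono[of C1 "max C1 C2" "norm x powr (- k)"]
        mult_right_mono[of C2 "max C1 C2" "norm x powr (- k)"]
      by (cases "ln (norm x) \<ge> s0") force+
    moreover have "max C1 C2 > 0" using C0 by (simp add: C2_def less_max_iff_disj)
    ultimately show ?thesis using that[of "max C1 C2" k] mb mk False by simp
  qed
qed

lemma V_pos: "x \<noteq> 0 \<Longrightarrow> t > 0 \<Longrightarrow> self_similar \<alpha> \<beta> f x t > 0"
  using f_pos by (simp add: self_similar_def)

lemma V_sol: "fde_sol m (self_similar \<alpha> \<beta> f)"
  by (rule fde_sol_self_similar[OF f m(1) \<alpha>(1)])

lemma V_trace: "initial_trace (self_similar \<alpha> \<beta> f) (\<lambda>x. lam powr (1 / ((1 - m) * \<beta>)) * norm x powr (- \<gamma>))"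
  using \<gamma>(1) by (intro initial_trace_self_similar f_lim \<beta> \<alpha>(2)) linarith

text \<open>Self-similar solutions are the fixed points of the rescaling; this is why the barriers
  remain barriers for every T.\<close>

lemma V_scaling:
  assumes "T > 0" "t > 0"
  shows "T powr \<alpha> * self_similar \<alpha> \<beta> f (T powr \<beta> *\<^sub>R x) (T * t) = self_similar \<alpha> \<beta> f x t"
proof -
  have e: "T powr r * (T * t) powr (- r) = t powr (- r)" for r
    using assms by (simp add: powr_mult powr_minus)
  have "T powr \<alpha> * ((T * t) powr (- \<alpha>) * f ((T * t) powr (- \<beta>) *\<^sub>R T powr \<beta> *\<^sub>R x))
     = (T powr \<alpha> * (T * t) powr (- \<alpha>)) * f ((T powr \<beta> * (T * t) powr (- \<beta>)) *\<^sub>R x)"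
    by (simp only: scaleR_scaleR mult.assoc mult.commute[of "T powr \<beta>"])
  then show ?thesis unfolding self_similar_def e .
qed

text \<open>The exponents depend on the profile only, so one choice serves all solutions below a
  multiple of a time-scaled self-similar solution. Near the origin a = m \<gamma>; at infinity
  \<kappa> = m k and \<theta> = m (-\<beta>) (k - \<gamma>), where k is the rate of
  \<open>f_decay\<close> with \<epsilon> = \<nu>, which leaves a margin \<nu> in the condition on
  \<kappa>.\<close>

lemma admissible_exponents:
  assumes \<nu>: "\<nu> > 0"
  obtains \<kappa> \<theta> where "0 \<le> \<kappa>" "real DIM('a) - 2 - 2 * \<nu> < \<kappa>" "\<theta> < 1"
    "\<And>u c l T. c > 0 \<Longrightarrow> l > 0 \<Longrightarrow> (\<And>x t. x \<noteq> 0 \<Longrightarrow> t > 0 \<Longrightarrow> 0 < u x t \<and> u x t \<le> c * self_similar \<alpha> \<beta> f x (l * t)) \<Longrightarrow>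
       admissible m (m * \<gamma>) \<kappa> \<theta> T u"
proof -
  obtain C0 where C0: "C0 > 0" "\<And>x. x \<noteq> 0 \<Longrightarrow> f x \<le> C0 * norm x powr (- \<gamma>)" by (rule f_bound) blast
  obtain C1 k where C1: "C1 > 0" "\<And>x. x \<noteq> 0 \<Longrightarrow> f x \<le> C1 * norm x powr (- k)" and
    k: "\<gamma> \<le> k" "real DIM('a) - 2 - \<nu> \<le> m * k" "m * (- \<beta>) * (k - \<gamma>) < 1"
    using f_decay[OF \<nu>] by metis
  define \<theta> where "\<theta> = m * (- \<beta>) * (k - \<gamma>)"
  have kg: "0 \<le> m * k" using k m \<gamma> by (smt (verit) mult_nonneg_nonneg of_nat_0_le_iff)
  \<comment> \<open>For j = \<gamma> the time factor is 1; for j = k it is the singularity that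
    becomes t^(-\<theta>) after raising to the power m.\<close>
  have V: "self_similar \<alpha> \<beta> f x t \<le> C * t powr (\<beta> * (j - \<gamma>)) * norm x powr (- j)"
    if "x \<noteq> 0" "t > 0" "\<And>x. x \<noteq> 0 \<Longrightarrow> f x \<le> C * norm x powr (- j)" "C > 0" for x t C j
  proof -
    have "f (t powr (- \<beta>) *\<^sub>R x) \<le> C * norm (t powr (- \<beta>) *\<^sub>R x) powr (- j)" by (rule that(3)) (use that in auto)
    then have "t powr (- \<alpha>) * f (t powr (- \<beta>) *\<^sub>R x) \<le> t powr (- \<alpha>) * (C * norm (t powr (- \<beta>) *\<^sub>R x) powr (- j))"
      by (intro mult_left_mono) auto
    also have "\<dots> = C * (t powr (- \<alpha>) * t powr (\<beta> * j)) * norm x powr (- j)"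
      using that by (simp add: powr_mult powr_powr)
    also have "t powr (- \<alpha>) * t powr (\<beta> * j) = t powr (\<beta> * (j - \<gamma>))"
      using \<alpha>(2) by (simp add: powr_add[symmetric] algebra_simps)
    finally show ?thesis by (simp add: self_similar_def)
  qed
  have adm: "admissible m (m * \<gamma>) (m * k) \<theta> T u" if c: "c > 0" "l > 0" and
    u: "\<And>x t. x \<noteq> 0 \<Longrightarrow> t > 0 \<Longrightarrow> 0 < u x t \<and> u x t \<le> c * self_similar \<alpha> \<beta> f x (l * t)" for u c l T
  proof -
    define D0 where "D0 = (c * C0) powr m"
    define D1 where "D1 = (c * C1 * l powr (\<beta> * (k - \<gamma>))) powr m"
    have "u x t powr m \<le> max D0 D1 * norm x powr (- (m * \<gamma>)) \<and> u x t powr m \<le> max D0 D1 * t powr (- \<theta>) * norm x powr (- (m * k))"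
      if x: "x \<noteq> 0" "0 < t" for x t
    proof
      have lt: "l * t > 0" using c x by simp
      have "u x t \<le> c * (C0 * norm x powr (- \<gamma>))"
      proof -
        have "self_similar \<alpha> \<beta> f x (l * t) \<le> C0 * norm x powr (- \<gamma>)"
          using V[OF x(1) lt C0(2) C0(1)] c x by simp
        then have "c * self_similar \<alpha> \<beta> f x (l * t) \<le> c * (C0 * norm x powr (- \<gamma>))"
          using c by (intro mult_left_mono) auto
        then show ?thesis using u[OF x] by linarith
      qed
      then have "u x t powr m \<le> (c * (C0 * norm x powr (- \<gamma>))) powr m" using u[OF x] m by (intro powr_mono2) auto
      also have "\<dots> = D0 * norm x powr (- (m * \<gamma>))" using c C0 by (simp add: D0_def powr_mult powr_powr mult_ac)
      also have "\<dots> \<le> max D0 D1 * norm x powr (- (m * \<gamma>))" by (intro mult_right_mono) auto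
      finally show "u x t powr m \<le> max D0 D1 * norm x powr (- (m * \<gamma>))" .
      have "u x t \<le> c * (C1 * (l * t) powr (\<beta> * (k - \<gamma>)) * norm x powr (- k))"
        using u[OF x] mult_left_mono[OF V[OF x(1) lt C1(2) C1(1)], of c] c by linarith
      then have "u x t powr m \<le> (c * (C1 * (l * t) powr (\<beta> * (k - \<gamma>)) * norm x powr (- k))) powr m"
        using u[OF x] m by (intro powr_mono2) auto
      also have "\<dots> = D1 * (t powr (\<beta> * (k - \<gamma>))) powr m * norm x powr (- (m * k))"
        using c C1 x by (simp add: D1_def powr_mult powr_powr mult_ac)
      also have "(t powr (\<beta> * (k - \<gamma>))) powr m = t powr (- \<theta>)" using x by (simp add: powr_powr \<theta>_def mult_ac)
      also have "D1 * t powr (- \<theta>) * norm x powr (- (m * k)) \<le> max D0 D1 * t powr (- \<theta>) * norm x powr (- (m * k))"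
        by (intro mult_right_mono) auto
      finally show "u x t powr m \<le> max D0 D1 * t powr (- \<theta>) * norm x powr (- (m * k))" .
    qed
    moreover have "max D0 D1 \<ge> 0" by (simp add: D0_def le_max_iff_disj)
    ultimately show ?thesis unfolding admissible_def by blast
  qed
  have "real DIM('a) - 2 - 2 * \<nu> < m * k" "\<theta> < 1" using k \<nu> by (auto simp: \<theta>_def)
  note * = that[OF kg this]
  show ?thesis
  proof (rule *)
    fix u :: "'a \<Rightarrow> real \<Rightarrow> real" and c l T :: real
    assume "c > 0" "l > 0" "\<And>x t. x \<noteq> 0 \<Longrightarrow> t > 0 \<Longrightarrow> 0 < u x t \<and> u x t \<le> c * self_similar \<alpha> \<beta> f x (l * t)"
    then show "admissible m (m * \<gamma>) (m * k) \<theta> T u" by (rule adm)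
  qed
qed

end

section \<open>Mean values of time averages\<close>

context test_function begin

lemma integral_time_swap:
  fixes g :: "'a \<Rightarrow> real \<Rightarrow> real"
  assumes g: "continuous_on ((- {0}) \<times> {0<..}) (\<lambda>(x, t). g x t)" and ab: "0 < a" "a \<le> b"
  shows "(\<integral>x. integral {a..b} (g x) * \<xi> x \<partial>lborel) = integral {a..b} (\<lambda>t. \<integral>x. g x t * \<xi> x \<partial>lborel)"
    and "continuous_on (- {0}) (\<lambda>x. integral {a..b} (g x))"
proof -
  obtain l h where lh: "K \<subseteq> cbox l h" by (rule box)
  have "continuous_on ((- {0}) \<times> {a..b}) (\<lambda>(x, t). g x t)"
    by (rule continuous_on_subset[OF g]) (use ab in auto)
  from integral_continuous_on_param[of "- {0}" a b g, unfolded cbox_interval, OF this]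
  show cP: "continuous_on (- {0}) (\<lambda>x. integral {a..b} (g x))" .
  have cPx: "continuous_on UNIV (\<lambda>x. integral {a..b} (g x) * \<xi> x)"
    by (rule continuous_on_zero_extension[OF _ K(1,2)])
       (use supp in \<open>auto intro!: continuous_intros cP continuous_on_subset[OF cont]\<close>)
  have e: "(\<integral>x. g x t * \<xi> x \<partial>lborel) = integral (cbox l h) (\<lambda>x. g x t * \<xi> x)" if "t > 0" for t
    by (rule compact_support_integral(1)[OF slice_continuous[OF g that] lh]) (simp add: supp)
  have "(\<integral>x. integral {a..b} (g x) * \<xi> x \<partial>lborel) = integral (cbox l h) (\<lambda>x. integral {a..b} (g x) * \<xi> x)"
    by (rule compact_support_integral(1)[OF cPx lh]) (simp add: supp)
  also have "\<dots> = integral (cbox l h) (\<lambda>x. integral (cbox a b) (\<lambda>t. g x t * \<xi> x))" by simp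
  also have "\<dots> = integral (cbox a b) (\<lambda>t. integral (cbox l h) (\<lambda>x. g x t * \<xi> x))"
  proof (rule integral_swap_continuous)
    show "continuous_on (cbox (l, a) (h, b)) (\<lambda>(x, t). g x t * \<xi> x)"
      by (rule continuous_on_subset[OF product_zero_extension[OF K supp cont g]]) (use ab in \<open>auto simp: cbox_Pair_eq\<close>)
  qed
  also have "\<dots> = integral {a..b} (\<lambda>t. \<integral>x. g x t * \<xi> x \<partial>lborel)"
    unfolding cbox_interval by (rule integral_cong) (use e ab in auto)
  finally show "(\<integral>x. integral {a..b} (g x) * \<xi> x \<partial>lborel) = integral {a..b} (\<lambda>t. \<integral>x. g x t * \<xi> x \<partial>lborel)" .
qed

end

text \<open>The \<open>\<rho>\<close>-derivative of \<open>avg_kernel\<close> is \<open>\<rho>\<close> times the Laplacian of \<open>bump\<close>.\<close>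

definition bump :: "'a::euclidean_space \<Rightarrow> real \<Rightarrow> 'a \<Rightarrow> real" where
  "bump x \<rho> y = \<rho> powr (- real DIM('a)) * (max 0 (1 - (norm (y - x))\<^sup>2 / \<rho>\<^sup>2)) ^ 3"

definition avg_kernel :: "'a::euclidean_space \<Rightarrow> real \<Rightarrow> 'a \<Rightarrow> real" where
  "avg_kernel x \<rho> y = \<rho> powr (- real DIM('a)) * (6 * (max 0 (1 - (norm (y - x))\<^sup>2 / \<rho>\<^sup>2))\<^sup>2)"

lemma outside_ball_sq:
  assumes "\<rho> > 0" "y \<notin> cball x \<rho>" shows "max 0 (1 - (norm (y - x))\<^sup>2 / \<rho>\<^sup>2) = 0"
proof -
  have "\<rho>\<^sup>2 \<le> (norm (y - x))\<^sup>2" using assms by (intro power_mono) (auto simp: dist_norm norm_minus_commute)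
  then show ?thesis using assms by (simp add: max_def pos_divide_le_eq)
qed

lemma kernel_outside:
  assumes "\<rho> > 0" "y \<notin> cball x \<rho>" shows "bump x \<rho> y = 0" "avg_kernel x \<rho> y = 0"
  unfolding bump_def avg_kernel_def outside_ball_sq[OF assms] by simp_all

lemma kernel_bounds:
  fixes x y :: "'a::euclidean_space"
  assumes "\<rho> > 0"
  shows "0 \<le> bump x \<rho> y" "bump x \<rho> y \<le> \<rho> powr (- real DIM('a)) * indicator (cball x \<rho>) y"
    "0 \<le> avg_kernel x \<rho> y" "avg_kernel x \<rho> y \<le> 6 * \<rho> powr (- real DIM('a)) * indicator (cball x \<rho>) y"
    "3 * \<rho> powr (- real DIM('a)) * indicator (cball x (\<rho> / 2)) y \<le> avg_kernel x \<rho> y"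
proof -
  let ?q = "max 0 (1 - (norm (y - x))\<^sup>2 / \<rho>\<^sup>2)"
  have q: "0 \<le> ?q" "?q \<le> 1" by auto
  show "0 \<le> bump x \<rho> y" "0 \<le> avg_kernel x \<rho> y" by (auto simp: bump_def avg_kernel_def)
  show "bump x \<rho> y \<le> \<rho> powr (- real DIM('a)) * indicator (cball x \<rho>) y"
  proof (cases "y \<in> cball x \<rho>")
    case True
    have "?q ^ 3 \<le> 1" using q by (intro power_le_one)
    then show ?thesis unfolding bump_def using True by (simp add: mult_left_le)
  qed (simp add: kernel_outside[OF assms])
  show "avg_kernel x \<rho> y \<le> 6 * \<rho> powr (- real DIM('a)) * indicator (cball x \<rho>) y"
  proof (cases "y \<in> cball x \<rho>")
    case True
    have "?q\<^sup>2 \<le> 1" using q by (intro power_le_one)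
    then have "\<rho> powr (- real DIM('a)) * (6 * ?q\<^sup>2) \<le> \<rho> powr (- real DIM('a)) * (6 * 1)"
      by (intro mult_left_mono) auto
    then show ?thesis unfolding avg_kernel_def using True by (simp add: mult_ac)
  qed (simp add: kernel_outside[OF assms])
  show "3 * \<rho> powr (- real DIM('a)) * indicator (cball x (\<rho> / 2)) y \<le> avg_kernel x \<rho> y"
  proof (cases "y \<in> cball x (\<rho> / 2)")
    case True
    then have "(norm (y - x))\<^sup>2 \<le> (\<rho> / 2)\<^sup>2" by (intro power_mono) (auto simp: dist_norm norm_minus_commute)
    then have "(norm (y - x))\<^sup>2 / \<rho>\<^sup>2 \<le> 1 / 4" using assms by (simp add: field_simps power_divide)
    then have "3 / 4 \<le> 1 - (norm (y - x))\<^sup>2 / \<rho>\<^sup>2" by linarith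
    then have "3 / 4 \<le> ?q" by (rule max.coboundedI2)
    then have "(3 / 4)\<^sup>2 \<le> ?q\<^sup>2" by (rule power_mono) simp
    moreover have "(1 / 2 :: real) \<le> (3 / 4)\<^sup>2" by (simp add: power2_eq_square)
    ultimately have "3 \<le> 6 * ?q\<^sup>2" by linarith
    then have "\<rho> powr (- real DIM('a)) * 3 \<le> \<rho> powr (- real DIM('a)) * (6 * ?q\<^sup>2)" by (intro mult_left_mono) auto
    then show ?thesis unfolding avg_kernel_def using True by (simp add: mult_ac)
  qed (simp add: avg_kernel_def)
qed

text \<open>Write both kernels as \<rho>^(-n) times a profile in q = |y - x|^2 / \<rho>^2. For a
  bump profile g the second claim holds exactly when the other profile is -2 g'; for the cube of 1 -
  q this is 6 (1 - q)^2, the origin of the constant 6.\<close>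

lemma bump_laplacian:
  fixes x :: "'a::euclidean_space"
  assumes "\<rho> > 0"
  shows "Ck_on 2 UNIV (bump x \<rho>)"
    "((\<lambda>\<rho>. avg_kernel x \<rho> y) has_real_derivative \<rho> * laplacian (bump x \<rho>) y) (at \<rho>)"
    "laplacian (bump x \<rho>) y = \<rho> powr (- real DIM('a) - 2) *
       (24 * ((norm (y - x))\<^sup>2 / \<rho>\<^sup>2) * max 0 (1 - (norm (y - x))\<^sup>2 / \<rho>\<^sup>2)
        - 6 * real DIM('a) * (max 0 (1 - (norm (y - x))\<^sup>2 / \<rho>\<^sup>2))\<^sup>2)"
proof -
  let ?n = "real DIM('a)"
  define G where "G q = \<rho> powr (- ?n) * (max 0 (1 - q / \<rho>\<^sup>2)) ^ 3" for q
  define G1 where "G1 q = \<rho> powr (- ?n) * (3 * (max 0 (1 - q / \<rho>\<^sup>2))\<^sup>2 * - (1 / \<rho>\<^sup>2))" for q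
  define G2 where "G2 q = \<rho> powr (- ?n) * (3 * (2 * max 0 (1 - q / \<rho>\<^sup>2) * - (1 / \<rho>\<^sup>2)) * - (1 / \<rho>\<^sup>2))" for q
  have d: "((\<lambda>q. 1 - q / \<rho>\<^sup>2) has_real_derivative - (1 / \<rho>\<^sup>2)) (at q)" for q
    using DERIV_diff[OF DERIV_const[of 1] DERIV_cdivide[OF DERIV_ident, of "\<rho>\<^sup>2"]] by simp
  have DG: "(G has_real_derivative G1 q) (at q)" for q
    unfolding G_def[abs_def] G1_def by (intro DERIV_cmult DERIV_chain2[OF max_cube_deriv(1) d])
  have DG1: "(G1 has_real_derivative G2 q) (at q)" for q
    unfolding G1_def[abs_def] G2_def by (intro DERIV_cmult DERIV_cmult_right DERIV_chain2[OF max_cube_deriv(2) d])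
  have c: "continuous_on T G2" for T unfolding G2_def using assms by (intro continuous_intros) auto
  have e: "bump x \<rho> = (\<lambda>y. G ((norm (y - x))\<^sup>2))" by (simp add: fun_eq_iff bump_def G_def)
  note R = Ck_on_2_radial[where c=x, OF open_UNIV DG DG1 c]
  show "Ck_on 2 UNIV (bump x \<rho>)" unfolding e by (rule R(1))
  have p2: "\<rho> powr (- ?n - 2) = \<rho> powr (- ?n) / \<rho>\<^sup>2" using assms by (simp add: powr_diff)
  have r4: "\<rho>\<^sup>2 / \<rho> ^ 4 = 1 / \<rho>\<^sup>2" using assms by (simp add: divide_simps flip: power_add)
  show L: "laplacian (bump x \<rho>) y = \<rho> powr (- ?n - 2) *
       (24 * ((norm (y - x))\<^sup>2 / \<rho>\<^sup>2) * max 0 (1 - (norm (y - x))\<^sup>2 / \<rho>\<^sup>2)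
        - 6 * ?n * (max 0 (1 - (norm (y - x))\<^sup>2 / \<rho>\<^sup>2))\<^sup>2)"
    unfolding e R(3)[OF UNIV_I] G1_def G2_def p2 using assms r4 by (simp add: field_simps)
  let ?q = "(norm (y - x))\<^sup>2"
  have "((\<lambda>\<rho>. 1 - ?q / \<rho>\<^sup>2) has_real_derivative 2 * ?q / \<rho> ^ 3) (at \<rho>)"
    using assms by (auto intro!: derivative_eq_intros simp: field_simps eval_nat_numeral)
  from DERIV_mult[OF has_real_derivative_powr[OF assms, of "- ?n"] DERIV_cmult[OF DERIV_chain2[OF max_cube_deriv(2) this], of 6]]
  have "((\<lambda>\<rho>. avg_kernel x \<rho> y) has_real_derivative
     - ?n * \<rho> powr (- ?n - 1) * (6 * (max 0 (1 - ?q / \<rho>\<^sup>2))\<^sup>2) + 6 * (2 * max 0 (1 - ?q / \<rho>\<^sup>2) * (2 * ?q / \<rho> ^ 3)) * \<rho> powr (- ?n)) (at \<rho>)"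
    unfolding avg_kernel_def .
  moreover have "- ?n * \<rho> powr (- ?n - 1) * (6 * (max 0 (1 - ?q / \<rho>\<^sup>2))\<^sup>2) + 6 * (2 * max 0 (1 - ?q / \<rho>\<^sup>2) * (2 * ?q / \<rho> ^ 3)) * \<rho> powr (- ?n)
     = \<rho> * laplacian (bump x \<rho>) y"
  proof -
    have p1: "\<rho> powr (- ?n - 1) = \<rho> powr (- ?n) / \<rho>" using assms by (simp add: powr_diff)
    show ?thesis unfolding L p2 p1 using assms
      by (simp add: divide_simps) (simp add: algebra_simps eval_nat_numeral)
  qed
  ultimately show "((\<lambda>\<rho>. avg_kernel x \<rho> y) has_real_derivative \<rho> * laplacian (bump x \<rho>) y) (at \<rho>)" by simp
qed

lemma cball_integral:
  fixes x :: "'a::euclidean_space"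
  assumes "\<rho> > 0"
  shows "integrable lborel (\<lambda>y. c * indicator (cball x \<rho>) y :: real)"
    "(\<integral>y. c * \<rho> powr (- real DIM('a)) * indicator (cball x \<rho>) y \<partial>lborel) = c * measure lborel (cball (0::'a) 1)"
proof -
  have "emeasure lborel (cball x \<rho>) < \<infinity>" by (rule emeasure_compact_finite[OF compact_cball])
  then show "integrable lborel (\<lambda>y. c * indicator (cball x \<rho>) y :: real)"
    by (intro integrable_mult_right integrable_real_indicator) auto
  have "\<rho> powr (- real DIM('a)) * \<rho> ^ DIM('a) = 1" using assms by (simp add: powr_minus powr_realpow)
  then show "(\<integral>y. c * \<rho> powr (- real DIM('a)) * indicator (cball x \<rho>) y \<partial>lborel) = c * measure lborel (cball (0::'a) 1)"
    using measure_cball_scaled[OF assms, of x] by (simp add: mult_ac)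
qed

text \<open>The time integral P of the difference of powers has the weak Laplacian w(b) - w(a),
  bounded by M. Hence the average of P against \<open>avg_kernel x \<rho>\<close> changes by at most
  M \<omega> r^2 for \<rho> between 0 and r. At \<rho> = r it is controlled by N, and as \<rho>
  tends to 0 it concentrates at x. The factor 3 \<omega> / 2^n is a lower bound for the mass of the
  kernel.\<close>

lemma mean_value_estimate:
  fixes u v :: "'a::euclidean_space \<Rightarrow> real \<Rightarrow> real"
  assumes m: "m > 0" and u: "fde_sol m u" and v: "fde_sol m v" and ab: "0 < a" "a \<le> b"
    and r: "r > 0" "cball x (2 * r) \<subseteq> - {0}"
    and M: "\<And>y. y \<in> cball x r \<Longrightarrow> \<bar>(u y b - v y b) - (u y a - v y a)\<bar> \<le> M"
    and N: "\<And>t. t \<in> {a..b} \<Longrightarrow> \<bar>\<integral>y. (u y t powr m / m - v y t powr m / m) * avg_kernel x r y \<partial>lborel\<bar> \<le> N"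
  defines "\<omega> \<equiv> measure lborel (cball (0::'a) 1)"
  shows "3 / 2 ^ DIM('a) * \<omega> * \<bar>integral {a..b} (\<lambda>t. u x t powr m / m - v x t powr m / m)\<bar> \<le> (b - a) * N + M * \<omega> * r\<^sup>2"
proof -
  let ?n = "real DIM('a)"
  let ?z = "\<lambda>x t. u x t powr m / m - v x t powr m / m"
  define P where "P y = integral {a..b} (?z y)" for y
  have M0: "M \<ge> 0" using M[of x] r by fastforce
  have w0: "\<omega> \<ge> 0" by (simp add: \<omega>_def)
  have sub: "cball x r \<subseteq> - {0}" using r by auto
  note cz = fde_sol_power_diff_continuous[OF u v m]
  have cP: "continuous_on (- {0}) P"
  proof -
    have "continuous_on ((- {0}) \<times> {a..b}) (\<lambda>(x, t). ?z x t)"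
      by (rule continuous_on_subset[OF cz]) (use ab in auto)
    from integral_continuous_on_param[of "- {0}" a b ?z, unfolded cbox_interval, OF this]
    show ?thesis by (simp add: P_def[abs_def])
  qed
  have bumpi: "integrable lborel (bump x \<rho>)" "(\<integral>y. bump x \<rho> y \<partial>lborel) \<le> \<omega>" if "\<rho> > 0" for \<rho>
  proof -
    show i: "integrable lborel (bump x \<rho>)"
      by (rule integrable_compact_support[OF compact_cball continuous_on_subset[OF Ck_on_2_continuous(1)[OF bump_laplacian(1)[OF that]] subset_UNIV]])
         (use kernel_outside[OF that] in auto)
    have "(\<integral>y. bump x \<rho> y \<partial>lborel) \<le> (\<integral>y. 1 * \<rho> powr (- ?n) * indicator (cball x \<rho>) y \<partial>lborel)"
      using kernel_bounds(2)[OF that, of x] by (intro integral_mono i cball_integral(1)[OF that]) auto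
    then show "(\<integral>y. bump x \<rho> y \<partial>lborel) \<le> \<omega>" unfolding cball_integral(2)[OF that] by (simp add: \<omega>_def)
  qed
  have weak: "\<bar>\<integral>y. P y * laplacian (bump x \<rho>) y \<partial>lborel\<bar> \<le> M * \<omega>" if \<rho>: "0 < \<rho>" "\<rho> \<le> r" for \<rho>
  proof -
    have s0: "y \<notin> cball x r \<Longrightarrow> bump x \<rho> y = 0" for y using kernel_outside(1)[OF \<rho>(1), of y x] \<rho>(2) by auto
    interpret B: fde_pair "bump x \<rho>" "cball x r" m u v
      by unfold_locales (use s0 sub m u v bump_laplacian(1)[OF \<rho>(1)] Ck_on_2_continuous(1)[OF bump_laplacian(1)[OF \<rho>(1)]] in auto)
    interpret L: test_function "laplacian (bump x \<rho>)" "cball x r"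
      by unfold_locales (use sub Ck_on_2_laplacian[OF bump_laplacian(1)[OF \<rho>(1)]] laplacian_zero_outside[OF compact_cball s0] in auto)
    have "(\<integral>y. P y * laplacian (bump x \<rho>) y \<partial>lborel) = integral {a..b} (\<lambda>t. \<integral>y. ?z y t * laplacian (bump x \<rho>) y \<partial>lborel)"
      unfolding P_def by (rule L.integral_time_swap(1)[OF cz ab])
    also have "\<dots> = (\<integral>y. B.w y b * bump x \<rho> y \<partial>lborel) - (\<integral>y. B.w y a * bump x \<rho> y \<partial>lborel)"
      using B.weak_identity[OF ab] by (intro integral_unique) (simp add: B.z_def)
    also have "\<dots> = (\<integral>y. (B.w y b - B.w y a) * bump x \<rho> y \<partial>lborel)"
      using B.slice_integrable[OF B.cont_w, of a] B.slice_integrable[OF B.cont_w, of b] ab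
      by (subst Bochner_Integration.integral_diff[symmetric]) (auto simp: left_diff_distrib)
    also have "\<bar>\<dots>\<bar> \<le> (\<integral>y. M * bump x \<rho> y \<partial>lborel)"
    proof (rule order_trans[OF integral_abs_bound integral_mono])
      have "integrable lborel (\<lambda>y. (B.w y b - B.w y a) * bump x \<rho> y)"
        using B.slice_integrable[OF B.cont_w, of a] B.slice_integrable[OF B.cont_w, of b] ab
        by (auto simp: left_diff_distrib)
      then show "integrable lborel (\<lambda>y. \<bar>(B.w y b - B.w y a) * bump x \<rho> y\<bar>)" by (rule integrable_abs)
      show "integrable lborel (\<lambda>y. M * bump x \<rho> y)" using bumpi(1)[OF \<rho>(1)] by simp
      fix y
      show "\<bar>(B.w y b - B.w y a) * bump x \<rho> y\<bar> \<le> M * bump x \<rho> y"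
      proof (cases "y \<in> cball x r")
        case True
        then show ?thesis using M[OF True] kernel_bounds(1)[OF \<rho>(1), of x y]
          by (simp add: abs_mult B.w_def mult_right_mono)
      qed (simp add: s0)
    qed
    also have "\<dots> \<le> M * \<omega>" using bumpi(2)[OF \<rho>(1)] M0 by (simp add: mult_left_mono)
    finally show ?thesis .
  qed
  \<comment> \<open>A fixed cutoff that is 1 on the ball of radius r turns P times
    \<open>hat\<close> into a test function, so that \<open>integral_deriv\<close> applies with
    \<rho> in the role of time.\<close>
  define hat where "hat y = 1 - cutoff ((norm (y - x))\<^sup>2 / r\<^sup>2)" for y
  have hat1: "hat y = 1" if "y \<in> cball x r" for y
  proof -
    have "(norm (y - x))\<^sup>2 \<le> r\<^sup>2" using that r by (intro power_mono) (auto simp: dist_norm norm_minus_commute)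
    then show ?thesis using r by (simp add: hat_def cutoff_values(1))
  qed
  have hat0: "hat y = 0" if "y \<notin> cball x (2 * r)" for y
  proof -
    have "(2 * r)\<^sup>2 \<le> (norm (y - x))\<^sup>2" using that r by (intro power_mono) (auto simp: dist_norm norm_minus_commute)
    then have "2 * r\<^sup>2 \<le> (norm (y - x))\<^sup>2" by (simp add: power_mult_distrib) (smt (verit) zero_le_power2)
    then show ?thesis using r by (simp add: hat_def cutoff_values(2) pos_le_divide_eq)
  qed
  have chat: "continuous_on UNIV hat" unfolding hat_def
  proof -
    have "continuous_on UNIV cutoff"
      by (intro continuous_at_imp_continuous_on ballI DERIV_isCont[OF cutoff_deriv(1)])
    moreover have "continuous_on UNIV (\<lambda>y. (norm (y - x))\<^sup>2 / r\<^sup>2)" using r by (intro continuous_intros) auto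
    ultimately have "continuous_on UNIV (\<lambda>y. cutoff ((norm (y - x))\<^sup>2 / r\<^sup>2))"
      by (rule continuous_on_compose2) simp
    then show "continuous_on UNIV (\<lambda>y. 1 - cutoff ((norm (y - x))\<^sup>2 / r\<^sup>2))" by (intro continuous_intros)
  qed
  interpret H: test_function "\<lambda>y. P y * hat y" "cball x (2 * r)"
  proof
    show "continuous_on UNIV (\<lambda>y. P y * hat y)"
      by (rule continuous_on_zero_extension[of "- {0}" "cball x (2 * r)"])
         (use r hat0 in \<open>auto intro!: continuous_intros cP continuous_on_subset[OF chat]\<close>)
  qed (use r hat0 in auto)
  define \<Phi> where "\<Phi> \<rho> = (\<integral>y. avg_kernel x \<rho> y * (P y * hat y) \<partial>lborel)" for \<rho>
  have pc: "continuous_on ((- {0::'a}) \<times> {0::real<..}) (\<lambda>z. snd z powr c)" for c by (intro continuous_intros) auto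
  have ck: "continuous_on ((- {0}) \<times> {0<..}) (\<lambda>(y, \<rho>). avg_kernel x \<rho> y)"
    unfolding avg_kernel_def split_beta by (intro continuous_intros pc) auto
  have cl: "continuous_on ((- {0}) \<times> {0<..}) (\<lambda>(y, \<rho>). \<rho> * laplacian (bump x \<rho>) y)"
  proof -
    have "continuous_on ((- {0}) \<times> {0<..}) (\<lambda>z. snd z * (snd z powr (- ?n - 2) *
       (24 * ((norm (fst z - x))\<^sup>2 / (snd z)\<^sup>2) * max 0 (1 - (norm (fst z - x))\<^sup>2 / (snd z)\<^sup>2)
        - 6 * ?n * (max 0 (1 - (norm (fst z - x))\<^sup>2 / (snd z)\<^sup>2))\<^sup>2)))"
      by (intro continuous_intros pc) auto
    then show ?thesis by (rule continuous_on_eq) (auto simp: bump_laplacian(3))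
  qed
  have dPhi: "(\<Phi> has_real_derivative (\<integral>y. \<rho> * laplacian (bump x \<rho>) y * (P y * hat y) \<partial>lborel)) (at \<rho>)" if "\<rho> > 0" for \<rho>
    unfolding \<Phi>_def[abs_def] by (rule H.integral_deriv[OF ck cl bump_laplacian(2) that])
  have dbound: "\<bar>\<integral>y. \<rho> * laplacian (bump x \<rho>) y * (P y * hat y) \<partial>lborel\<bar> \<le> r * (M * \<omega>)" if \<rho>: "0 < \<rho>" "\<rho> \<le> r" for \<rho>
  proof -
    have "(\<integral>y. \<rho> * laplacian (bump x \<rho>) y * (P y * hat y) \<partial>lborel) = (\<integral>y. \<rho> * (P y * laplacian (bump x \<rho>) y) \<partial>lborel)"
    proof (rule Bochner_Integration.integral_cong[OF refl])
      fix y
      show "\<rho> * laplacian (bump x \<rho>) y * (P y * hat y) = \<rho> * (P y * laplacian (bump x \<rho>) y)"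
      proof (cases "y \<in> cball x \<rho>")
        case True then show ?thesis using hat1[of y] \<rho> by simp
      next
        case False
        then show ?thesis unfolding bump_laplacian(3)[OF \<rho>(1)] outside_ball_sq[OF \<rho>(1) False] by simp
      qed
    qed
    then have "\<bar>\<integral>y. \<rho> * laplacian (bump x \<rho>) y * (P y * hat y) \<partial>lborel\<bar> = \<rho> * \<bar>\<integral>y. P y * laplacian (bump x \<rho>) y \<partial>lborel\<bar>"
      using \<rho> by (simp add: abs_mult)
    also have "\<dots> \<le> r * (M * \<omega>)" using weak[OF \<rho>] \<rho> r by (intro mult_mono) auto
    finally show ?thesis .
  qed
  have osc: "\<bar>\<Phi> \<rho> - \<Phi> r\<bar> \<le> r\<^sup>2 * (M * \<omega>)" if \<rho>: "0 < \<rho>" "\<rho> < r" for \<rho>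
  proof -
    have "\<exists>z. \<rho> < z \<and> z < r \<and> \<Phi> r - \<Phi> \<rho> = (r - \<rho>) * (\<integral>y. z * laplacian (bump x z) y * (P y * hat y) \<partial>lborel)"
      by (rule MVT2) (use \<rho> dPhi in auto)
    then obtain z where z: "\<rho> < z" "z < r" "\<Phi> r - \<Phi> \<rho> = (r - \<rho>) * (\<integral>y. z * laplacian (bump x z) y * (P y * hat y) \<partial>lborel)" by blast
    have "\<bar>\<Phi> \<rho> - \<Phi> r\<bar> = (r - \<rho>) * \<bar>\<integral>y. z * laplacian (bump x z) y * (P y * hat y) \<partial>lborel\<bar>"
      using z \<rho> by (subst abs_minus_commute) (simp add: abs_mult)
    also have "\<dots> \<le> r * (r * (M * \<omega>))" using dbound[of z] z \<rho> by (intro mult_mono) auto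
    finally show ?thesis by (simp add: power2_eq_square mult.assoc)
  qed
  have Phir: "\<bar>\<Phi> r\<bar> \<le> (b - a) * N"
  proof -
    have Icc: "{a..b} \<subseteq> {0<..}" using ab by auto
    interpret A: test_function "avg_kernel x r" "cball x r"
    proof
      show "continuous_on UNIV (avg_kernel x r)" unfolding avg_kernel_def using r by (intro continuous_intros) auto
    qed (use sub kernel_outside(2)[OF r(1)] in auto)
    have "\<Phi> r = (\<integral>y. P y * avg_kernel x r y \<partial>lborel)" unfolding \<Phi>_def
    proof (rule Bochner_Integration.integral_cong[OF refl])
      fix y show "avg_kernel x r y * (P y * hat y) = P y * avg_kernel x r y"
        using hat1[of y] kernel_outside(2)[OF r(1), of y x] by (cases "y \<in> cball x r") auto
    qed
    also have "\<dots> = integral {a..b} (\<lambda>t. \<integral>y. ?z y t * avg_kernel x r y \<partial>lborel)"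
      unfolding P_def by (rule A.integral_time_swap(1)[OF cz ab])
    also have "\<bar>\<dots>\<bar> \<le> N * (b - a)"
      using integral_bound[of a b "\<lambda>t. \<integral>y. ?z y t * avg_kernel x r y \<partial>lborel" N] ab N A.integral_continuous[OF cz Icc]
      by auto
    finally show ?thesis by (simp add: mult.commute)
  qed
  have "3 / 2 ^ DIM('a) * \<omega> * \<bar>P x\<bar> \<le> (b - a) * N + M * \<omega> * r\<^sup>2 + \<epsilon>" if \<epsilon>: "\<epsilon> > 0" for \<epsilon>
  proof -
    define e where "e = \<epsilon> / (6 * (\<omega> + 1))"
    have e: "e > 0" using \<epsilon> w0 by (simp add: e_def)
    have "x \<in> - {0}" using sub r by auto
    then have "isCont P x" using cP continuous_on_eq_continuous_at[of "- {0}" P] by auto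
    then obtain d where d: "d > 0" "\<And>y. dist y x < d \<Longrightarrow> \<bar>P y - P x\<bar> < e"
      using e by (auto simp: continuous_at_eps_delta dist_real_def)
    define \<rho> where "\<rho> = min (d / 2) (r / 2)"
    have \<rho>: "0 < \<rho>" "\<rho> < d" "\<rho> < r" using d(1) r(1) by (auto simp: \<rho>_def)
    have ki: "integrable lborel (avg_kernel x \<rho>)"
      by (rule integrable_compact_support[OF compact_cball[of x \<rho>]])
         (use kernel_outside[OF \<rho>(1)] \<rho> in \<open>auto simp: avg_kernel_def intro!: continuous_intros\<close>)
    \<comment> \<open>The kernel is at least 3 \<rho>^(-n) on the ball of half the radius, whose
      volume is \<omega> (\<rho> / 2)^n.\<close>
    have low: "3 / 2 ^ DIM('a) * \<omega> \<le> (\<integral>y. avg_kernel x \<rho> y \<partial>lborel)"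
    proof -
      have "(\<integral>y. (3 / 2 ^ DIM('a)) * (\<rho> / 2) powr (- ?n) * indicator (cball x (\<rho> / 2)) y \<partial>lborel) \<le> (\<integral>y. avg_kernel x \<rho> y \<partial>lborel)"
      proof (intro integral_mono ki cball_integral(1))
        fix y
        have "(3 / 2 ^ DIM('a)) * (\<rho> / 2) powr (- ?n) = 3 * \<rho> powr (- ?n)"
          using \<rho>(1) by (simp add: powr_divide powr_minus powr_realpow field_simps)
        then show "(3 / 2 ^ DIM('a)) * (\<rho> / 2) powr (- ?n) * indicator (cball x (\<rho> / 2)) y \<le> avg_kernel x \<rho> y"
          using kernel_bounds(5)[OF \<rho>(1), of x y] by simp
      qed (use \<rho> in auto)
      moreover have "\<rho> / 2 > 0" using \<rho> by simp
      ultimately show ?thesis unfolding \<omega>_def by (simp only: cball_integral(2))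
    qed
    have ki2: "integrable lborel (\<lambda>y. avg_kernel x \<rho> y * (P y * hat y))"
      using H.slice_integrable[OF ck \<rho>(1)] .
    have "\<bar>\<Phi> \<rho> - P x * (\<integral>y. avg_kernel x \<rho> y \<partial>lborel)\<bar> = \<bar>\<integral>y. avg_kernel x \<rho> y * (P y * hat y) - P x * avg_kernel x \<rho> y \<partial>lborel\<bar>"
      unfolding \<Phi>_def using ki ki2 by simp
    also have "\<dots> \<le> (\<integral>y. e * (6 * \<rho> powr (- ?n) * indicator (cball x \<rho>) y) \<partial>lborel)"
    proof (rule order_trans[OF integral_abs_bound integral_mono])
      show "integrable lborel (\<lambda>y. \<bar>avg_kernel x \<rho> y * (P y * hat y) - P x * avg_kernel x \<rho> y\<bar>)" using ki ki2 by simp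
      show "integrable lborel (\<lambda>y. e * (6 * \<rho> powr (- ?n) * indicator (cball x \<rho>) y) :: real)"
        using cball_integral(1)[OF \<rho>(1), of "e * (6 * \<rho> powr (- ?n))" x] by (simp add: mult.assoc)
      fix y
      show "\<bar>avg_kernel x \<rho> y * (P y * hat y) - P x * avg_kernel x \<rho> y\<bar> \<le> e * (6 * \<rho> powr (- ?n) * indicator (cball x \<rho>) y)"
      proof (cases "y \<in> cball x \<rho>")
        case True
        then have "dist y x < d" "hat y = 1" using \<rho> hat1[of y] by (auto simp: dist_commute)
        then have "avg_kernel x \<rho> y * (P y * hat y) - P x * avg_kernel x \<rho> y = (P y - P x) * avg_kernel x \<rho> y"
          by (simp add: algebra_simps)
        also have "\<bar>\<dots>\<bar> \<le> e * (6 * \<rho> powr (- ?n) * indicator (cball x \<rho>) y)"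
          unfolding abs_mult using d(2)[OF \<open>dist y x < d\<close>] kernel_bounds(3,4)[OF \<rho>(1), of x y]
          by (intro mult_mono) auto
        finally show ?thesis .
      qed (simp add: kernel_outside[OF \<rho>(1)])
    qed
    also have "\<dots> = e * (6 * \<omega>)" using cball_integral(2)[OF \<rho>(1), of 6 x] by (simp add: \<omega>_def)
    also have "\<dots> \<le> \<epsilon>" using \<epsilon> w0 by (simp add: e_def field_simps)
    finally have "\<bar>\<Phi> \<rho> - P x * (\<integral>y. avg_kernel x \<rho> y \<partial>lborel)\<bar> \<le> \<epsilon>" .
    moreover have "\<bar>P x * (\<integral>y. avg_kernel x \<rho> y \<partial>lborel)\<bar> \<ge> 3 / 2 ^ DIM('a) * \<omega> * \<bar>P x\<bar>"
    proof -
      have "0 \<le> (\<integral>y. avg_kernel x \<rho> y \<partial>lborel)" by (rule Bochner_Integration.integral_nonneg[OF kernel_bounds(3)[OF \<rho>(1)]])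
      then show ?thesis using mult_right_mono[OF low abs_ge_zero, of "P x"]
        by (simp add: abs_mult mult.commute)
    qed
    ultimately show ?thesis using osc[OF \<rho>(1,3)] Phir by (simp add: mult_ac)
  qed
  then have "3 / 2 ^ DIM('a) * \<omega> * \<bar>P x\<bar> \<le> (b - a) * N + M * \<omega> * r\<^sup>2" by (rule field_le_epsilon)
  then show ?thesis by (simp add: P_def)
qed

section \<open>Comparison of the weights\<close>

locale weight_setup =
  fixes \<mu> :: real and \<eta> :: "real \<Rightarrow> real" and n :: nat
  assumes n: "n \<ge> 3" and \<mu>: "0 < \<mu>" "\<mu> < real n - 2"
    and cont: "continuous_on {0..} \<eta>" and nonneg: "\<And>r. r \<ge> 0 \<Longrightarrow> \<eta> r \<ge> 0"
    and zero: "\<And>r. 0 \<le> r \<Longrightarrow> r \<le> 1 \<Longrightarrow> \<eta> r = 0"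
    and tail: "\<And>r. r \<ge> 2 \<Longrightarrow> \<eta> r = \<mu> * (real n - 2 - \<mu>) * r powr (- \<mu> - 2)"
begin

definition "mass s = integral {0..s} (\<lambda>\<rho>. \<rho> ^ (n - 1) * \<eta> \<rho>)"
definition "k = real n - 2 - \<mu>"
text \<open>Beyond radius 2 the integrand of the mass is \<mu> k s^(k - 1), so the mass there is
  \<mu> s^k plus this constant of integration.\<close>

definition "D = mass 2 - \<mu> * 2 powr k"
abbreviation "J \<equiv> weight_integrand n \<eta>"

lemma k: "k > 0" using \<mu> by (simp add: k_def)

lemma integrand_integrable: "0 \<le> a \<Longrightarrow> (\<lambda>\<rho>. \<rho> ^ (n - 1) * \<eta> \<rho>) integrable_on {a..b}"
  by (intro integrable_continuous_real continuous_intros continuous_on_subset[OF cont]) auto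

lemma mass_nonneg: "0 \<le> s \<Longrightarrow> 0 \<le> mass s"
  unfolding mass_def using nonneg by (intro Henstock_Kurzweil_Integration.integral_nonneg integrand_integrable) auto

lemma J_eq: "J s = 1 / s ^ (n - 1) * mass s"
  by (simp add: weight_integrand_def mass_def)

lemma J_nonneg: "0 \<le> s \<Longrightarrow> J s \<ge> 0"
  unfolding J_eq using mass_nonneg by simp

lemma mass_0: "0 \<le> s \<Longrightarrow> s \<le> 1 \<Longrightarrow> mass s = 0"
proof -
  assume s: "0 \<le> s" "s \<le> 1"
  have "mass s = integral {0..s} (\<lambda>_. 0)"
    unfolding mass_def by (rule Henstock_Kurzweil_Integration.integral_cong) (use s zero in auto)
  then show ?thesis by simp
qed

lemma mass_tail: "s \<ge> 2 \<Longrightarrow> mass s = D + \<mu> * s powr k"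
proof -
  assume s: "s \<ge> 2"
  have "((\<lambda>\<rho>. \<mu> * k * \<rho> powr (k - 1)) has_integral \<mu> * s powr k - \<mu> * 2 powr k) {2..s}"
  proof (rule fundamental_theorem_of_calculus[OF s])
    fix x assume "x \<in> {2..s}"
    then have "((\<lambda>\<rho>. \<mu> * \<rho> powr k) has_real_derivative \<mu> * (k * x powr (k - 1))) (at x)"
      by (intro DERIV_cmult has_real_derivative_powr) auto
    then show "((\<lambda>\<rho>. \<mu> * \<rho> powr k) has_vector_derivative \<mu> * k * x powr (k - 1)) (at x within {2..s})"
      by (simp add: has_real_derivative_iff_has_vector_derivative mult.assoc has_vector_derivative_at_within)
  qed
  moreover have "\<rho> ^ (n - 1) * \<eta> \<rho> = \<mu> * k * \<rho> powr (k - 1)" if "\<rho> \<in> {2..s}" for \<rho>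
  proof -
    have "\<rho> ^ (n - 1) = \<rho> powr (real n - 1)" using that n powr_realpow[of \<rho> "n - 1"] by (simp add: of_nat_diff)
    then have "\<rho> ^ (n - 1) * \<rho> powr (- \<mu> - 2) = \<rho> powr (k - 1)" by (simp add: powr_add[symmetric] k_def)
    then show ?thesis using tail[of \<rho>] that by (simp add: k_def mult_ac)
  qed
  ultimately have "((\<lambda>\<rho>. \<rho> ^ (n - 1) * \<eta> \<rho>) has_integral \<mu> * s powr k - \<mu> * 2 powr k) {2..s}"
    using has_integral_cong by (metis (no_types, lifting))
  then have "integral {2..s} (\<lambda>\<rho>. \<rho> ^ (n - 1) * \<eta> \<rho>) = \<mu> * s powr k - \<mu> * 2 powr k" by (rule integral_unique)
  moreover have "mass 2 + integral {2..s} (\<lambda>\<rho>. \<rho> ^ (n - 1) * \<eta> \<rho>) = mass s"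
    unfolding mass_def using s by (intro Henstock_Kurzweil_Integration.integral_combine integrand_integrable) auto
  ultimately show ?thesis by (simp add: D_def)
qed

text \<open>The quotient by s^(n - 1) is harmless at 0 because the mass vanishes on [0, 1].\<close>

lemma J_continuous: "continuous_on {0..r} J"
proof -
  have "continuous_on {0..} J"
  proof -
    have c1: "continuous_on {0..1} J"
      by (rule continuous_on_eq[where f="\<lambda>_. 0"]) (auto simp: J_eq mass_0)
    have cm: "continuous_on {0..b} mass" for b
      unfolding mass_def[abs_def] by (rule indefinite_integral_continuous_1) (rule integrand_integrable, simp)
    have "continuous_on {1..} J"
    proof -
      have "continuous_on {1..} mass"
      proof (rule continuous_at_imp_continuous_on, rule ballI)
        fix x :: real assume "x \<in> {1..}"
        then have "continuous_on {0<..<x + 1} mass" "x \<in> {0<..<x + 1}"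
          by (auto intro: continuous_on_subset[OF cm[of "x + 1"]])
        then show "isCont mass x" by (simp add: continuous_on_eq_continuous_at)
      qed
      then show ?thesis unfolding J_eq[abs_def] by (intro continuous_intros) auto
    qed
    then have "continuous_on ({0..1} \<union> {1..}) J" using c1 by (intro continuous_on_closed_Un) auto
    moreover have "{0..1} \<union> {1..} = {0::real..}" by auto
    ultimately show ?thesis by simp
  qed
  then show ?thesis by (rule continuous_on_subset) auto
qed

lemma J_tail: "s \<ge> 2 \<Longrightarrow> J s = D * s powr (1 - real n) + \<mu> * s powr (- \<mu> - 1)"
proof -
  assume s: "s \<ge> 2"
  have p: "1 / s ^ (n - 1) = s powr (1 - real n)"
    using s n powr_realpow[of s "n - 1"] powr_minus[of s "real n - 1"] by (simp add: of_nat_diff divide_inverse)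
  have e: "1 - real n + k = - \<mu> - 1" by (simp add: k_def)
  have "s powr (1 - real n) * s powr k = s powr (- \<mu> - 1)" unfolding e[symmetric] powr_add ..
  then show ?thesis unfolding J_eq mass_tail[OF s] p by (simp add: algebra_simps)
qed

text \<open>The closed form of the integral of \<open>J\<close> over [r, \<infinity>), valid for r
  \<ge> 2.\<close>

definition "rest r = D * r powr (2 - real n) / (real n - 2) + r powr (- \<mu>)"

lemma J_tail_integral: "r \<ge> 2 \<Longrightarrow> (J has_integral rest r) {r..}"
proof -
  assume r: "r \<ge> 2"
  have n2: "real n > 2" using n by simp
  have "((\<lambda>s. D * s powr (1 - real n) + \<mu> * s powr (- \<mu> - 1)) has_integral
     D * (- (r powr (1 - real n + 1)) / (1 - real n + 1)) + \<mu> * (- (r powr (- \<mu> - 1 + 1)) / (- \<mu> - 1 + 1))) {r..}"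
    using n2 r \<mu> by (intro has_integral_add has_integral_mult_right has_integral_powr_to_inf) auto
  moreover have "D * (- (r powr (1 - real n + 1)) / (1 - real n + 1)) + \<mu> * (- (r powr (- \<mu> - 1 + 1)) / (- \<mu> - 1 + 1)) = rest r"
  proof -
    define N where "N = real n - 2"
    have e: "1 - real n + 1 = - N" "- \<mu> - 1 + 1 = - \<mu>" "2 - real n = - N" by (simp_all add: N_def)
    show ?thesis unfolding rest_def e N_def[symmetric] using \<mu> by simp
  qed
  ultimately have "((\<lambda>s. D * s powr (1 - real n) + \<mu> * s powr (- \<mu> - 1)) has_integral rest r) {r..}" by simp
  then show ?thesis by (rule has_integral_eq[rotated]) (use J_tail r in auto)
qed

text \<open>\<open>D\<close> may be negative, but the mass up to 2 is not, so D \<ge> - \<mu> 2^k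
  and D r^(-k) \<ge> - \<mu> for r \<ge> 2. The lower bound is thus a positive multiple of
  r^(-\<mu>), as \<mu> < n - 2.\<close>

lemma rest_bounds:
  assumes r: "r \<ge> 2"
  shows "(1 - \<mu> / (real n - 2)) * r powr (- \<mu>) \<le> rest r" "rest r \<le> (\<bar>D\<bar> / (real n - 2) + 1) * r powr (- \<mu>)"
proof -
  have n2: "real n > 2" using n by simp
  have p: "r powr (2 - real n) = r powr (- k) * r powr (- \<mu>)" by (simp add: powr_add[symmetric] k_def)
  have "mass 2 \<ge> 0" by (rule mass_nonneg) simp
  then have "- (\<mu> * 2 powr k) \<le> D" by (simp add: D_def)
  then have "- (\<mu> * 2 powr k) * r powr (- k) \<le> D * r powr (- k)" by (rule mult_right_mono) simp
  moreover have "2 powr k * r powr (- k) \<le> 1"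
  proof -
    have "2 powr k \<le> r powr k" using r k by (intro powr_mono2) auto
    then show ?thesis using r by (simp add: powr_minus field_simps)
  qed
  then have "\<mu> * (2 powr k * r powr (- k)) \<le> \<mu> * 1" using \<mu> by (intro mult_left_mono) auto
  ultimately have "- \<mu> \<le> D * r powr (- k)" by (simp add: mult.assoc)
  then have "- \<mu> / (real n - 2) \<le> D * r powr (- k) / (real n - 2)" using n2 by (intro divide_right_mono) auto
  then have "(- \<mu> / (real n - 2) + 1) * r powr (- \<mu>) \<le> (D * r powr (- k) / (real n - 2) + 1) * r powr (- \<mu>)"
    by (intro mult_right_mono add_right_mono) auto
  moreover have rest: "rest r = (D * r powr (- k) / (real n - 2) + 1) * r powr (- \<mu>)"
    unfolding rest_def p by (simp add: algebra_simps)
  ultimately show "(1 - \<mu> / (real n - 2)) * r powr (- \<mu>) \<le> rest r" by simp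
  have "r powr (- k) \<le> 1" using r k powr_mono2'[of "-k" 1 r] by simp
  then have "\<bar>D\<bar> * r powr (- k) \<le> \<bar>D\<bar> * 1" by (intro mult_left_mono) auto
  moreover have "D * r powr (- k) \<le> \<bar>D\<bar> * r powr (- k)" by (intro mult_right_mono) auto
  ultimately have "D * r powr (- k) \<le> \<bar>D\<bar>" by linarith
  then have "D * r powr (- k) / (real n - 2) \<le> \<bar>D\<bar> / (real n - 2)" using n2 by (intro divide_right_mono) auto
  then show "rest r \<le> (\<bar>D\<bar> / (real n - 2) + 1) * r powr (- \<mu>)"
    unfolding rest by (intro mult_right_mono) auto
qed

lemma J_total: "r \<ge> 2 \<Longrightarrow> (J has_integral integral {0..r} J + rest r) {0..}"
proof -
  assume r: "r \<ge> 2"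
  have "(J has_integral integral {0..r} J) {0..r}"
    by (intro integrable_integral integrable_continuous_real J_continuous)
  moreover have "{0..r} \<inter> {r..} = {r}" "{0..r} \<union> {r..} = {0..}" using r by auto
  ultimately show ?thesis using has_integral_Un[OF _ J_tail_integral[OF r], of _ "{0..r}"] by simp
qed

text \<open>The normalising constant is the inverse of the total integral T of \<open>J\<close>, so
  the weight is the tail of \<open>J\<close> beyond r divided by T. For r \<ge> 2 this is
  \<open>rest r\<close> over T, of order r^(-\<mu>); for r \<le> 2 it lies between
  \<open>rest 2\<close> over T and 1.\<close>

lemma weight_comparison:
  obtains c1 c2 where "c1 > 0" "c2 > 0"
    "\<And>r. r \<ge> 0 \<Longrightarrow> c1 * (1 + r\<^sup>2) powr (- (\<mu> / 2)) \<le> 1 - weight_const n \<eta> * integral {0..r} J"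
    "\<And>r. r \<ge> 0 \<Longrightarrow> 1 - weight_const n \<eta> * integral {0..r} J \<le> c2 * (1 + r\<^sup>2) powr (- (\<mu> / 2))"
proof -
  have n2: "real n > 2" using n by simp
  define T where "T = integral {0..} J"
  have T: "T = integral {0..r} J + rest r" if "r \<ge> 2" for r
    using J_total[OF that] unfolding T_def by (rule integral_unique)
  have J0: "integral {0..r} J \<ge> 0" for r
    by (intro Henstock_Kurzweil_Integration.integral_nonneg integrable_continuous_real J_continuous) (auto simp: J_nonneg)
  define b where "b = 1 - \<mu> / (real n - 2)"
  have b: "b > 0" using \<mu> n2 by (simp add: b_def)
  have rest2: "rest 2 > 0" using rest_bounds(1)[of 2] b by (smt (verit) b_def mult_pos_pos powr_gt_zero)
  then have Tp: "T > 0" using T[of 2] J0[of 2] by simp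
  define B where "B = \<bar>D\<bar> / (real n - 2) + 1"
  have B: "B > 0" using n2 by (simp add: B_def add_nonneg_pos)
  have w: "1 - weight_const n \<eta> * integral {0..r} J = (T - integral {0..r} J) / T" for r
    using Tp by (simp add: weight_const_def T_def[symmetric] field_simps)
  let ?W = "\<lambda>r. (1 + r\<^sup>2) powr (- (\<mu> / 2))"
  have W1: "?W r \<le> 1" for r :: real using \<mu> powr_mono2'[of "- (\<mu> / 2)" 1 "1 + r\<^sup>2"] by simp
  have W2: "?W r \<le> r powr (- \<mu>)" "r powr (- \<mu>) \<le> 2 powr \<mu> * ?W r" if r: "r \<ge> 2" for r
  proof -
    have rp: "(r\<^sup>2) powr (- (\<mu> / 2)) = r powr (- \<mu>)" using r by (simp add: powr_powr flip: powr_numeral)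
    have "?W r \<le> (r\<^sup>2) powr (- (\<mu> / 2))" using r \<mu> by (intro powr_mono2') auto
    then show "?W r \<le> r powr (- \<mu>)" unfolding rp .
    have "1 \<le> r\<^sup>2" using r by (simp add: one_le_power)
    then have "1 + r\<^sup>2 \<le> 4 * r\<^sup>2" by simp
    then have "(4 * r\<^sup>2) powr (- (\<mu> / 2)) \<le> ?W r" using \<mu> by (intro powr_mono2') (auto simp: add_pos_nonneg)
    moreover have "(4 * r\<^sup>2) powr (- (\<mu> / 2)) = 2 powr (- \<mu>) * r powr (- \<mu>)"
    proof -
      have "(4::real) powr (- (\<mu> / 2)) = (2 powr 2) powr (- (\<mu> / 2))" by simp
      also have "\<dots> = 2 powr (- \<mu>)" by (simp only: powr_powr) simp
      finally show ?thesis using rp by (simp add: powr_mult)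
    qed
    ultimately have "2 powr \<mu> * (2 powr (- \<mu>) * r powr (- \<mu>)) \<le> 2 powr \<mu> * ?W r" by (intro mult_left_mono) auto
    then show "r powr (- \<mu>) \<le> 2 powr \<mu> * ?W r" by (simp add: mult.assoc[symmetric] powr_add[symmetric])
  qed
  have W3: "5 powr (- (\<mu> / 2)) \<le> ?W r" if "0 \<le> r" "r \<le> 2" for r
  proof -
    have "r\<^sup>2 \<le> 2\<^sup>2" using that by (intro power_mono) auto
    then show ?thesis using \<mu> by (intro powr_mono2') (auto simp: add_pos_nonneg)
  qed
  have small: "rest 2 \<le> T - integral {0..r} J" if "0 \<le> r" "r \<le> 2" for r
  proof -
    have "integral {0..r} J \<le> integral {0..2} J"
      using that by (intro integral_subset_le integrable_continuous_real J_continuous) (auto simp: J_nonneg)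
    then show ?thesis using T[of 2] by simp
  qed
  define c1 where "c1 = min (rest 2) b / T"
  define c2 where "c2 = max (5 powr (\<mu> / 2)) (B * 2 powr \<mu> / T)"
  show ?thesis
  proof (rule that[of c1 c2])
    show "c1 > 0" using rest2 b Tp by (simp add: c1_def)
    show "c2 > 0" by (simp add: c2_def less_max_iff_disj)
    fix r :: real assume r0: "r \<ge> 0"
    show "c1 * ?W r \<le> 1 - weight_const n \<eta> * integral {0..r} J"
    proof (cases "r \<le> 2")
      case True
      have "min (rest 2) b * ?W r \<le> rest 2 * 1" using rest2 b W1[of r] by (intro mult_mono) auto
      then show ?thesis unfolding w c1_def using small[OF r0 True] Tp by (simp add: field_simps)
    next
      case False
      then have r: "r \<ge> 2" by simp
      have "min (rest 2) b * ?W r \<le> b * r powr (- \<mu>)" using rest2 b W2(1)[OF r] by (intro mult_mono) auto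
      also have "\<dots> \<le> T - integral {0..r} J" using rest_bounds(1)[OF r] T[OF r] by (simp add: b_def)
      finally show ?thesis unfolding w c1_def using Tp by (simp add: field_simps)
    qed
    show "1 - weight_const n \<eta> * integral {0..r} J \<le> c2 * ?W r"
    proof (cases "r \<le> 2")
      case True
      have "(T - integral {0..r} J) / T \<le> 1" using Tp J0[of r] by (simp add: field_simps)
      also have "1 = 5 powr (\<mu> / 2) * 5 powr (- (\<mu> / 2))" by (simp add: powr_minus)
      also have "\<dots> \<le> c2 * ?W r" using W3[OF r0 True] by (intro mult_mono) (auto simp: c2_def le_max_iff_disj)
      finally show ?thesis unfolding w .
    next
      case False
      then have r: "r \<ge> 2" by simp
      have "T - integral {0..r} J \<le> B * r powr (- \<mu>)" using rest_bounds(2)[OF r] T[OF r] by (simp add: B_def)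
      also have "\<dots> \<le> B * (2 powr \<mu> * ?W r)" using W2(2)[OF r] B by (intro mult_left_mono) auto
      finally have "(T - integral {0..r} J) / T \<le> B * (2 powr \<mu> * ?W r) / T" using Tp by (intro divide_right_mono) auto
      also have "\<dots> = (B * 2 powr \<mu> / T) * ?W r" by simp
      also have "\<dots> \<le> c2 * ?W r" by (intro mult_right_mono) (auto simp: c2_def)
      finally show ?thesis unfolding w .
    qed
  qed
qed

end

lemma weight_equivalent:
  assumes n: "DIM('a::euclidean_space) \<ge> 3" and \<mu>: "0 < \<mu>" "\<mu> < real DIM('a) - 2"
    and \<eta>: "weight_source TYPE('a) \<mu> \<eta>"
  obtains c1 c2 where "c1 > 0" "c2 > 0" "\<And>x::'a. c1 * Wt (\<mu> / 2) x \<le> weight \<eta> x" "\<And>x::'a. weight \<eta> x \<le> c2 * Wt (\<mu> / 2) x"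
proof -
  interpret weight_setup \<mu> \<eta> "DIM('a)"
  proof
    obtain e :: 'a where e: "e \<in> Basis" using nonempty_Basis by blast
    have "continuous_on UNIV (\<lambda>x::'a. \<eta> (norm x))"
      using \<eta> unfolding weight_source_def smooth_on_def by (metis Ck_on.simps(1))
    then have "continuous_on {0..} (\<lambda>r. \<eta> (norm (r *\<^sub>R e)))"
      by (rule continuous_on_compose2) (auto intro!: continuous_intros)
    then show "continuous_on {0..} \<eta>" by (rule continuous_on_eq) (use e in auto)
  qed (use n \<mu> \<eta> in \<open>auto simp: weight_source_def\<close>)
  obtain c1 c2 where c: "c1 > 0" "c2 > 0"
    "\<And>r. r \<ge> 0 \<Longrightarrow> c1 * (1 + r\<^sup>2) powr (- (\<mu> / 2)) \<le> 1 - weight_const DIM('a) \<eta> * integral {0..r} J"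
    "\<And>r. r \<ge> 0 \<Longrightarrow> 1 - weight_const DIM('a) \<eta> * integral {0..r} J \<le> c2 * (1 + r\<^sup>2) powr (- (\<mu> / 2))"
    by (rule weight_comparison) blast
  show ?thesis
    by (rule that[OF c(1,2)]) (use c(3,4)[OF norm_ge_zero] in \<open>auto simp: Wt_def weight_def\<close>)
qed

section \<open>Convergence of the rescaled solutions\<close>

text \<open>Local integrability speaks about compact sets only; the punctured space is exhausted by
  countably many compact shells.\<close>

lemma L1_loc_measurable_punctured:
  assumes "L1_loc (f :: 'a::euclidean_space \<Rightarrow> real)"
  shows "(\<lambda>x. indicator (- {0}) x * f x) \<in> borel_measurable lebesgue"
proof (rule borel_measurable_LIMSEQ_real)
  define S where "S j = (cut_shell (inverse (real (Suc j))) (real j) :: 'a set)" for j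
  show "(\<lambda>x. indicator (S j) x * f x) \<in> borel_measurable lebesgue" for j
    unfolding S_def using assms by (intro L1_loc_measurable compact_cut_shell cut_shell_subset) auto
  fix x :: 'a
  show "(\<lambda>j. indicator (S j) x * f x) \<longlonglongrightarrow> indicator (- {0}) x * f x"
  proof (cases "x = 0")
    case True
    then show ?thesis by (simp add: S_def cut_shell_def indicator_def)
  next
    case False
    obtain j0 where j0: "real j0 \<ge> norm x" "real j0 \<ge> inverse (norm x)"
      using real_arch_simple[of "max (norm x) (inverse (norm x))"] by auto
    have "x \<in> S j" if "j \<ge> j0" for j
    proof -
      have "inverse (norm x) \<le> real (Suc j)" using j0 that by simp
      then have "inverse (real (Suc j)) \<le> inverse (inverse (norm x))" using False by (intro le_imp_inverse_le) auto
      then show ?thesis using j0 that by (simp add: S_def cut_shell_def)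
    qed
    then have "\<forall>\<^sub>F j in sequentially. indicator (S j) x * f x = indicator (- {0}) x * f x"
      using False by (intro eventually_sequentiallyI[of j0]) simp
    then show ?thesis by (rule tendsto_eventually)
  qed
qed

lemma continuous_measurable_punctured:
  fixes f :: "'a::euclidean_space \<Rightarrow> real"
  assumes "continuous_on (- {0}) f"
  shows "(\<lambda>x. ennreal (f x) * indicator (- {0}) x) \<in> borel_measurable lebesgue"
proof -
  have "(\<lambda>x. indicator (- {0}) x *\<^sub>R f x) \<in> borel_measurable borel"
    by (rule borel_measurable_continuous_on_indicator) (use assms in auto)
  then have "(\<lambda>x. ennreal (indicator (- {0}) x *\<^sub>R f x)) \<in> borel_measurable lebesgue"
    by (intro measurable_completion) simp
  moreover have "(\<lambda>x. ennreal (indicator (- {0}) x *\<^sub>R f x)) = (\<lambda>x. ennreal (f x) * indicator (- {0}) x)"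
    by (auto simp: indicator_def)
  ultimately show ?thesis by simp
qed

lemma continuous_Wt: "continuous_on S (Wt \<nu> :: 'a::euclidean_space \<Rightarrow> real)"
proof -
  have "1 + (norm x)\<^sup>2 \<noteq> 0" for x :: 'a by (smt (verit) zero_le_power2)
  then show ?thesis unfolding Wt_def by (intro continuous_intros) auto
qed

text \<open>The set where h is positive is open, and an open null set is empty. This turns the
  contraction into a pointwise comparison.\<close>

lemma nonpos_of_integral_zero:
  fixes h :: "'a::euclidean_space \<Rightarrow> real"
  assumes c: "continuous_on (- {0}) h" and z: "(\<integral>\<^sup>+x\<in>-{0}. ennreal (max 0 (h x) * Wt \<nu> x) \<partial>lebesgue) = 0" and x: "x \<noteq> 0"
  shows "h x \<le> 0"
proof (rule ccontr)
  assume "\<not> h x \<le> 0"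
  define S where "S = {y \<in> - {0}. h y \<in> {0<..}}"
  have "open S" unfolding S_def using continuous_open_preimage[OF c open_Compl[OF closed_singleton] open_greaterThan[of 0]] by (simp add: vimage_def Int_def)
  moreover have "x \<in> S" using x \<open>\<not> h x \<le> 0\<close> by (simp add: S_def)
  ultimately have "\<not> negligible S" using open_not_negligible by blast
  moreover have nW: "\<not> Wt \<nu> y \<le> 0" for y :: 'a using Wt_pos[of \<nu> y] by linarith
  have "AE y in lebesgue. ennreal (max 0 (h y) * Wt \<nu> y) * indicator (- {0}) y = 0"
    using z by (subst (asm) nn_integral_0_iff_AE)
      (auto intro!: continuous_measurable_punctured continuous_intros c continuous_Wt)
  then have "AE y in lebesgue. y \<notin> S"
    by eventually_elim (use nW in \<open>auto simp: S_def ennreal_eq_0_iff mult_le_0_iff\<close>)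
  then have "negligible S"
    by (auto simp: negligible_iff_null_sets AE_iff_null_sets eventually_ae_filter intro: null_sets_completion_subset)
  ultimately show False by simp
qed

text \<open>\<open>f0\<close> is the profile of the limit, \<open>f1\<close> and \<open>f2\<close>
  are those of the lower and the upper barrier. The condition on the initial difference is already
  stated with \<open>Wt \<nu>\<close>, where \<nu> = \<mu> / 2 in the application.\<close>

locale asym =
  P0: profile m \<alpha> \<beta> \<gamma> lam0 f0 + P1: profile m \<alpha> \<beta> \<gamma> lam1 f1 + P2: profile m \<alpha> \<beta> \<gamma> lam2 f2
  for m \<alpha> \<beta> \<gamma> lam0 lam1 lam2 :: real and f0 f1 f2 :: "'a::euclidean_space \<Rightarrow> real" +
  fixes \<nu> A0 :: real and u0 :: "'a \<Rightarrow> real" and u :: "'a \<Rightarrow> real \<Rightarrow> real"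
  assumes \<nu>: "0 < \<nu>" "2 * (\<nu> + 1) \<le> real DIM('a)"
    and A0: "A0 = lam0 powr (1 / ((1 - m) * \<beta>))"
    and u: "fde_sol m u" "initial_trace u u0" and u0: "\<And>x. x \<noteq> 0 \<Longrightarrow> u0 x \<ge> 0"
    and bounds: "\<And>x t. x \<noteq> 0 \<Longrightarrow> t > 0 \<Longrightarrow> self_similar \<alpha> \<beta> f1 x t \<le> u x t \<and> u x t \<le> self_similar \<alpha> \<beta> f2 x t"
    and L1: "(\<integral>\<^sup>+x\<in>-{0}. ennreal (\<bar>u0 x - A0 * norm x powr (- \<gamma>)\<bar> * Wt \<nu> x) \<partial>lebesgue) < \<infinity>"
begin

abbreviation "V0 \<equiv> self_similar \<alpha> \<beta> f0"
abbreviation "V1 \<equiv> self_similar \<alpha> \<beta> f1"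
abbreviation "V2 \<equiv> self_similar \<alpha> \<beta> f2"

text \<open>A barrier of the form c V(x, l t) makes \<open>w\<close> admissible. The constants c and
  l are there for the time-rescaled solution in \<open>time_monotone\<close>.\<close>

lemma contraction_below:
  fixes w v :: "'a \<Rightarrow> real \<Rightarrow> real"
  assumes P: "profile m \<alpha> \<beta> \<gamma> lam f" and w: "fde_sol m w" "initial_trace w w0" and v: "fde_sol m v" "initial_trace v v0"
    and b: "c > 0" "l > 0" "\<And>x t. x \<noteq> 0 \<Longrightarrow> t > 0 \<Longrightarrow> w x t \<le> c * self_similar \<alpha> \<beta> f x (l * t)" and t: "t > 0"
  shows "(\<integral>\<^sup>+x\<in>-{0}. ennreal (max 0 (w x t - v x t) * Wt \<nu> x) \<partial>lebesgue)
     \<le> (\<integral>\<^sup>+x\<in>-{0}. ennreal (max 0 (w0 x - v0 x) * Wt \<nu> x) \<partial>lebesgue)"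
proof -
  interpret P: profile m \<alpha> \<beta> \<gamma> lam f by (rule P)
  obtain \<kappa> \<theta> where e: "0 \<le> \<kappa>" "real DIM('a) - 2 - 2 * \<nu> < \<kappa>" "\<theta> < 1"
    and adm: "\<And>u c l T. c > 0 \<Longrightarrow> l > 0 \<Longrightarrow> (\<And>x t. x \<noteq> 0 \<Longrightarrow> t > 0 \<Longrightarrow> 0 < u x t \<and> u x t \<le> c * self_similar \<alpha> \<beta> f x (l * t)) \<Longrightarrow>
       admissible m (m * \<gamma>) \<kappa> \<theta> T u"
    using P.admissible_exponents[OF \<nu>(1)] by metis
  have "admissible m (m * \<gamma>) \<kappa> \<theta> t w"
    by (rule adm[OF b(1,2)]) (use b(3) fde_solD(1)[OF w(1)] in auto)
  moreover have "0 \<le> m * \<gamma>" using P0.m P0.\<gamma>(1) by (intro mult_nonneg_nonneg) linarith+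
  ultimately show ?thesis
    using contraction[OF P0.m(1) w(1) v(1) w(2) v(2) t _ _ P0.\<gamma>(2) e(1,2,3) _ \<nu>(2)] \<nu>(1) by simp
qed

definition U :: "real \<Rightarrow> 'a \<Rightarrow> real \<Rightarrow> real" where
  "U T x s = T powr \<alpha> * u (T powr \<beta> *\<^sub>R x) (T * s)"
definition U0 :: "real \<Rightarrow> 'a \<Rightarrow> real" where
  "U0 T x = T powr \<alpha> * u0 (T powr \<beta> *\<^sub>R x)"

text \<open>The balance of \<open>fde_sol_scaled\<close> for amplitude T^\<alpha>, length T^\<beta>
  and time T is the relation \<alpha> (1 - m) = 2 \<beta> - 1.\<close>

lemma U_sol: assumes "T > 0" shows "fde_sol m (U T)" "initial_trace (U T) (U0 T)"
proof -
  have e: "\<alpha> + 1 = \<alpha> * m + \<beta> + \<beta>" using P0.\<alpha>(1) by (simp add: algebra_simps)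
  have "T powr \<alpha> * T = T powr (\<alpha> + 1)" using assms by (simp add: powr_add)
  also have "\<dots> = (T powr \<alpha>) powr m * (T powr \<beta>)\<^sup>2"
    unfolding e by (simp only: powr_add powr_powr power2_eq_square mult.assoc)
  finally have e': "T powr \<alpha> * T = (T powr \<alpha>) powr m * (T powr \<beta>)\<^sup>2" .
  show "fde_sol m (U T)" unfolding U_def[abs_def]
    by (rule fde_sol_scaled[OF P0.m(1) u(1) _ _ assms e']) (use assms in auto)
  show "initial_trace (U T) (U0 T)" unfolding U_def[abs_def] U0_def[abs_def]
    by (rule initial_trace_scaled[OF u _ _ assms]) (use assms in auto)
qed

lemma U_bounds: 
  assumes "T > 0" "x \<noteq> 0" "t > 0" shows "V1 x t \<le> U T x t" "U T x t \<le> V2 x t" "U T x t > 0"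
proof -
  have b: "V1 (T powr \<beta> *\<^sub>R x) (T * t) \<le> u (T powr \<beta> *\<^sub>R x) (T * t)" "u (T powr \<beta> *\<^sub>R x) (T * t) \<le> V2 (T powr \<beta> *\<^sub>R x) (T * t)"
    using bounds[of "T powr \<beta> *\<^sub>R x" "T * t"] assms by auto
  show "V1 x t \<le> U T x t" "U T x t \<le> V2 x t"
    unfolding U_def P1.V_scaling[OF assms(1,3), of x, symmetric] P2.V_scaling[OF assms(1,3), of x, symmetric]
    using b by (intro mult_left_mono; simp)+
  show "U T x t > 0" using fde_solD(1)[OF U_sol(1)[OF assms(1)] assms(2,3)] .
qed

text \<open>The Benilan--Crandall monotonicity, by comparison with a time rescaling.\<close>

lemma time_monotone:
  assumes T: "T > 0" and x: "x \<noteq> 0" and k: "k \<ge> 1" and t: "t > 0"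
  shows "U T x (k * t) \<le> k powr (1 / (1 - m)) * U T x t"
proof -
  \<comment> \<open>The exponent solves c k = c^m, the balance for a rescaling of time alone. Since
    c \<le> 1, the initial data are ordered and the right side of the contraction is 0.\<close>
  define c where "c = k powr (- 1 / (1 - m))"
  have c: "c > 0" using k by (simp add: c_def)
  have c1: "c \<le> 1" unfolding c_def using k P0.m powr_mono[of "- 1 / (1 - m)" 0 k] by simp
  let ?w = "\<lambda>x t. c * U T (1 *\<^sub>R x) (k * t)"
  have "c * k = c powr m * 1\<^sup>2"
  proof -
    have e: "- 1 / (1 - m) + 1 = - 1 / (1 - m) * m" using P0.m by (simp add: field_simps)
    have "c * k = k powr (- 1 / (1 - m) + 1)" unfolding powr_add c_def using k by simp
    also have "\<dots> = c powr m" unfolding e c_def powr_powr ..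
    finally show ?thesis by simp
  qed
  then have w: "fde_sol m ?w" using fde_sol_scaled[OF P0.m(1) U_sol(1)[OF T] c, of 1 k] k by simp
  have w0: "initial_trace ?w (\<lambda>x. c * U0 T (1 *\<^sub>R x))"
    by (rule initial_trace_scaled[OF U_sol[OF T] c]) (use k in auto)
  have "(\<integral>\<^sup>+x\<in>-{0}. ennreal (max 0 (?w x t - U T x t) * Wt \<nu> x) \<partial>lebesgue)
     \<le> (\<integral>\<^sup>+x\<in>-{0}. ennreal (max 0 (c * U0 T (1 *\<^sub>R x) - U0 T x) * Wt \<nu> x) \<partial>lebesgue)"
  proof (rule contraction_below[OF P2.profile_axioms w w0 U_sol[OF T] c _ _ t])
    show "k > 0" using k by simp
    show "?w x t \<le> c * V2 x (k * t)" if "x \<noteq> 0" "t > 0" for x t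
      using U_bounds(2)[OF T that(1), of "k * t"] that k c by (simp add: mult_left_mono)
  qed
  also have "\<dots> = (\<integral>\<^sup>+x\<in>-{0::'a}. 0 \<partial>lebesgue)"
  proof (rule nn_integral_cong)
    fix x :: 'a
    have "x \<noteq> 0 \<Longrightarrow> U0 T x \<ge> 0" unfolding U0_def using u0[of "T powr \<beta> *\<^sub>R x"] T by simp
    then have "x \<noteq> 0 \<Longrightarrow> c * U0 T x - U0 T x \<le> 0" using c1 by (simp add: mult_left_le_one_le c less_imp_le)
    then show "ennreal (max 0 (c * U0 T (1 *\<^sub>R x) - U0 T x) * Wt \<nu> x) * indicator (- {0}) x = 0 * indicator (- {0}) x"
      by (cases "x = 0") auto
  qed
  finally have "(\<integral>\<^sup>+x\<in>-{0}. ennreal (max 0 (?w x t - U T x t) * Wt \<nu> x) \<partial>lebesgue) = 0" by simp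
  moreover have "continuous_on (- {0}) (\<lambda>x. ?w x t - U T x t)"
    by (intro continuous_on_diff Ck_on_2_continuous(1)[OF fde_solD(2)[OF w t]] Ck_on_2_continuous(1)[OF fde_solD(2)[OF U_sol(1)[OF T] t]])
  ultimately have "?w x t - U T x t \<le> 0" using nonpos_of_integral_zero x by blast
  then have "k powr (1 / (1 - m)) * (c * U T x (k * t)) \<le> k powr (1 / (1 - m)) * U T x t" by (intro mult_left_mono) auto
  moreover have "k powr (1 / (1 - m)) * c = 1" unfolding c_def using k by (simp add: powr_add[symmetric])
  ultimately show ?thesis by (metis mult.assoc mult_1)
qed

definition "E T = (\<integral>\<^sup>+x\<in>-{0}. ennreal (\<bar>U0 T x - A0 * norm x powr (- \<gamma>)\<bar> * Wt \<nu> x) \<partial>lebesgue)"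

lemma V0_trace: "initial_trace V0 (\<lambda>x. A0 * norm x powr (- \<gamma>))"
  using P0.V_trace unfolding A0 .

text \<open>The contraction is applied to each sign of the difference, with \<open>V2\<close> as
  barrier above \<open>U T\<close> and \<open>V0\<close> as its own barrier. Each part is at most
  \<open>E T\<close>, whence the factor 2.\<close>

lemma distance_bound:
  assumes T: "T > 0" and t: "t > 0"
  shows "(\<integral>\<^sup>+x\<in>-{0}. ennreal (\<bar>U T x t - V0 x t\<bar> * Wt \<nu> x) \<partial>lebesgue) \<le> 2 * E T"
proof -
  let ?a = "\<lambda>x. ennreal (max 0 (U T x t - V0 x t) * Wt \<nu> x) * indicator (- {0}) x"
  let ?b = "\<lambda>x. ennreal (max 0 (V0 x t - U T x t) * Wt \<nu> x) * indicator (- {0}) x"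
  have c: "continuous_on (- {0}) (\<lambda>x. U T x t)" "continuous_on (- {0}) (\<lambda>x. V0 x t)"
    by (rule Ck_on_2_continuous(1)[OF fde_solD(2)[OF U_sol(1)[OF T] t]] Ck_on_2_continuous(1)[OF fde_solD(2)[OF P0.V_sol t]])+
  have m: "?a \<in> borel_measurable lebesgue" "?b \<in> borel_measurable lebesgue"
    by (rule continuous_measurable_punctured; intro continuous_intros c continuous_Wt)+
  have "(\<integral>\<^sup>+x\<in>-{0}. ennreal (\<bar>U T x t - V0 x t\<bar> * Wt \<nu> x) \<partial>lebesgue) = (\<integral>\<^sup>+x. ?a x + ?b x \<partial>lebesgue)"
  proof (rule nn_integral_cong)
    fix x :: 'a
    have "\<bar>U T x t - V0 x t\<bar> * Wt \<nu> x = max 0 (U T x t - V0 x t) * Wt \<nu> x + max 0 (V0 x t - U T x t) * Wt \<nu> x"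
      by (auto simp: max_def abs_if)
    then show "ennreal (\<bar>U T x t - V0 x t\<bar> * Wt \<nu> x) * indicator (- {0}) x = ?a x + ?b x"
      using Wt_pos[of \<nu> x] by (simp add: less_imp_le distrib_right)
  qed
  also have "\<dots> = (\<integral>\<^sup>+x. ?a x \<partial>lebesgue) + (\<integral>\<^sup>+x. ?b x \<partial>lebesgue)" by (rule nn_integral_add[OF m])
  also have "\<dots> \<le> E T + E T"
  proof (rule add_mono)
    have "(\<integral>\<^sup>+x. ?a x \<partial>lebesgue) \<le> (\<integral>\<^sup>+x\<in>-{0}. ennreal (max 0 (U0 T x - A0 * norm x powr (- \<gamma>)) * Wt \<nu> x) \<partial>lebesgue)"
      by (rule contraction_below[OF P2.profile_axioms U_sol[OF T] P0.V_sol V0_trace, where c=1 and l=1]) (use U_bounds[OF T] t in auto)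
    also have "\<dots> \<le> E T" unfolding E_def using Wt_pos[of \<nu>, where 'a='a]
      by (intro nn_integral_mono mult_right_mono ennreal_leI) (auto simp: less_imp_le)
    finally show "(\<integral>\<^sup>+x. ?a x \<partial>lebesgue) \<le> E T" .
    have "(\<integral>\<^sup>+x. ?b x \<partial>lebesgue) \<le> (\<integral>\<^sup>+x\<in>-{0}. ennreal (max 0 (A0 * norm x powr (- \<gamma>) - U0 T x) * Wt \<nu> x) \<partial>lebesgue)"
      by (rule contraction_below[OF P0.profile_axioms P0.V_sol V0_trace U_sol[OF T], where c=1 and l=1]) (use t in auto)
    also have "\<dots> \<le> E T" unfolding E_def using Wt_pos[of \<nu>, where 'a='a]
      by (intro nn_integral_mono mult_right_mono ennreal_leI) (auto simp: less_imp_le)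
    finally show "(\<integral>\<^sup>+x. ?b x \<partial>lebesgue) \<le> E T" .
  qed
  also have "E T + E T = 2 * E T" by (simp add: mult_2)
  finally show ?thesis .
qed

text \<open>Rescaling turns \<open>E\<close> into an integral of the initial difference against a weight that tends to \<open>0\<close>;
  here \<open>\<gamma> \<ge> n\<close> enters.\<close>

lemma E_tendsto: "((\<lambda>\<tau>. E (exp \<tau>)) \<longlongrightarrow> 0) at_top"
proof -
  define g where "g x = \<bar>u0 x - A0 * norm x powr (- \<gamma>)\<bar>" for x :: 'a
  \<comment> \<open>The maximum with 0 keeps k \<ge> 1 for all \<tau>, so that the initial weighted
    difference is a majorant throughout; for \<tau> \<ge> 0 this is the factor T^(-\<beta>).\<close>
  define k where "k \<tau> = exp (- \<beta> * max 0 \<tau>)" for \<tau>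
  define F where "F \<tau> x = ennreal (g x * Wt \<nu> (k \<tau> *\<^sub>R x)) * indicator (- {0}) x" for \<tau> and x :: 'a
  have k1: "k \<tau> \<ge> 1" for \<tau> unfolding k_def using P0.\<beta> by (simp add: mult_nonpos_nonneg)
  have mg: "(\<lambda>x. indicator (- {0}) x * u0 x) \<in> borel_measurable lebesgue"
    by (rule L1_loc_measurable_punctured) (use u(2) in \<open>simp add: initial_trace_def\<close>)
  have mA: "(\<lambda>x::'a. indicator (- {0}) x * (A0 * norm x powr (- \<gamma>))) \<in> borel_measurable lebesgue"
    by (rule L1_loc_measurable_punctured) (use V0_trace in \<open>simp add: initial_trace_def\<close>)
  have mF: "F \<tau> \<in> borel_measurable lebesgue" for \<tau>
  proof -
    have "(\<lambda>x::'a. Wt \<nu> (k \<tau> *\<^sub>R x)) \<in> borel_measurable borel"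
      by (intro borel_measurable_continuous_onI continuous_on_compose2[OF continuous_Wt[of UNIV]] continuous_intros) auto
    then have mW: "(\<lambda>x::'a. Wt \<nu> (k \<tau> *\<^sub>R x)) \<in> borel_measurable lebesgue"
      by (simp add: measurable_completion)
    have e: "F \<tau> = (\<lambda>x. ennreal (\<bar>indicator (- {0}) x * u0 x - indicator (- {0}) x * (A0 * norm x powr (- \<gamma>))\<bar> * Wt \<nu> (k \<tau> *\<^sub>R x)))"
      by (auto simp: F_def g_def indicator_def)
    show ?thesis unfolding e using mg mA mW by measurable
  qed
  have mono: "F \<tau> x \<le> ennreal (g x * Wt \<nu> x) * indicator (- {0}) x" for \<tau> x
  proof -
    have "norm x \<le> k \<tau> * norm x" using k1[of \<tau>] by (simp add: mult_right_le_one_le mult_le_cancel_right1)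
    then have "(norm x)\<^sup>2 \<le> (norm (k \<tau> *\<^sub>R x))\<^sup>2" using k1[of \<tau>] by (intro power_mono) auto
    then have "Wt \<nu> (k \<tau> *\<^sub>R x) \<le> Wt \<nu> x" unfolding Wt_def using \<nu> by (intro powr_mono2') (auto simp: add_pos_nonneg)
    then show ?thesis unfolding F_def by (intro mult_right_mono ennreal_leI mult_left_mono) (auto simp: g_def)
  qed
  have lim: "((\<lambda>\<tau>. \<integral>\<^sup>+x. F \<tau> x \<partial>lebesgue) \<longlongrightarrow> 0) at_top"
  proof (rule tendsto_at_topI_sequentially)
    fix X :: "nat \<Rightarrow> real" assume X: "filterlim X at_top sequentially"
    have "(\<lambda>j. \<integral>\<^sup>+x. F (X j) x \<partial>lebesgue) \<longlonglongrightarrow> (\<integral>\<^sup>+x. 0 \<partial>(lebesgue :: 'a measure))"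
    proof (rule nn_integral_dominated_convergence[where w="\<lambda>x. ennreal (g x * Wt \<nu> x) * indicator (- {0}) x"])
      show "(\<lambda>x. ennreal (g x * Wt \<nu> x) * indicator (- {0}) x) \<in> borel_measurable lebesgue"
        using mF[of 0] by (simp add: F_def[abs_def] k_def)
      show "(\<integral>\<^sup>+x. ennreal (g x * Wt \<nu> x) * indicator (- {0}) x \<partial>lebesgue) < \<infinity>" using L1 by (simp add: g_def)
      have "(\<lambda>j. F (X j) x) \<longlonglongrightarrow> 0" for x :: 'a
      proof (cases "x = 0")
        case False
        have kl: "filterlim (\<lambda>j. k (X j)) at_top sequentially"
        proof -
          have "filterlim (\<lambda>j. - \<beta> * X j) at_top sequentially"
            using P0.\<beta> by (intro filterlim_tendsto_pos_mult_at_top[OF tendsto_const _ X]) simp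
          then have "filterlim (\<lambda>j. exp (- \<beta> * X j)) at_top sequentially" by (rule filterlim_compose[OF exp_at_top])
          then show ?thesis
            by (rule filterlim_at_top_mono) (use P0.\<beta> in \<open>auto simp: k_def intro!: always_eventually mult_left_mono_neg\<close>)
        qed
        have "(\<lambda>j. (k (X j) * norm x) powr (- (2 * \<nu>))) \<longlonglongrightarrow> 0"
          using False \<nu> by (intro tendsto_neg_powr filterlim_at_top_mult_tendsto_pos[OF tendsto_const _ kl]) auto
        moreover have "Wt \<nu> (k (X j) *\<^sub>R x) \<le> (k (X j) * norm x) powr (- (2 * \<nu>))" for j
        proof -
          have p: "k (X j) * norm x > 0" using k1[of "X j"] False by simp
          then have "Wt \<nu> (k (X j) *\<^sub>R x) \<le> ((k (X j) * norm x)\<^sup>2) powr (- \<nu>)"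
            unfolding Wt_def using \<nu> k1[of "X j"] by (intro powr_mono2') auto
          also have "\<dots> = (k (X j) * norm x) powr (- (2 * \<nu>))" using p by (simp add: powr_powr flip: powr_numeral)
          finally show ?thesis .
        qed
        ultimately have "(\<lambda>j. Wt \<nu> (k (X j) *\<^sub>R x)) \<longlonglongrightarrow> 0"
          by (intro tendsto_sandwich[of "\<lambda>_. 0" "\<lambda>j. Wt \<nu> (k (X j) *\<^sub>R x)"]) (auto simp: less_imp_le[OF Wt_pos])
        then have "(\<lambda>j. ennreal (g x * Wt \<nu> (k (X j) *\<^sub>R x))) \<longlonglongrightarrow> ennreal (g x * 0)" by (intro tendsto_intros)
        then show ?thesis using False by (simp add: F_def)
      qed (simp add: F_def)
      then show "AE x in lebesgue. (\<lambda>j. F (X j) x) \<longlonglongrightarrow> 0" by simp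
    qed (use mF mono in auto)
    then show "(\<lambda>j. \<integral>\<^sup>+x. F (X j) x \<partial>lebesgue) \<longlonglongrightarrow> 0" by simp
  qed
  have "E (exp \<tau>) \<le> (\<integral>\<^sup>+x. F \<tau> x \<partial>lebesgue)" if \<tau>: "\<tau> \<ge> 0" for \<tau>
  proof -
    define T where "T = exp \<tau>"
    have T: "T \<ge> 1" "T > 0" using \<tau> by (auto simp: T_def)
    have kT: "k \<tau> = T powr (- \<beta>)" using \<tau> by (simp add: k_def T_def powr_def)
    let ?s = "T powr \<beta>"
    have s: "?s > 0" using T by simp
    have Fs: "ennreal (\<bar>U0 T x - A0 * norm x powr (- \<gamma>)\<bar> * Wt \<nu> x) * indicator (- {0}) x
        = ennreal (T powr \<alpha>) * F \<tau> (?s *\<^sub>R x)" for x :: 'a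
    proof (cases "x = 0")
      case False
      have "T powr \<alpha> * (A0 * norm (?s *\<^sub>R x) powr (- \<gamma>)) = (T powr \<alpha> * T powr (- \<alpha>)) * (A0 * norm x powr (- \<gamma>))"
        using T by (simp add: powr_mult powr_powr P0.\<alpha>(2) mult.commute[of \<beta>])
      also have "\<dots> = A0 * norm x powr (- \<gamma>)" using T by (simp add: powr_add[symmetric])
      finally have "U0 T x - A0 * norm x powr (- \<gamma>) = T powr \<alpha> * (u0 (?s *\<^sub>R x) - A0 * norm (?s *\<^sub>R x) powr (- \<gamma>))"
        by (simp only: U0_def right_diff_distrib)
      then have "\<bar>U0 T x - A0 * norm x powr (- \<gamma>)\<bar> = T powr \<alpha> * g (?s *\<^sub>R x)"
        by (simp add: g_def abs_mult)
      moreover have "k \<tau> *\<^sub>R ?s *\<^sub>R x = x" unfolding kT using T by (simp add: powr_add[symmetric])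
      ultimately show ?thesis using False T Wt_pos[of \<nu> x]
        by (simp add: F_def ennreal_mult[symmetric] g_def mult.assoc less_imp_le)
    qed (simp add: F_def)
    have "E T = ennreal (T powr \<alpha>) * (\<integral>\<^sup>+x. F \<tau> (?s *\<^sub>R x) \<partial>lebesgue)"
      unfolding E_def Fs by (rule nn_integral_cmult) (rule measurable_compose[OF lebesgue_measurable_scaling mF])
    \<comment> \<open>The amplitude T^\<alpha> = T^(\<beta> \<gamma>) is at most the Jacobian
      T^(\<beta> n), since T \<ge> 1, \<beta> < 0 and \<gamma> \<ge> n. A change of variables then
      removes the scaling.\<close>
    also have "\<dots> \<le> ennreal (?s ^ DIM('a)) * (\<integral>\<^sup>+x. F \<tau> (?s *\<^sub>R x) \<partial>lebesgue)"
    proof (intro mult_right_mono ennreal_leI)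
      have "\<alpha> \<le> \<beta> * real DIM('a)" unfolding P0.\<alpha>(2) using P0.\<gamma>(1) P0.\<beta> by (simp add: mult.commute mult_left_mono_neg)
      then have "T powr \<alpha> \<le> T powr (\<beta> * real DIM('a))" using T by (intro powr_mono) auto
      also have "\<dots> = ?s ^ DIM('a)" using s by (simp add: powr_powr[symmetric] powr_realpow)
      finally show "T powr \<alpha> \<le> ?s ^ DIM('a)" .
    qed simp
    also have "\<dots> = (\<integral>\<^sup>+x. F \<tau> x \<partial>lebesgue)" by (rule nn_integral_scaled[OF s mF, symmetric])
    finally show ?thesis by (simp add: T_def)
  qed
  then have "\<forall>\<^sub>F \<tau> in at_top. E (exp \<tau>) \<le> (\<integral>\<^sup>+x. F \<tau> x \<partial>lebesgue)"
    using eventually_ge_at_top[of 0] by (rule eventually_mono[rotated])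
  then show ?thesis
    by (rule tendsto_sandwich[OF always_eventually[OF allI[OF zero_le]] _ tendsto_const lim])
qed

end

section \<open>Locally uniform convergence\<close>

lemma powr_diff_bounds:
  fixes a b c C m :: real
  assumes m: "0 < m" "m < 1" and c: "0 < c" "c \<le> a" "c \<le> b" "a \<le> C" "b \<le> C"
  shows "\<bar>a powr m / m - b powr m / m\<bar> \<le> c powr (m - 1) * \<bar>a - b\<bar>"
    "\<bar>a - b\<bar> \<le> C powr (1 - m) * \<bar>a powr m / m - b powr m / m\<bar>"
proof -
  have *: "y powr m / m - x powr m / m \<le> c powr (m - 1) * (y - x) \<and> 0 \<le> y powr m / m - x powr m / m \<and>
     y - x \<le> C powr (1 - m) * (y powr m / m - x powr m / m)" if "x < y" "c \<le> x" "y \<le> C" for x y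
  proof -
    have "\<exists>z. x < z \<and> z < y \<and> y powr m / m - x powr m / m = (y - x) * z powr (m - 1)"
    proof (rule MVT2[OF that(1)])
      fix z assume "x \<le> z"
      then have "z > 0" using that c by linarith
      then show "((\<lambda>s. s powr m / m) has_real_derivative z powr (m - 1)) (at z)"
        using DERIV_cdivide[OF has_real_derivative_powr[of z m], of m] m by simp
    qed
    then obtain z where z: "x < z" "z < y" "y powr m / m - x powr m / m = (y - x) * z powr (m - 1)" by blast
    have zc: "c \<le> z" "z \<le> C" "0 < z" using z that c by auto
    have 1: "z powr (m - 1) \<le> c powr (m - 1)" using zc c m by (intro powr_mono2') auto
    have "z powr (1 - m) \<le> C powr (1 - m)" using zc m by (intro powr_mono2) auto
    then have "z powr (1 - m) * z powr (m - 1) \<le> C powr (1 - m) * z powr (m - 1)" by (intro mult_right_mono) auto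
    then have 2: "1 \<le> C powr (1 - m) * z powr (m - 1)" using zc by (simp add: powr_add[symmetric])
    have "(y - x) * z powr (m - 1) \<le> (y - x) * c powr (m - 1)" using 1 that by (intro mult_left_mono) auto
    moreover have "(y - x) * 1 \<le> (y - x) * (C powr (1 - m) * z powr (m - 1))" using 2 that by (intro mult_left_mono) auto
    ultimately show ?thesis unfolding z(3) using that by (simp add: mult_ac)
  qed
  show "\<bar>a powr m / m - b powr m / m\<bar> \<le> c powr (m - 1) * \<bar>a - b\<bar>"
    "\<bar>a - b\<bar> \<le> C powr (1 - m) * \<bar>a powr m / m - b powr m / m\<bar>"
    using *[of a b] *[of b a] c by (cases a b rule: linorder_cases; simp add: abs_minus_commute)+
qed

lemma compact_positive_lower_bound:
  fixes g :: "'a::topological_space \<Rightarrow> real"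
  assumes "compact S" "continuous_on S g" "\<And>x. x \<in> S \<Longrightarrow> g x > 0"
  obtains c where "c > 0" "\<And>x. x \<in> S \<Longrightarrow> c \<le> g x"
proof (cases "S = {}")
  case False
  then obtain x where "x \<in> S" "\<forall>y\<in>S. g x \<le> g y" using continuous_attains_inf assms by blast
  then show ?thesis using that[of "g x"] assms(3) by auto
qed (use that[of 1] in auto)

lemma compact_upper_bound:
  fixes g :: "'a::topological_space \<Rightarrow> real"
  assumes "compact S" "continuous_on S g"
  obtains C where "C > 0" "\<And>x. x \<in> S \<Longrightarrow> g x \<le> C"
proof (cases "S = {}")
  case False
  then obtain x where "x \<in> S" "\<forall>y\<in>S. g y \<le> g x" using continuous_attains_sup assms by blast
  then show ?thesis using that[of "max 1 (g x)"] by (auto simp: le_max_iff_disj)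
qed (use that[of 1] in auto)

context asym begin

abbreviation "pr a \<equiv> a powr m / m"

text \<open>On \<open>S\<close> all solutions lie between c and C, so the difference of values is at
  most 2 C. The kernel average is controlled by the weighted distance, since powers are Lipschitz
  there with constant c^(m - 1), the kernel is at most 6 r^(-n) and the weight is at least
  wm.\<close>

lemma average_bound:
  assumes T: "T > 0" and r: "r > 0" "cball x (2 * r) \<subseteq> S" "S \<subseteq> - {0}" and c: "c > 0" "wm > 0"
    and S: "\<And>y t. y \<in> S \<Longrightarrow> t \<in> {1/2..2} \<Longrightarrow> c \<le> V0 y t \<and> c \<le> V1 y t \<and> V0 y t \<le> C \<and> V2 y t \<le> C"
    and W: "\<And>y. y \<in> S \<Longrightarrow> wm \<le> Wt \<nu> y"
    and ab: "1/2 \<le> a" "a \<le> b" "b \<le> 2" and e: "2 * E T \<le> ennreal e" "e \<ge> 0"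
  shows "3 / 2 ^ DIM('a) * measure lborel (cball (0::'a) 1) * \<bar>integral {a..b} (\<lambda>t. pr (U T x t) - pr (V0 x t))\<bar>
    \<le> (b - a) * (6 * r powr (- real DIM('a)) * c powr (m - 1) / wm * e) + 2 * C * measure lborel (cball (0::'a) 1) * r\<^sup>2"
proof (rule mean_value_estimate[OF P0.m(1) U_sol(1)[OF T] P0.V_sol _ ab(2) r(1)])
  show "0 < a" using ab by simp
  show "cball x (2 * r) \<subseteq> - {0}" by (rule order_trans[OF r(2,3)])
  have sub: "y \<in> S" if "y \<in> cball x r" for y using that r by auto
  have UV: "c \<le> U T y t \<and> U T y t \<le> C \<and> c \<le> V0 y t \<and> V0 y t \<le> C" if "y \<in> S" "t \<in> {1/2..2}" for y t
  proof -
    have "y \<noteq> 0" "t > 0" using that r(3) by auto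
    from U_bounds[OF T this] S[OF that] show ?thesis by linarith
  qed
  show "\<bar>U T y b - V0 y b - (U T y a - V0 y a)\<bar> \<le> 2 * C" if "y \<in> cball x r" for y
    using UV[OF sub[OF that], of a] UV[OF sub[OF that], of b] ab c by auto
  fix t assume "t \<in> {a..b}"
  then have t: "t \<in> {1/2..2}" "t > 0" using ab by auto
  let ?k = "6 * r powr (- real DIM('a)) * c powr (m - 1) / wm"
  let ?h = "\<lambda>y. indicator (cball x r) y * (\<bar>U T y t - V0 y t\<bar> * Wt \<nu> y)"
  have cs: "cball x r \<subseteq> - {0}" using sub r(3) by auto
  have cU: "continuous_on (- {0}) (\<lambda>x. U T x t)" and cV: "continuous_on (- {0}) (\<lambda>x. V0 x t)"
    by (rule Ck_on_2_continuous(1)[OF fde_solD(2)[OF U_sol(1)[OF T] t(2)]] Ck_on_2_continuous(1)[OF fde_solD(2)[OF P0.V_sol t(2)]])+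
  have cpU: "continuous_on (- {0}) (\<lambda>x. pr (U T x t))" and cpV: "continuous_on (- {0}) (\<lambda>x. pr (V0 x t))"
    by (rule Ck_on_2_continuous(1)[OF fde_sol_power[OF U_sol(1)[OF T] t(2) P0.m(1)]] Ck_on_2_continuous(1)[OF fde_sol_power[OF P0.V_sol t(2) P0.m(1)]])+
  have "continuous_on (cball x r) (\<lambda>y. \<bar>U T y t - V0 y t\<bar> * Wt \<nu> y)"
    by (intro continuous_intros continuous_on_subset[OF cU cs] continuous_on_subset[OF cV cs] continuous_Wt)
  from borel_integrable_compact[OF compact_cball this] have hi: "integrable lborel ?h" by simp
  have he: "(\<integral>y. ?h y \<partial>lborel) \<le> e"
  proof -
    have "ennreal (\<integral>y. ?h y \<partial>lborel) = (\<integral>\<^sup>+y. ennreal (?h y) \<partial>lebesgue)"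
      using Wt_pos[of \<nu>, where 'a='a]
      by (intro nn_integral_lebesgue_eq_integral[symmetric] hi mult_nonneg_nonneg) (auto simp: less_imp_le)
    also have "\<dots> \<le> (\<integral>\<^sup>+y\<in>-{0}. ennreal (\<bar>U T y t - V0 y t\<bar> * Wt \<nu> y) \<partial>lebesgue)"
      using cs by (intro nn_integral_mono) (auto simp: indicator_def)
    also have "\<dots> \<le> ennreal e" using distance_bound[OF T t(2)] e(1) by (rule order_trans)
    finally show ?thesis using e(2) by simp
  qed
  have ki: "integrable lborel (\<lambda>y. \<bar>(pr (U T y t) - pr (V0 y t)) * avg_kernel x r y\<bar>)"
  proof (rule integrable_compact_support[OF compact_cball[of x r]])
    have "continuous_on (cball x r) (avg_kernel x r)" unfolding avg_kernel_def using r by (intro continuous_intros) auto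
    then show "continuous_on (cball x r) (\<lambda>y. \<bar>(pr (U T y t) - pr (V0 y t)) * avg_kernel x r y\<bar>)"
      by (intro continuous_intros continuous_on_subset[OF cpU cs] continuous_on_subset[OF cpV cs])
  qed (simp add: kernel_outside[OF r(1)])
  have "\<bar>\<integral>y. (pr (U T y t) - pr (V0 y t)) * avg_kernel x r y \<partial>lborel\<bar>
     \<le> (\<integral>y. \<bar>(pr (U T y t) - pr (V0 y t)) * avg_kernel x r y\<bar> \<partial>lborel)" by (rule integral_abs_bound)
  also have "\<dots> \<le> (\<integral>y. ?k * ?h y \<partial>lborel)"
  proof (rule integral_mono[OF ki integrable_mult_right])
    show "integrable lborel ?h" by (rule hi)
    fix y
    show "\<bar>(pr (U T y t) - pr (V0 y t)) * avg_kernel x r y\<bar> \<le> ?k * ?h y"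
    proof (cases "y \<in> cball x r")
      case True
      have "\<bar>pr (U T y t) - pr (V0 y t)\<bar> \<le> c powr (m - 1) * \<bar>U T y t - V0 y t\<bar>"
        using UV[OF sub[OF True] t(1)] c by (intro powr_diff_bounds(1)[OF P0.m]) auto
      moreover have "avg_kernel x r y \<le> 6 * r powr (- real DIM('a))" using kernel_bounds(4)[OF r(1), of x y] True by simp
      ultimately have "\<bar>pr (U T y t) - pr (V0 y t)\<bar> * avg_kernel x r y
          \<le> (c powr (m - 1) * \<bar>U T y t - V0 y t\<bar>) * (6 * r powr (- real DIM('a)))"
        using kernel_bounds(3)[OF r(1)] by (intro mult_mono) auto
      also have "\<dots> \<le> (c powr (m - 1) * \<bar>U T y t - V0 y t\<bar>) * (6 * r powr (- real DIM('a))) * (Wt \<nu> y / wm)"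
      proof -
        have "1 \<le> Wt \<nu> y / wm" using W[OF sub[OF True]] c by simp
        moreover have "0 \<le> (c powr (m - 1) * \<bar>U T y t - V0 y t\<bar>) * (6 * r powr (- real DIM('a)))" by simp
        ultimately show ?thesis using mult_left_mono by fastforce
      qed
      finally show ?thesis using True kernel_bounds(3)[OF r(1), of x y] by (simp add: abs_mult mult_ac)
    qed (simp add: kernel_outside[OF r(1)])
  qed
  also have "\<dots> = ?k * (\<integral>y. ?h y \<partial>lborel)" by simp
  also have "\<dots> \<le> ?k * e" using he c by (intro mult_left_mono) auto
  finally show "\<bar>\<integral>y. (pr (U T y t) - pr (V0 y t)) * avg_kernel x r y \<partial>lborel\<bar> \<le> ?k * e" .
qed

lemma pr_continuous:
  assumes "fde_sol m w" "x \<noteq> 0" "a > 0"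
  shows "(\<lambda>t. pr (w x t)) integrable_on {a..b}"
proof (rule integrable_continuous_real)
  have "continuous_on {a..b} (w x)"
    using fde_solD(3)[OF assms(1,2)] assms(3)
    by (intro continuous_at_imp_continuous_on ballI DERIV_isCont) (auto intro: less_le_trans)
  moreover have "w x t \<noteq> 0" if "t \<in> {a..b}" for t
    using fde_solD(1)[OF assms(1,2), of t] assms(3) that by auto
  ultimately show "continuous_on {a..b} (\<lambda>t. pr (w x t))"
    using P0.m by (intro continuous_intros) auto
qed

text \<open>One factor q serves both sides of time 1: for t before 1 the ratio is 1/t, for t after 1
  it is t \<le> 1 + \<delta>, and both are at most 1 / (1 - \<delta>). The exponent m / (1 - m) is
  that of \<open>time_monotone\<close> raised to the power m.\<close>

lemma pinch:
  assumes T: "T > 0" and x: "x \<noteq> 0" and \<delta>: "0 < \<delta>" "\<delta> < 1" and q: "q = (1 / (1 - \<delta>)) powr (m / (1 - m))"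
    and osc: "\<And>s. \<bar>s - 1\<bar> \<le> \<delta> \<Longrightarrow> \<bar>pr (V0 x s) - pr (V0 x 1)\<bar> \<le> e"
    and av: "\<bar>integral {1 - \<delta>..1} (\<lambda>t. pr (U T x t) - pr (V0 x t))\<bar> \<le> \<delta> * e"
      "\<bar>integral {1..1 + \<delta>} (\<lambda>t. pr (U T x t) - pr (V0 x t))\<bar> \<le> \<delta> * e"
  shows "\<bar>pr (U T x 1) - pr (V0 x 1)\<bar> \<le> (q - 1) * pr (V0 x 1) + 2 * q * e"
proof -
  let ?G = "pr (U T x 1)" and ?F = "pr (V0 x 1)"
  have s: "m / (1 - m) \<ge> 0" using P0.m by simp
  have d1: "1 / (1 - \<delta>) \<ge> 1" using \<delta> by (simp add: field_simps)
  have q1: "q \<ge> 1" unfolding q using s d1 by (rule ge_one_powr_ge_zero[rotated])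
  have e0: "e \<ge> 0" using osc[of 1] \<delta> by simp
  have step: "pr (U T x (k * t)) \<le> q * pr (U T x t)" if "1 \<le> k" "k \<le> 1 / (1 - \<delta>)" "t > 0" for k t
  proof -
    have Up: "U T x (k * t) > 0" "U T x t > 0" using U_bounds(3)[OF T x] that by auto
    have "U T x (k * t) powr m \<le> (k powr (1 / (1 - m)) * U T x t) powr m"
      using time_monotone[OF T x that(1,3)] Up P0.m by (intro powr_mono2) auto
    also have "\<dots> = k powr (m / (1 - m)) * U T x t powr m" using that Up by (simp add: powr_mult powr_powr)
    also have "\<dots> \<le> q * U T x t powr m" unfolding q using that s by (intro mult_right_mono powr_mono2) auto
    finally show ?thesis using P0.m by (simp add: divide_right_mono)
  qed
  note iU = pr_continuous[OF U_sol(1)[OF T] x] and iV = pr_continuous[OF P0.V_sol x]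
  have V: "integral {a..b} (\<lambda>t. pr (V0 x t)) \<le> (b - a) * (?F + e)" "(b - a) * (?F - e) \<le> integral {a..b} (\<lambda>t. pr (V0 x t))"
    if "0 < a" "a \<le> b" "\<And>t. t \<in> {a..b} \<Longrightarrow> \<bar>t - 1\<bar> \<le> \<delta>" for a b
  proof -
    have "integral {a..b} (\<lambda>t. pr (V0 x t)) \<le> integral {a..b} (\<lambda>_. ?F + e)"
    proof (rule integral_le[OF iV[OF that(1)]])
      fix t assume "t \<in> {a..b}" then show "pr (V0 x t) \<le> ?F + e" using osc[OF that(3)] by fastforce
    qed (rule integrable_const_ivl)
    then show "integral {a..b} (\<lambda>t. pr (V0 x t)) \<le> (b - a) * (?F + e)" using that by simp
    have "integral {a..b} (\<lambda>_. ?F - e) \<le> integral {a..b} (\<lambda>t. pr (V0 x t))"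
    proof (rule integral_le[OF _ iV[OF that(1)]])
      fix t assume "t \<in> {a..b}" then show "?F - e \<le> pr (V0 x t)" using osc[OF that(3)] by fastforce
    qed (rule integrable_const_ivl)
    then show "(b - a) * (?F - e) \<le> integral {a..b} (\<lambda>t. pr (V0 x t))" using that by simp
  qed
  have split: "integral {a..b} (\<lambda>t. pr (U T x t)) = integral {a..b} (\<lambda>t. pr (U T x t) - pr (V0 x t)) + integral {a..b} (\<lambda>t. pr (V0 x t))"
    if "0 < a" for a b
    using Henstock_Kurzweil_Integration.integral_diff[OF iU[OF that] iV[OF that]] by simp
  have up: "?G \<le> q * (?F + 2 * e)"
  proof -
    have "integral {1 - \<delta>..1} (\<lambda>_. ?G / q) \<le> integral {1 - \<delta>..1} (\<lambda>t. pr (U T x t))"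
    proof (rule integral_le[OF _ iU])
      fix t assume t: "t \<in> {1 - \<delta>..1}"
      then have "1 \<le> 1 / t" "1 / t \<le> 1 / (1 - \<delta>)" "t > 0" using \<delta> by (auto simp: divide_simps)
      from step[OF this] have "?G \<le> q * pr (U T x t)" using t \<delta> by simp
      then show "?G / q \<le> pr (U T x t)"
        using q1 by (subst pos_divide_le_eq) (linarith, simp only: mult.commute)
    qed (use \<delta> in \<open>auto intro: integrable_const_ivl\<close>)
    also have "\<dots> \<le> \<delta> * e + \<delta> * (?F + e)"
      using split[of "1 - \<delta>" 1] av(1) V(1)[of "1 - \<delta>" 1] \<delta> by (smt (verit) atLeastAtMost_iff)
    also have "\<dots> = \<delta> * (?F + 2 * e)" by (simp add: algebra_simps)
    finally have "\<delta> * (?G / q) \<le> \<delta> * (?F + 2 * e)" using \<delta> by simp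
    then have "?G / q \<le> ?F + 2 * e" by (simp only: mult_le_cancel_left_pos[OF \<delta>(1)])
    moreover have "q > 0" using q1 by linarith
    ultimately show ?thesis by (simp only: pos_divide_le_eq mult.commute)
  qed
  have low: "?F - 2 * e \<le> q * ?G"
  proof -
    have "\<delta> * (?F - 2 * e) = \<delta> * (?F - e) - \<delta> * e" by (simp add: algebra_simps)
    also have "\<dots> \<le> integral {1..1 + \<delta>} (\<lambda>t. pr (U T x t))"
      using split[of 1 "1 + \<delta>"] av(2) V(2)[of 1 "1 + \<delta>"] \<delta> by (smt (verit) atLeastAtMost_iff)
    also have "\<dots> \<le> integral {1..1 + \<delta>} (\<lambda>_. q * ?G)"
    proof (rule integral_le[OF iU])
      fix t assume t: "t \<in> {1..1 + \<delta>}"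
      have "(1 + \<delta>) * (1 - \<delta>) \<le> 1" by (simp add: algebra_simps)
      then have "1 + \<delta> \<le> 1 / (1 - \<delta>)" using \<delta> by (simp add: field_simps)
      then show "pr (U T x t) \<le> q * ?G" using step[of t 1] t by simp
    qed (auto intro: integrable_const_ivl)
    also have "\<dots> = \<delta> * (q * ?G)" using \<delta> by simp
    finally show ?thesis by (simp only: mult_le_cancel_left_pos[OF \<delta>(1)])
  qed
  have "\<bar>G - F\<bar> \<le> (q - 1) * F + 2 * q * e" if "G \<le> q * (F + 2 * e)" "F - 2 * e \<le> q * G" "F \<ge> 0" for F G :: real
  proof -
    have "G - F \<le> (q - 1) * F + 2 * q * e" using that(1) by (simp add: algebra_simps)
    moreover have "q * (F - G) \<le> (q - 1) * F + 2 * e" using that(2) by (simp add: algebra_simps)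
    moreover have "0 \<le> (q - 1) * F" "e \<le> q * e" using q1 that(3) e0 by (simp_all add: mult_le_cancel_right1)
    moreover have "0 \<le> F - G \<Longrightarrow> F - G \<le> q * (F - G)" using q1 mult_right_mono[of 1 q "F - G"] by simp
    ultimately show ?thesis by linarith
  qed
  from this[OF up low] show ?thesis using P0.m by simp
qed

text \<open>The order of choices is forced. The time step \<delta> makes q close to 1 and the
  oscillation of \<open>V0\<close> small, then r makes the error of order r^2 small against
  \<delta>, and only then is T taken large, because the kernel multiplies the weighted distance by
  r^(-n).\<close>

lemma uniform_convergence:
  assumes K: "compact K" "K \<subseteq> - {0}" and \<epsilon>: "\<epsilon> > 0"
  shows "\<forall>\<^sub>F \<tau> in at_top. \<forall>x\<in>K. \<bar>U (exp \<tau>) x 1 - V0 x 1\<bar> < \<epsilon>"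
proof -
  let ?n = "real DIM('a)"
  obtain d where d: "d > 0" "\<And>x. x \<in> K \<Longrightarrow> d \<le> norm x"
  proof -
    have "0 \<notin> K" using K by auto
    then obtain d where "d > 0" "\<forall>x\<in>K. d \<le> dist 0 x"
      using separate_point_closed[OF compact_imp_closed[OF K(1)]] by blast
    then show ?thesis using that[of d] by simp
  qed
  obtain R where R: "R > 0" "\<And>x. x \<in> K \<Longrightarrow> norm x \<le> R"
    using compact_imp_bounded[OF K(1)] by (auto simp: bounded_pos)
  \<comment> \<open>Because \<open>cut_shell\<close> doubles its second parameter, this is the shell
    d / 2 \<le> |x| \<le> R + d, which contains the balls of radius d / 2 around the points of
    \<open>K\<close>.\<close>
  define S where "S = (cut_shell (d / 2) ((R + d) / 2) :: 'a set)"
  have S: "compact S" "S \<subseteq> - {0}"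
    unfolding S_def by (rule compact_cut_shell, rule cut_shell_subset) (use d in simp)
  have KS: "cball x (2 * r) \<subseteq> S" if "x \<in> K" "r \<le> d / 4" for x r
  proof
    fix y assume "y \<in> cball x (2 * r)"
    then have "norm (y - x) \<le> d / 2" using that by (simp add: dist_norm norm_minus_commute)
    then show "y \<in> S" unfolding S_def cut_shell_def
      using d(2)[OF that(1)] R(2)[OF that(1)] norm_triangle_ineq2[of x y] norm_triangle_ineq2[of y x] d(1)
      by (auto simp: norm_minus_commute)
  qed
  have Q: "compact (S \<times> {1/2..2::real})" "S \<times> {1/2..2::real} \<subseteq> (- {0}) \<times> {0<..}"
    using S by (auto intro!: compact_Times)
  note cV0 = continuous_on_subset[OF fde_solD(4)[OF P0.V_sol] Q(2)]
    and cV1 = continuous_on_subset[OF fde_solD(4)[OF P1.V_sol] Q(2)]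
    and cV2 = continuous_on_subset[OF fde_solD(4)[OF P2.V_sol] Q(2)]
  obtain c0 where c0: "c0 > 0" "\<And>z. z \<in> S \<times> {1/2..2} \<Longrightarrow> c0 \<le> (case z of (x, t) \<Rightarrow> V0 x t)"
    by (rule compact_positive_lower_bound[OF Q(1) cV0]) (use S P0.V_pos in \<open>auto simp: subset_eq\<close>)
  obtain c1 where c1: "c1 > 0" "\<And>z. z \<in> S \<times> {1/2..2} \<Longrightarrow> c1 \<le> (case z of (x, t) \<Rightarrow> V1 x t)"
    by (rule compact_positive_lower_bound[OF Q(1) cV1]) (use S P1.V_pos in \<open>auto simp: subset_eq\<close>)
  obtain C0 where C0: "C0 > 0" "\<And>z. z \<in> S \<times> {1/2..2} \<Longrightarrow> (case z of (x, t) \<Rightarrow> V0 x t) \<le> C0"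
    by (rule compact_upper_bound[OF Q(1) cV0]) blast
  obtain C2 where C2: "C2 > 0" "\<And>z. z \<in> S \<times> {1/2..2} \<Longrightarrow> (case z of (x, t) \<Rightarrow> V2 x t) \<le> C2"
    by (rule compact_upper_bound[OF Q(1) cV2]) blast
  obtain wm where wm: "wm > 0" "\<And>y. y \<in> S \<Longrightarrow> wm \<le> Wt \<nu> y"
    by (rule compact_positive_lower_bound[OF S(1) continuous_Wt Wt_pos]) blast
  define c where "c = min c0 c1"
  define C where "C = max C0 C2"
  have c: "c > 0" and C: "C > 0" using c0 c1 C0 by (auto simp: c_def C_def)
  have SV: "c \<le> V0 y t \<and> c \<le> V1 y t \<and> V0 y t \<le> C \<and> V2 y t \<le> C" if "y \<in> S" "t \<in> {1/2..2}" for y t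
    using c0(2)[of "(y, t)"] c1(2)[of "(y, t)"] C0(2)[of "(y, t)"] C2(2)[of "(y, t)"] that by (auto simp: c_def C_def)
  define Pm where "Pm = pr C"
  have Pm: "Pm > 0" using C P0.m by (simp add: Pm_def)
  \<comment> \<open>The pinching costs 5 \<epsilon>' for the powers, and C^(1 - m) is the price for
    returning to the functions; 6 leaves room for a strict inequality.\<close>
  define \<epsilon>' where "\<epsilon>' = \<epsilon> / (6 * C powr (1 - m))"
  have \<epsilon>': "\<epsilon>' > 0" using \<epsilon> C by (simp add: \<epsilon>'_def)
  define \<omega> where "\<omega> = measure lborel (cball (0::'a) 1)"
  have \<omega>: "\<omega> > 0" unfolding \<omega>_def by (rule content_cball_pos) simp
  \<comment> \<open>The inverse of the constant in front of the mean value estimate.\<close>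
  define C1 where "C1 = 2 ^ DIM('a) / (3 * \<omega>)"
  have C1: "C1 > 0" using \<omega> by (simp add: C1_def)
  have KS': "K \<subseteq> S" using KS[of _ 0] d by force
  have "uniformly_continuous_on (K \<times> {1/2..2}) (\<lambda>(x, t). pr (V0 x t))"
  proof (rule compact_uniformly_continuous)
    have "continuous_on (K \<times> {1/2..2}) (\<lambda>(x, t). V0 x t)" by (rule continuous_on_subset[OF cV0]) (use KS' in auto)
    moreover have "V0 (fst z) (snd z) \<noteq> 0" if "z \<in> K \<times> {1/2..2}" for z
    proof -
      have "fst z \<noteq> 0" "snd z > 0" using that K by auto
      from P0.V_pos[OF this] show ?thesis by simp
    qed
    ultimately show "continuous_on (K \<times> {1/2..2}) (\<lambda>(x, t). pr (V0 x t))"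
      unfolding split_beta using P0.m by (intro continuous_intros) auto
  qed (use K in \<open>auto intro: compact_Times\<close>)
  then obtain du where du: "du > 0" "\<And>z z'. z \<in> K \<times> {1/2..2} \<Longrightarrow> z' \<in> K \<times> {1/2..2} \<Longrightarrow> dist z' z < du \<Longrightarrow>
      dist (case z' of (x, t) \<Rightarrow> pr (V0 x t)) (case z of (x, t) \<Rightarrow> pr (V0 x t)) < \<epsilon>'"
    using \<epsilon>' unfolding uniformly_continuous_on_def by metis
  \<comment> \<open>The bound 1 in the minimum yields q < 2; the other one makes q - 1, times the
    largest power \<open>Pm\<close>, less than \<epsilon>'.\<close>
  have "\<forall>\<^sub>F \<delta> in at_right 0. (1 / (1 - \<delta>)) powr (m / (1 - m)) < 1 + min 1 (\<epsilon>' / Pm)"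
  proof (rule order_tendstoD(2))
    have "((\<lambda>\<delta>::real. (1 / (1 - \<delta>)) powr (m / (1 - m))) \<longlongrightarrow> (1 / (1 - 0)) powr (m / (1 - m))) (at_right 0)"
      by (intro tendsto_intros) auto
    then show "((\<lambda>\<delta>::real. (1 / (1 - \<delta>)) powr (m / (1 - m))) \<longlongrightarrow> 1) (at_right 0)" by simp
  qed (use \<epsilon>' Pm in simp)
  moreover have "\<forall>\<^sub>F \<delta> in at_right 0. \<delta> < min (1/2) du"
    using du(1) by (auto simp: eventually_at_right[of 0 1] intro!: exI[of _ "min (1/2) du"])
  moreover have "\<forall>\<^sub>F \<delta> in at_right (0::real). 0 < \<delta>" by (rule eventually_at_right_less)
  ultimately have "\<forall>\<^sub>F \<delta> in at_right 0. (1 / (1 - \<delta>)) powr (m / (1 - m)) < 1 + min 1 (\<epsilon>' / Pm) \<and> \<delta> < min (1/2) du \<and> 0 < \<delta>"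
    by eventually_elim simp
  then obtain \<delta> where \<delta>: "(1 / (1 - \<delta>)) powr (m / (1 - m)) < 1 + min 1 (\<epsilon>' / Pm)" "\<delta> < 1/2" "\<delta> < du" "0 < \<delta>"
    using eventually_happens'[OF trivial_limit_at_right_real] by fastforce
  define q where "q = (1 / (1 - \<delta>)) powr (m / (1 - m))"
  have "q - 1 < \<epsilon>' / Pm" "q < 2" using \<delta>(1) by (auto simp: q_def[symmetric])
  then have q: "q < 2" "(q - 1) * Pm < \<epsilon>'" using Pm by (simp_all add: pos_less_divide_eq)
  \<comment> \<open>The bound d / 4 keeps the doubled balls inside \<open>S\<close>, 1 gives r^2
    \<le> r, and the last entry limits the Laplacian error to half of \<delta> \<epsilon>'.\<close>
  define r where "r = min (d / 4) (min 1 (\<epsilon>' * \<delta> / (4 * C1 * C * \<omega>)))"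
  have r: "0 < r" "r \<le> d / 4" "r \<le> 1" "r \<le> \<epsilon>' * \<delta> / (4 * C1 * C * \<omega>)"
    using d \<epsilon>' \<delta> C1 C \<omega> by (auto simp: r_def)
  have rr: "C1 * (2 * C * \<omega> * r\<^sup>2) \<le> \<delta> * \<epsilon>' / 2"
  proof -
    have "r\<^sup>2 \<le> r" using r by (simp add: power2_eq_square mult_left_le)
    then have "r\<^sup>2 \<le> \<epsilon>' * \<delta> / (4 * C1 * C * \<omega>)" using r by linarith
    then show ?thesis using C1 C \<omega> by (simp add: field_simps)
  qed
  define \<kappa> where "\<kappa> = 6 * r powr (- ?n) * c powr (m - 1) / wm"
  have \<kappa>: "\<kappa> > 0" using r c wm by (simp add: \<kappa>_def)
  \<comment> \<open>With this bound on the weighted distance, the kernel average takes the other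
    half of \<delta> \<epsilon>'.\<close>
  define e where "e = \<epsilon>' / (2 * C1 * \<kappa>)"
  have e: "e > 0" using \<epsilon>' C1 \<kappa> by (simp add: e_def)
  have "((\<lambda>\<tau>. 2 * E (exp \<tau>)) \<longlongrightarrow> 2 * 0) at_top" by (intro ennreal_tendsto_cmult E_tendsto) simp
  then have "\<forall>\<^sub>F \<tau> in at_top. 2 * E (exp \<tau>) < ennreal e" using e by (intro order_tendstoD(2)) auto
  then show ?thesis
  proof eventually_elim
    case (elim \<tau>)
    define T where "T = exp \<tau>"
    have T: "T > 0" by (simp add: T_def)
    have eT: "2 * E T \<le> ennreal e" using elim by (simp add: T_def)
    have "\<bar>U T x 1 - V0 x 1\<bar> < \<epsilon>" if x: "x \<in> K" for x
    proof -
      have x0: "x \<noteq> 0" using x K by auto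
      have av: "\<bar>integral {a..b} (\<lambda>t. pr (U T x t) - pr (V0 x t))\<bar> \<le> \<delta> * \<epsilon>'" if "1/2 \<le> a" "b \<le> 2" "b - a = \<delta>" for a b
      proof -
        let ?I = "\<bar>integral {a..b} (\<lambda>t. pr (U T x t) - pr (V0 x t))\<bar>"
        have "3 / 2 ^ DIM('a) * \<omega> * ?I \<le> (b - a) * (\<kappa> * e) + 2 * C * \<omega> * r\<^sup>2"
          unfolding \<omega>_def \<kappa>_def
          by (rule average_bound[OF T r(1) KS[OF x r(2)] S(2) c wm(1) SV wm(2) that(1) _ that(2) eT]) (use that \<delta> e in auto)
        then have "C1 * (3 / 2 ^ DIM('a) * \<omega> * ?I) \<le> C1 * ((b - a) * (\<kappa> * e) + 2 * C * \<omega> * r\<^sup>2)"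
          using C1 by (intro mult_left_mono) auto
        moreover have "C1 * (3 / 2 ^ DIM('a) * \<omega> * ?I) = ?I" using \<omega> by (simp add: C1_def)
        moreover have "C1 * ((b - a) * (\<kappa> * e)) = \<delta> * \<epsilon>' / 2" using C1 \<kappa> that by (simp add: e_def)
        ultimately show ?thesis using rr by (simp add: distrib_left)
      qed
      have "\<bar>pr (U T x 1) - pr (V0 x 1)\<bar> \<le> (q - 1) * pr (V0 x 1) + 2 * q * \<epsilon>'"
      proof (rule pinch[OF T x0 \<delta>(4) _ q_def])
        fix s assume "\<bar>s - 1\<bar> \<le> \<delta>"
        then have "dist (x, s) (x, 1) < du" "s \<in> {1/2..2}" using \<delta> by (auto simp: dist_Pair_Pair dist_real_def abs_le_iff)
        then show "\<bar>pr (V0 x s) - pr (V0 x 1)\<bar> \<le> \<epsilon>'"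
          using du(2)[of "(x, 1)" "(x, s)"] x by (auto simp: dist_real_def)
      qed (use \<delta> av[of "1 - \<delta>" 1] av[of 1 "1 + \<delta>"] in auto)
      also have "\<dots> \<le> \<epsilon>' + 2 * 2 * \<epsilon>'"
      proof (intro add_mono mult_right_mono mult_left_mono)
        have xS: "x \<in> S" using x KS' by auto
        have "pr (V0 x 1) \<le> Pm" unfolding Pm_def using SV[OF xS, of 1] c P0.m by (intro divide_right_mono powr_mono2) auto
        moreover have "1 \<le> q" unfolding q_def using \<delta> P0.m by (intro ge_one_powr_ge_zero) (auto simp: field_simps)
        ultimately have "(q - 1) * pr (V0 x 1) \<le> (q - 1) * Pm" by (intro mult_left_mono) auto
        then show "(q - 1) * pr (V0 x 1) \<le> \<epsilon>'" using q(2) by linarith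
      qed (use q \<epsilon>' in auto)
      finally have p5: "\<bar>pr (U T x 1) - pr (V0 x 1)\<bar> \<le> 5 * \<epsilon>'" by simp
      have xS: "x \<in> S" using x KS' by auto
      have "\<bar>U T x 1 - V0 x 1\<bar> \<le> C powr (1 - m) * \<bar>pr (U T x 1) - pr (V0 x 1)\<bar>"
        using SV[OF xS, of 1] U_bounds[OF T x0, of 1] by (intro powr_diff_bounds(2)[OF P0.m c]) auto
      also have "\<dots> \<le> C powr (1 - m) * (5 * \<epsilon>')" using p5 by (intro mult_left_mono) auto
      also have "\<dots> < \<epsilon>" using \<epsilon> C by (simp add: \<epsilon>'_def)
      finally show ?thesis .
    qed
    then show ?case by (simp add: T_def)
  qed
qed

end

text \<open>The return from \<open>Wt\<close> to a weight that it dominates: the norm is at most 2 c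
  \<open>E\<close>, and \<open>E\<close> tends to 0.\<close>

lemma (in asym) weighted_convergence:
  assumes w: "c > 0" "\<And>x. w x \<le> c * Wt \<nu> x"
  shows "((\<lambda>\<tau>. L1_norm_weighted w (- {0}) (\<lambda>y. U (exp \<tau>) y 1 - V0 y 1)) \<longlongrightarrow> 0) at_top"
proof -
  have le: "L1_norm_weighted w (- {0}) (\<lambda>y. U (exp \<tau>) y 1 - V0 y 1) \<le> ennreal c * (2 * E (exp \<tau>))" for \<tau>
  proof -
    let ?g = "\<lambda>y. ennreal (\<bar>U (exp \<tau>) y 1 - V0 y 1\<bar> * Wt \<nu> y) * indicator (- {0}) y"
    have "L1_norm_weighted w (- {0}) (\<lambda>y. U (exp \<tau>) y 1 - V0 y 1) \<le> (\<integral>\<^sup>+y. ennreal c * ?g y \<partial>lebesgue)"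
      unfolding L1_norm_weighted_def
    proof (rule nn_integral_mono)
      fix y :: 'a
      have "\<bar>U (exp \<tau>) y 1 - V0 y 1\<bar> * w y \<le> c * (\<bar>U (exp \<tau>) y 1 - V0 y 1\<bar> * Wt \<nu> y)"
        using mult_left_mono[OF w(2)[of y], of "\<bar>U (exp \<tau>) y 1 - V0 y 1\<bar>"] by (simp add: mult_ac)
      then show "ennreal (\<bar>U (exp \<tau>) y 1 - V0 y 1\<bar> * w y) * indicator (- {0}) y \<le> ennreal c * ?g y"
        using w(1) by (simp add: ennreal_mult'[symmetric] ennreal_leI mult.assoc[symmetric] mult_right_mono)
    qed
    also have "\<dots> = ennreal c * (\<integral>\<^sup>+y. ?g y \<partial>lebesgue)"
      by (intro nn_integral_cmult continuous_measurable_punctured continuous_intros continuous_Wt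
          Ck_on_2_continuous(1)[OF fde_solD(2)[OF U_sol(1)]] Ck_on_2_continuous(1)[OF fde_solD(2)[OF P0.V_sol]]) auto
    also have "\<dots> \<le> ennreal c * (2 * E (exp \<tau>))"
      by (intro mult_left_mono distance_bound) auto
    finally show ?thesis .
  qed
  have lim: "((\<lambda>\<tau>. ennreal c * (2 * E (exp \<tau>))) \<longlongrightarrow> ennreal c * (2 * 0)) at_top"
    by (intro ennreal_tendsto_cmult E_tendsto) auto
  show ?thesis
    by (rule tendsto_sandwich[OF always_eventually[OF allI[OF zero_le]] always_eventually[OF allI[OF le]] tendsto_const])
       (use lim in simp)
qed

theorem theorem1p5:
  fixes m \<alpha> \<beta> \<gamma> \<mu> A0 A1 A2 lam0 lam1 lam2 :: real
    and \<eta> :: "real \<Rightarrow> real"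
    and f :: "real \<Rightarrow> 'a::euclidean_space \<Rightarrow> real"
    and u0 :: "'a \<Rightarrow> real"
    and u :: "'a \<Rightarrow> real \<Rightarrow> real"
  assumes n: "DIM('a) \<ge> 3"
    and m: "0 < m" "m < (real DIM('a) - 2) / real DIM('a)"
    and \<beta>: "\<beta> < 0"
    and \<alpha>: "\<alpha> = (2 * \<beta> - 1) / (1 - m)"
    and \<gamma>: "\<gamma> = \<alpha> / \<beta>" "real DIM('a) \<le> \<gamma>" "\<gamma> < (real DIM('a) - 2) / m"
    and profiles: "\<And>lam. lam > 0 \<Longrightarrow> self_similar_profile m \<alpha> \<beta> lam (f lam)"
    and A: "A2 \<ge> A0" "A0 \<ge> A1" "A1 > 0"
    and lam: "lam0 = A0 powr ((1 - m) * \<beta>)" "lam1 = A1 powr ((1 - m) * \<beta>)" "lam2 = A2 powr ((1 - m) * \<beta>)"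
    and \<mu>: "0 < \<mu>" "\<mu> < real DIM('a) - 2"
    and \<eta>: "weight_source TYPE('a) \<mu> \<eta>"
    and u0_bounds: "\<And>x. x \<noteq> 0 \<Longrightarrow>
          A1 * norm x powr (- \<gamma>) \<le> u0 x \<and> u0 x \<le> A2 * norm x powr (- \<gamma>)"
    and u0_L1: "(\<lambda>x. u0 x - A0 * norm x powr (- \<gamma>)) \<in> L1_weighted (weight \<eta>)"
    and u: "cauchy_solution m u0 u"
    and u_bounds: "\<And>x t. x \<noteq> 0 \<Longrightarrow> t > 0 \<Longrightarrow>
          self_similar \<alpha> \<beta> (f lam1) x t \<le> u x t \<and>
          u x t \<le> self_similar \<alpha> \<beta> (f lam2) x t"
  shows "(\<forall>K. compact K \<and> K \<subseteq> - {0} \<longrightarrow>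
            uniform_limit K (\<lambda>\<tau> y. rescaled \<alpha> \<beta> u y \<tau>) (f lam0) at_top) \<and>
         ((\<lambda>\<tau>. L1_norm_weighted (weight \<eta>) (- {0})
              (\<lambda>y. rescaled \<alpha> \<beta> u y \<tau> - f lam0 y)) \<longlongrightarrow> 0) at_top"
proof -
  have Ap: "A0 > 0" "A1 > 0" "A2 > 0" using A by auto
  have m1: "m < 1" using m(2) n by (smt (verit) divide_less_eq_1 of_nat_0_le_iff)
  have \<alpha>': "\<alpha> * (1 - m) = 2 * \<beta> - 1" "\<alpha> = \<gamma> * \<beta>" using \<alpha> m1 \<gamma>(1) \<beta> by auto
  have \<gamma>': "m * \<gamma> < real DIM('a) - 2" using \<gamma>(3) m(1) by (simp add: pos_less_divide_eq mult.commute)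
  have P: "profile m \<alpha> \<beta> \<gamma> lam (f lam)" if "lam > 0" for lam
    by unfold_locales (use n m(1) m1 \<beta> \<alpha>' \<gamma>(2) \<gamma>' profiles[OF that] in auto)
  have lp: "lam0 > 0" "lam1 > 0" "lam2 > 0" using Ap lam by auto
  obtain c1 c2 where c: "c1 > 0" "c2 > 0" "\<And>x::'a. c1 * Wt (\<mu> / 2) x \<le> weight \<eta> x" "\<And>x::'a. weight \<eta> x \<le> c2 * Wt (\<mu> / 2) x"
    by (rule weight_equivalent[OF n \<mu> \<eta>]) blast
  let ?g = "\<lambda>x. u0 x - A0 * norm x powr (- \<gamma>)"
  \<comment> \<open>The lower comparison constant transfers finiteness from the given weight to
    \<open>Wt\<close>; measurability is shown in order to move this constant out of the extended
    integral.\<close>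
  have fin: "(\<integral>\<^sup>+x\<in>-{0}. ennreal (\<bar>?g x\<bar> * Wt (\<mu> / 2) x) \<partial>lebesgue) < \<infinity>"
  proof -
    let ?G = "\<lambda>x. ennreal (\<bar>?g x\<bar> * Wt (\<mu> / 2) x) * indicator (- {0}) x"
    have "(\<lambda>x. indicator (- {0}) x * ?g x) \<in> borel_measurable lebesgue"
      by (rule L1_loc_measurable_punctured) (use u0_L1 in \<open>simp add: L1_weighted_def\<close>)
    moreover have "(Wt (\<mu> / 2) :: 'a \<Rightarrow> real) \<in> borel_measurable borel"
      by (rule borel_measurable_continuous_onI[OF continuous_Wt])
    then have "(Wt (\<mu> / 2) :: 'a \<Rightarrow> real) \<in> borel_measurable lebesgue" by (simp add: measurable_completion)
    ultimately have "(\<lambda>x. ennreal (\<bar>indicator (- {0}) x * ?g x\<bar> * Wt (\<mu> / 2) x)) \<in> borel_measurable lebesgue"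
      by measurable
    moreover have "(\<lambda>x. ennreal (\<bar>indicator (- {0}) x * ?g x\<bar> * Wt (\<mu> / 2) x)) = ?G" by (auto simp: indicator_def)
    ultimately have "ennreal c1 * (\<integral>\<^sup>+x. ?G x \<partial>lebesgue) = (\<integral>\<^sup>+x. ennreal c1 * ?G x \<partial>lebesgue)"
      by (intro nn_integral_cmult[symmetric]) simp
    also have "\<dots> \<le> L1_norm_weighted (weight \<eta>) (- {0}) ?g"
      unfolding L1_norm_weighted_def
    proof (rule nn_integral_mono)
      fix x :: 'a
      have "c1 * (\<bar>?g x\<bar> * Wt (\<mu> / 2) x) \<le> \<bar>?g x\<bar> * weight \<eta> x"
        using mult_left_mono[OF c(3)[of x], of "\<bar>?g x\<bar>"] by (simp add: mult_ac)
      then show "ennreal c1 * ?G x \<le> ennreal (\<bar>?g x\<bar> * weight \<eta> x) * indicator (- {0}) x"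
        using c(1) by (simp add: ennreal_mult'[symmetric] ennreal_leI mult.assoc[symmetric] mult_right_mono)
    qed
    also have "\<dots> < \<infinity>" using u0_L1 by (simp add: L1_weighted_def)
    finally show ?thesis using c(1) by (auto simp: ennreal_mult_less_top)
  qed
  \<comment> \<open>With \<nu> = \<mu> / 2 the superharmonicity condition 2 (\<nu> + 1) \<le> n
    reads \<mu> \<le> n - 2.\<close>
  interpret asym m \<alpha> \<beta> \<gamma> lam0 lam1 lam2 "f lam0" "f lam1" "f lam2" "\<mu> / 2" A0 u0 u
  proof (intro asym.intro asym_axioms.intro P lp)
    show "A0 = lam0 powr (1 / ((1 - m) * \<beta>))" using Ap m1 \<beta> unfolding lam by (simp add: powr_powr)
    show "fde_sol m u" "initial_trace u u0"
      using u unfolding cauchy_solution_def fde_sol_def initial_trace_def by blast+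
    show "u0 x \<ge> 0" if "x \<noteq> 0" for x using u that unfolding cauchy_solution_def by blast
  qed (use \<mu> u_bounds fin in auto)
  have resc: "rescaled \<alpha> \<beta> u y \<tau> = U (exp \<tau>) y 1" for y \<tau>
    by (simp add: rescaled_def U_def Let_def)
  have V01: "V0 y 1 = f lam0 y" for y by (simp add: self_similar_def)
  show ?thesis
  proof (intro conjI allI impI, goal_cases)
    case (1 K)
    then show ?case
      unfolding uniform_limit_iff resc dist_real_def using uniform_convergence[of K] by (simp add: V01)
  next
    case 2
    show ?case
      using weighted_convergence[OF c(2,4)] unfolding resc V01 .
  qed
qed

end
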